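(* Let $F$ be a tract, $\Gamma$ an ordered abelian group, and $M$ a (weak or strong) $F[\Gamma]$-matroid on $E$. The vectors and covectors of $M$ are subsets $$\mathcal V(M)\subseteq\{Y\in F[\Gamma]^E:\theta(Y)\in\mathcal V(M^{|Y|})\},\qquad \mathcal V^*(M)\subseteq\{X\in F[\Gamma]^E:\theta(X)\in\mathcal V^*(M^{|X|})\}.$$ Moreover, if $F$ is a perfect tract then these are equalities.
   Context: Tracts. A tract $F=(F^\times,N_F)$ is a multiplicative abelian group $F^\times$ (identity $1$) together with a subset $N_F$ (the null set) of the group semiring $\mathbb N[F^\times]$ of finite formal sums such that: $0\in N_F$; $1\notin N_F$; there is a unique element $-1$ with $1+(-1)\in N_F$; and if $\sum a_i\in N_F$ then $\sum c\,a_i\in N_F$ for all $c\in F^\times$. We also write $F=F^\times\cup\{0\}$ with $0\cdot g=0$; zero terms of formal sums are dropped. A homomorphism of tracts is a group homomorphism $F_1^\times\to F_2^\times$ whose induced map on formal sums sends $N_{F_1}$ into $N_{F_2}$, extended by $0\mapsto0$. Every tract carries a fixed involution $a\mapsto\overline a$ (a tract homomorphism $F\to F$ squaring to the identity); on $F[\Gamma]$ (below) it is $\overline{(a,\gamma)}=(\overline a,\gamma)$. Tropical extension. $\Gamma$ is written additively; $\infty$ is larger than every element of $\Gamma$ and absorbing. $F[\Gamma]$ is the tract with group $F^\times\times\Gamma$, zero element $\infty$, and null set consisting of the zero element and all finite sums $\sum_{i\in I}(a_i,\gamma_i)$ with $\sum_{i\in I_{\min}}a_i\in N_F$, where $I_{\min}=\{i\in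 I:\gamma_i\le\gamma_j\ \forall j\in I\}$. Put $\theta(a,\gamma)=a$, $\theta(\infty)=0$, $|(a,\gamma)|=\gamma$, $|\infty|=\infty$, applied coordinatewise to tuples, so $|X|\in(\Gamma\cup\{\infty\})^E$. Matroids. $E$ is a finite totally ordered set and $1\le r\le|E|$ (duals and minors may have rank $0$, with the same formulas). A strong Plücker vector of rank $r$ on $E$ is a nonzero function $P\colon\binom Er\to F$ with $\sum_{j\in J\setminus I}\operatorname{sign}(j;I,J)P(I+j)P(J-j)\in N_F$ for all $I\in\binom{E}{r-1}$, $J\in\binom{E}{r+1}$, where $\operatorname{sign}(j;I,J)=(-1)^\ell$, $\ell=\#\{j'\in J:j<j'\}+\#\{i\in I:j<i\}$. A weak Plücker vector is a nonzero function which satisfies these relations whenever $|J\setminus I|=3$. A weak (resp. strong) $F$-matroid is an equivalence class of weak (resp. strong) Plücker vectors under scaling by $F^\times$. For $\tau=\{i_0<\dots<i_r\}$ let $(C_\tau)_{i_s}=(-1)^sP(\tau-i_s)$, and $0$ elsewhere; the circuits $\mathcal C(M)\subseteq F^E$ are the $F^\times$-multiples of the nonzero $C_\tau$. An $F$-matroid is determined by its circuits. $X\perp Y$ means $\sum_{i\in E}X_i\overline{Y_i}\in N_F$; $\mathcal X^\perp$ is the set of tuples orthogonal to all elements of $\mathcal X$. The dual $M^*$ has Plücker vector $P^*(I)=\operatorname{sign}(I,I^c)\overline{P(I^c)}$, $I^c=E\setminus I$, where $\operatorname{sign}(I,I^c)$ is the sign of $(I,I^c)$ viewed as a permutation. Covectors: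 $\mathcal V^*(M)=\mathcal C(M)^\perp$. Vectors: $\mathcal V(M)=\mathcal C(M^* )^\perp=\mathcal V^*(M^* )$. $F$ is perfect if $\mathcal V(M)^\perp=\mathcal V^*(M)$ for every $F$-matroid $M$. Contraction and coloops. For $X\in F^E$, $A\subseteq E$, $X\setminus A\in F^{E\setminus A}$ is the restriction. $\operatorname{MinSupp}(\mathcal X)$ is the set of nonzero elements of $\mathcal X$ of inclusion-minimal support. $M/A$ is the $F$-matroid on $E\setminus A$ with circuits $\operatorname{MinSupp}\{C\setminus A:C\in\mathcal C(M)\}$. For $A$ disjoint from the ground set of $M$, $M+_{co\ell}A$ is the $F$-matroid on the union of the ground set with $A$ whose circuits are $\mathcal C(M)\times\{(0,\dots,0)\}$, in which all elements of $A$ are coloops. Initial matroids. For $\mathbf u\in\Gamma^E$ and $M$ with Plücker vector $P\colon\binom Er\to F[\Gamma]$, $M^{\mathbf u}$ is the $F$-matroid with Plücker vector $P^{\mathbf u}(I)=\theta(P(I))$ if $|P(I)|-\sum_{i\in I}u_i\le|P(J)|-\sum_{j\in J}u_j$ for all $J\in\binom Er$, and $0$ otherwise. For $\mathbf u\in(\Gamma\cup\{\infty\})^E$ put $Z_{\mathbf u}=\{i:u_i=\infty\}$, $\mathbf u^\circ=\mathbf u\setminus Z_{\mathbf u}\in\Gamma^{E\setminus Z_{\mathbf u}}$, and $M^{\mathbf u}=(M/Z_{\mathbf u})^{\mathbf u^\circ}+_{co\ell}Z_{\mathbf u}$.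
   Formalization: In the vector half M^{|Y|} is replaced by ((M* )^{|Y|})*, the dual of the initial matroid of M*, since the literal claim fails (already for rank 1 on two elements); weak Plücker vectors are also required to have a matroid's set of bases as support. *)

theory Defs
  imports "HOL-Algebra.Group" "HOL-Library.Multiset" "HOL-Library.Ramsey"
begin

section \<open>Tracts\<close>

text \<open>
  The record carries the multiplicative group $F^\times$; an element of $F = F^\times \cup \{0\}$ is
  an \<open>'a option\<close> with \<open>None\<close> as zero. Elements of the group semiring $\mathbb{N}[F^\times]$ are
  finite multisets over the carrier. The involution is part of the structure.
\<close>

record 'a tract = "'a monoid" +
  null :: "'a multiset set"
  invol :: "'a \<Rightarrow> 'a"

definition tract_hom :: "'a tract \<Rightarrow> 'b tract \<Rightarrow> ('a \<Rightarrow> 'b) set" where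
  "tract_hom F G = {h \<in> hom F G. \<forall>S \<in> null F. image_mset h S \<in> null G}"

locale tract = comm_group F for F :: "'a tract" (structure) +
  assumes null_carrier: "S \<in> null F \<Longrightarrow> set_mset S \<subseteq> carrier F"
    and zero_null: "{#} \<in> null F"
    and one_not_null: "{#\<one>#} \<notin> null F"
    and unique_neg_one: "\<exists>!e. e \<in> carrier F \<and> {#\<one>, e#} \<in> null F"
    and null_scale: "\<lbrakk>S \<in> null F; c \<in> carrier F\<rbrakk> \<Longrightarrow> image_mset (\<lambda>a. c \<otimes> a) S \<in> null F"
    and invol_hom: "invol F \<in> tract_hom F F"
    and invol_invol: "a \<in> carrier F \<Longrightarrow> invol F (invol F a) = a"

definition neg_one :: "'a tract \<Rightarrow> 'a" where
  "neg_one F = (THE e. e \<in> carrier F \<and> {#\<one>\<^bsub>F\<^esub>, e#} \<in> null F)"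

definition elems :: "'a tract \<Rightarrow> 'a option set" where
  "elems F = insert None (Some ` carrier F)"

definition tmul :: "'a tract \<Rightarrow> 'a option \<Rightarrow> 'a option \<Rightarrow> 'a option" where
  "tmul F x y = (case (x, y) of (Some a, Some b) \<Rightarrow> Some (a \<otimes>\<^bsub>F\<^esub> b) | _ \<Rightarrow> None)"

definition tconj :: "'a tract \<Rightarrow> 'a option \<Rightarrow> 'a option" where
  "tconj F = map_option (invol F)"

text \<open>$(-1)^n x$\<close>

definition signed :: "'a tract \<Rightarrow> nat \<Rightarrow> 'a option \<Rightarrow> 'a option" where
  "signed F n x = tmul F (Some (neg_one F [^]\<^bsub>F\<^esub> n)) x"

text \<open>The formal sum $\sum_{i \in A} f(i)$ for finite \<open>A\<close>, zero terms being dropped.\<close>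

definition formal_sum :: "('i \<Rightarrow> 'a option) \<Rightarrow> 'i set \<Rightarrow> 'a multiset" where
  "formal_sum f A = image_mset (\<lambda>i. the (f i)) (mset_set {i \<in> A. f i \<noteq> None})"


section \<open>Tropical extensions\<close>

definition trop_ext :: "'a tract \<Rightarrow> ('a \<times> 'g::linordered_ab_group_add) tract" where
  "trop_ext F =
    \<lparr>carrier = carrier F \<times> UNIV,
     monoid.mult = (\<lambda>(a, \<gamma>) (b, \<delta>). (a \<otimes>\<^bsub>F\<^esub> b, \<gamma> + \<delta>)),
     one = (\<one>\<^bsub>F\<^esub>, 0),
     null = {S. set_mset S \<subseteq> carrier F \<times> UNIV \<and>
               (S = {#} \<or>
                image_mset fst (filter_mset (\<lambda>x. \<forall>y \<in># S. snd x \<le> snd y) S) \<in> null F)},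
     invol = (\<lambda>(a, \<gamma>). (invol F a, \<gamma>))\<rparr>"

definition theta :: "('a \<times> 'g) option \<Rightarrow> 'a option" where
  "theta = map_option fst"

text \<open>An element of $\Gamma \cup \{\infty\}$ is a \<open>'g option\<close> with \<open>None\<close> as $\infty$, the largest
  element (this is not the order of \<open>HOL-Library.Option_ord\<close>).\<close>

definition val :: "('a \<times> 'g) option \<Rightarrow> 'g option" where
  "val = map_option snd"

definition le_infty :: "'g::linorder option \<Rightarrow> 'g option \<Rightarrow> bool" where
  "le_infty x y = (case y of None \<Rightarrow> True | Some b \<Rightarrow> (case x of None \<Rightarrow> False | Some a \<Rightarrow> a \<le> b))"


section \<open>Tuples\<close>

text \<open>A tuple in $F^E$ is a function on the whole type that is zero outside \<open>E\<close>. Extension of a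
  tuple by zeros to a larger index set is then the identity.\<close>

definition tuples :: "'a tract \<Rightarrow> 'e set \<Rightarrow> ('e \<Rightarrow> 'a option) set" where
  "tuples F E = {X. (\<forall>i \<in> E. X i \<in> elems F) \<and> (\<forall>i. i \<notin> E \<longrightarrow> X i = None)}"

definition supp :: "('e \<Rightarrow> 'a option) \<Rightarrow> 'e set" where
  "supp X = {i. X i \<noteq> None}"

definition remove_coords :: "('e \<Rightarrow> 'a option) \<Rightarrow> 'e set \<Rightarrow> 'e \<Rightarrow> 'a option" where
  "remove_coords X A = (\<lambda>i. if i \<in> A then None else X i)"

definition MinSupp :: "('e \<Rightarrow> 'a option) set \<Rightarrow> ('e \<Rightarrow> 'a option) set" where
  "MinSupp \<X> = {X \<in> \<X>. supp X \<noteq> {} \<and> \<not> (\<exists>Y \<in> \<X>. supp Y \<noteq> {} \<and> supp Y \<subset> supp X)}"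

definition orthogonal :: "'a tract \<Rightarrow> 'e set \<Rightarrow> ('e \<Rightarrow> 'a option) \<Rightarrow> ('e \<Rightarrow> 'a option) \<Rightarrow> bool" where
  "orthogonal F E X Y \<longleftrightarrow> formal_sum (\<lambda>i. tmul F (X i) (tconj F (Y i))) E \<in> null F"

definition perp :: "'a tract \<Rightarrow> 'e set \<Rightarrow> ('e \<Rightarrow> 'a option) set \<Rightarrow> ('e \<Rightarrow> 'a option) set" where
  "perp F E \<X> = {Y \<in> tuples F E. \<forall>X \<in> \<X>. orthogonal F E Y X}"


section \<open>Matroids over tracts\<close>

text \<open>A function $P : \binom{E}{r} \to F$ is represented by its extension by zero to all sets.\<close>

definition plucker_fun ::
  "'a tract \<Rightarrow> 'e set \<Rightarrow> nat \<Rightarrow> ('e set \<Rightarrow> 'a option) \<Rightarrow> bool" where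
  "plucker_fun F E r P \<longleftrightarrow>
     (\<forall>I. P I \<in> elems F) \<and> (\<forall>I. I \<notin> nsets E r \<longrightarrow> P I = None) \<and> (\<exists>I. P I \<noteq> None)"

definition plucker_rel ::
  "'a tract \<Rightarrow> ('e::linorder set \<Rightarrow> 'a option) \<Rightarrow> 'e set \<Rightarrow> 'e set \<Rightarrow> bool" where
  "plucker_rel F P I J \<longleftrightarrow>
     formal_sum
       (\<lambda>j. signed F (card {j' \<in> J. j < j'} + card {i \<in> I. j < i})
              (tmul F (P (insert j I)) (P (J - {j}))))
       (J - I) \<in> null F"

definition strong_plucker ::
  "'a tract \<Rightarrow> 'e::linorder set \<Rightarrow> nat \<Rightarrow> ('e set \<Rightarrow> 'a option) \<Rightarrow> bool" where
  "strong_plucker F E r P \<longleftrightarrow>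
     plucker_fun F E r P \<and>
     (\<forall>I J. I \<subseteq> E \<and> J \<subseteq> E \<and> Suc (card I) = r \<and> card J = Suc r \<longrightarrow> plucker_rel F P I J)"

text \<open>
  For weak Pluecker vectors the support is required to be the set of bases of a matroid, as is
  standard. For strong ones this is automatic, but it does not follow from the
  three-term relations: a function on $\binom{\{1,\dots,6\}}{3}$ supported on
  $\{\{1,2,3\},\{4,5,6\}\}$ satisfies all of them vacuously.
\<close>

definition basis_exchange :: "'e set set \<Rightarrow> bool" where
  "basis_exchange \<B> \<longleftrightarrow>
     (\<forall>I \<in> \<B>. \<forall>J \<in> \<B>. \<forall>i \<in> I - J. \<exists>j \<in> J - I. insert j (I - {i}) \<in> \<B>)"

definition weak_plucker ::
  "'a tract \<Rightarrow> 'e::linorder set \<Rightarrow> nat \<Rightarrow> ('e set \<Rightarrow> 'a option) \<Rightarrow> bool" where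
  "weak_plucker F E r P \<longleftrightarrow>
     plucker_fun F E r P \<and> basis_exchange {I. P I \<noteq> None} \<and>
     (\<forall>I J. I \<subseteq> E \<and> J \<subseteq> E \<and> Suc (card I) = r \<and> card J = Suc r \<and> card (J - I) = 3
        \<longrightarrow> plucker_rel F P I J)"

definition scale_class :: "'a tract \<Rightarrow> ('e set \<Rightarrow> 'a option) \<Rightarrow> ('e set \<Rightarrow> 'a option) set" where
  "scale_class F P = {\<lambda>I. tmul F (Some c) (P I) | c. c \<in> carrier F}"

record ('e, 'a) fmatroid =
  ground :: "'e set"
  rk :: nat
  pluckers :: "('e set \<Rightarrow> 'a option) set"

datatype strength = Weak | Strong

fun is_plucker :: "strength \<Rightarrow> 'a tract \<Rightarrow> 'e::linorder set \<Rightarrow> nat \<Rightarrow> ('e set \<Rightarrow> 'a option) \<Rightarrow> bool" where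
  "is_plucker Weak = weak_plucker"
| "is_plucker Strong = strong_plucker"

definition is_fmatroid :: "strength \<Rightarrow> 'a tract \<Rightarrow> ('e::linorder, 'a) fmatroid \<Rightarrow> bool" where
  "is_fmatroid k F M \<longleftrightarrow>
     finite (ground M) \<and>
     (\<exists>P. is_plucker k F (ground M) (rk M) P \<and> pluckers M = scale_class F P)"

definition fund_circuit ::
  "'a tract \<Rightarrow> ('e::linorder set \<Rightarrow> 'a option) \<Rightarrow> 'e set \<Rightarrow> 'e \<Rightarrow> 'a option" where
  "fund_circuit F P \<tau> = (\<lambda>i. if i \<in> \<tau> then signed F (card {i' \<in> \<tau>. i' < i}) (P (\<tau> - {i})) else None)"

definition circuits :: "'a tract \<Rightarrow> ('e::linorder, 'a) fmatroid \<Rightarrow> ('e \<Rightarrow> 'a option) set" where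
  "circuits F M =
     {\<lambda>i. tmul F (Some c) (fund_circuit F P \<tau> i) | c P \<tau>.
        c \<in> carrier F \<and> P \<in> pluckers M \<and> \<tau> \<in> nsets (ground M) (Suc (rk M)) \<and>
        supp (fund_circuit F P \<tau>) \<noteq> {}}"

text \<open>The exponent is the number of inversions of the word listing first \<open>I\<close> and then
  \<open>E - I\<close>, each increasingly.\<close>

definition dual_plucker ::
  "'a tract \<Rightarrow> 'e::linorder set \<Rightarrow> ('e set \<Rightarrow> 'a option) \<Rightarrow> 'e set \<Rightarrow> 'a option" where
  "dual_plucker F E P = (\<lambda>I. if I \<subseteq> E
     then signed F (card {(i, j). i \<in> I \<and> j \<in> E - I \<and> j < i}) (tconj F (P (E - I)))
     else None)"

definition dual :: "'a tract \<Rightarrow> ('e::linorder, 'a) fmatroid \<Rightarrow> ('e, 'a) fmatroid" where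
  "dual F M = \<lparr>ground = ground M, rk = card (ground M) - rk M,
               pluckers = dual_plucker F (ground M) ` pluckers M\<rparr>"

definition covectors :: "'a tract \<Rightarrow> ('e::linorder, 'a) fmatroid \<Rightarrow> ('e \<Rightarrow> 'a option) set" where
  "covectors F M = perp F (ground M) (circuits F M)"

definition vectors :: "'a tract \<Rightarrow> ('e::linorder, 'a) fmatroid \<Rightarrow> ('e \<Rightarrow> 'a option) set" where
  "vectors F M = perp F (ground M) (circuits F (dual F M))"

text \<open>Every finite totally ordered set is order isomorphic to a finite set of natural numbers, so
  quantifying over matroids on the latter covers all matroids. The parameter says whether
  \<open>F\<close>-matroid is read as weak or as strong; being perfect for weak matroids implies being
  perfect for strong ones.\<close>

definition perfect :: "strength \<Rightarrow> 'a tract \<Rightarrow> bool" where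
  "perfect k F \<longleftrightarrow>
     (\<forall>M :: (nat, 'a) fmatroid. is_fmatroid k F M \<longrightarrow>
        perp F (ground M) (vectors F M) = covectors F M)"


section \<open>Contractions, coloops and initial matroids\<close>

text \<open>Strong matroids are weak and matroids are determined by their circuits, so the following
  descriptions are definite for both strengths.\<close>

definition contract :: "'a tract \<Rightarrow> ('e::linorder, 'a) fmatroid \<Rightarrow> 'e set \<Rightarrow> ('e, 'a) fmatroid" where
  "contract F M A = (THE N. is_fmatroid Weak F N \<and> ground N = ground M - A \<and>
     circuits F N = MinSupp ((\<lambda>C. remove_coords C A) ` circuits F M))"

definition add_coloops :: "'a tract \<Rightarrow> ('e::linorder, 'a) fmatroid \<Rightarrow> 'e set \<Rightarrow> ('e, 'a) fmatroid" where
  "add_coloops F M A = (THE N. is_fmatroid Weak F N \<and> ground N = ground M \<union> A \<and>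
     circuits F N = circuits F M)"

definition initial_plucker ::
  "'e set \<Rightarrow> nat \<Rightarrow> ('e \<Rightarrow> 'g::linordered_ab_group_add) \<Rightarrow> ('e set \<Rightarrow> ('a \<times> 'g) option)
     \<Rightarrow> 'e set \<Rightarrow> 'a option" where
  "initial_plucker E r w P = (\<lambda>I.
     if I \<in> nsets E r \<and>
        (\<forall>J \<in> nsets E r. le_infty (map_option (\<lambda>\<gamma>. \<gamma> - sum w I) (val (P I)))
                                   (map_option (\<lambda>\<gamma>. \<gamma> - sum w J) (val (P J))))
     then theta (P I) else None)"

definition initial_fin ::
  "('e, 'a \<times> 'g::linordered_ab_group_add) fmatroid \<Rightarrow> ('e \<Rightarrow> 'g) \<Rightarrow> ('e, 'a) fmatroid" where
  "initial_fin M w = \<lparr>ground = ground M, rk = rk M,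
                      pluckers = initial_plucker (ground M) (rk M) w ` pluckers M\<rparr>"

definition initial ::
  "'a tract \<Rightarrow> ('e::linorder, 'a \<times> 'g::linordered_ab_group_add) fmatroid \<Rightarrow> ('e \<Rightarrow> 'g option)
     \<Rightarrow> ('e, 'a) fmatroid" where
  "initial F M u =
     (let Z = {i \<in> ground M. u i = None}
      in add_coloops F (initial_fin (contract (trop_ext F) M Z) (\<lambda>i. the (u i))) Z)"

text \<open>
  The initial matroid as seen from the vectors, obtained by taking the initial matroid of the dual:
  since vectors are the covectors of the dual, this is what a vector \<open>Y\<close> with valuation \<open>u\<close> is
  compared with. It differs from \<open>initial F M u\<close>. For finite \<open>u\<close> it is $M^{-\mathbf u}$, and
  elements with $u_i = \infty$ are deleted and added back as loops, instead of being contracted and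
  added back as coloops. For example, let \<open>M\<close> be of rank 1 on $\{1,2\}$ with $P(1) = (1,0)$ and
  $P(2) = (1,1)$. Then $Y = ((1,1),(-1,0))$ is a vector of \<open>M\<close>, whereas $\theta(Y) = (1,-1)$ is not
  a vector of $M^{(1,0)}$, in which 1 is the only basis element and 2 is a loop.
\<close>

definition coinitial ::
  "'a tract \<Rightarrow> ('e::linorder, 'a \<times> 'g::linordered_ab_group_add) fmatroid \<Rightarrow> ('e \<Rightarrow> 'g option)
     \<Rightarrow> ('e, 'a) fmatroid" where
  "coinitial F M u = dual F (initial F (dual (trop_ext F) M) u)"

end

theory Submission
  imports Defs
begin

text \<open>
  Vectors of $M$ are covectors of $M^*$, so only covectors matter. A fundamental circuit of an
  initial matroid consists of the terms of minimal weight of a fundamental circuit of $M$, whence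
  the leading terms of an orthogonality relation over the tropical extension form one over $F$.
  Conversely, if $F$ is perfect, each circuit of $M$ is a vector of $M$, since weak matroids over
  the tropical extension are then strong; its leading part is a vector of the initial matroid, hence
  orthogonal to $\theta(X)$, and this says precisely that the circuit is orthogonal to $X$.
\<close>

section \<open>Matroid bases\<close>

text \<open>Two obstacles shape the argument. For weak matroids the support of an initial Pluecker
  vector must be shown to be a matroid, which the three-term relations alone do not give. Exchange
  is therefore proved for the bases minimizing a tilted valuation, starting from exchange at
  distance 2, which is what three-term relations provide; the weight itself is changed inside the
  induction. The second obstacle is that a circuit of a weak matroid is orthogonal to the cocircuits
  only once the relations for all I and J are known. In the critical case the cocircuit of I and the
  circuit of J have no zero on J - I, and the relation becomes a pairing in a rank 2 minor; there
  the covector has finite weights, and passing to leading terms reduces the claim to perfectness of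
  F. Zero coordinates of a covector are contracted along a maximum independent subset K of them;
  maximality of K kills the terms of a relation at the remaining zeros. Contractions and coloops are
  definite descriptions in terms of circuits, hence the proof that a matroid is determined by its
  circuits.\<close>

lemma basis_exchangeD:
  assumes "basis_exchange \<B>" "I \<in> \<B>" "J \<in> \<B>" "i \<in> I" "i \<notin> J"
  obtains j where "j \<in> J" "j \<notin> I" "insert j (I - {i}) \<in> \<B>"
  using assms unfolding basis_exchange_def by blast

locale bases =
  fixes E :: "'e set" and r :: nat and \<B> :: "'e set set"
  assumes finite_ground: "finite E"
    and subset_nsets: "\<B> \<subseteq> nsets E r"
    and exchange: "basis_exchange \<B>"
begin

lemma basisD:
  assumes "B \<in> \<B>"
  shows "B \<subseteq> E" "finite B" "card B = r"
  using assms subset_nsets unfolding nsets_def by auto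

lemma card_Diff_basis:
  assumes "A \<in> \<B>" "B \<in> \<B>"
  shows "card (A - B) = card (B - A)"
  using assms by (metis Int_commute basisD(2,3) card_Diff_subset_Int finite_Int)

lemma basis_diff_obtain:
  assumes "A \<in> \<B>" "B \<in> \<B>" "A \<noteq> B"
  obtains x where "x \<in> A" "x \<notin> B"
proof -
  have "\<not> A \<subseteq> B" using assms card_subset_eq[of B A] basisD by auto
  then show ?thesis using that by blast
qed

text \<open>Among the bases that contain \<open>e\<close> and lie between
  \<open>B \<inter> B'\<close> and \<open>B \<union> B'\<close>, take \<open>A\<close> closest to
  \<open>B\<close>. An element of \<open>A - B\<close> other than \<open>e\<close> could be
  exchanged for one of \<open>B\<close>, bringing \<open>A\<close> closer; hence \<open>A\<close> is
  \<open>B\<close> with \<open>e\<close> in place of a single \<open>y\<close>.\<close>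

lemma dual_exchange:
  assumes B: "B \<in> \<B>" and B': "B' \<in> \<B>" and e: "e \<in> B'" "e \<notin> B"
  obtains y where "y \<in> B" "y \<notin> B'" "insert e (B - {y}) \<in> \<B>"
proof -
  let ?S = "\<lambda>A. A \<in> \<B> \<and> e \<in> A \<and> B \<inter> B' \<subseteq> A \<and> A \<subseteq> B \<union> B'"
  have "?S B'" using B' e by auto
  then obtain A where A: "?S A" and min: "\<And>C. ?S C \<Longrightarrow> card (A - B) \<le> card (C - B)"
    using ex_has_least_nat[of ?S B' "\<lambda>A. card (A - B)"] by blast
  have fA: "finite A" using A basisD by blast
  have AB: "A - B = {e}"
  proof (rule ccontr)
    assume "A - B \<noteq> {e}"
    then obtain i where i: "i \<in> A" "i \<notin> B" "i \<noteq> e" using A e by auto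
    obtain j where j: "j \<in> B" "j \<notin> A" "insert j (A - {i}) \<in> \<B>"
      using basis_exchangeD[OF exchange _ B i(1,2)] A by auto
    have "?S (insert j (A - {i}))" using A i j by auto
    then have "card (A - B) \<le> card (insert j (A - {i}) - B)" by (rule min)
    also have "insert j (A - {i}) - B = (A - B) - {i}" using j by auto
    finally show False using i fA by (metis card_Diff1_less_iff DiffI finite_Diff leD)
  qed
  have "card (B - A) = 1" using card_Diff_basis[of A B] A B AB by simp
  then obtain y where y: "B - A = {y}" by (auto simp: card_1_singleton_iff)
  have "A = insert e (B - {y})" using AB y by auto
  moreover have "y \<in> B" "y \<notin> B'" using y A by auto
  ultimately show ?thesis using that A by blast
qed

text \<open>Take a basis containing \<open>A\<close> with as few elements as possible outside
  \<open>A \<union> B\<close>; any such element could be exchanged for one of \<open>B\<close>. This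
  is the usual extension of an independent set by elements of a basis.\<close>

lemma augment:
  assumes B1: "B1 \<in> \<B>" and A: "A \<subseteq> B1" and B: "B \<in> \<B>"
  obtains B2 where "B2 \<in> \<B>" "A \<subseteq> B2" "B2 \<subseteq> A \<union> B"
proof -
  let ?S = "\<lambda>X. X \<in> \<B> \<and> A \<subseteq> X"
  obtain X where X: "?S X" and min: "\<And>C. ?S C \<Longrightarrow> card (X - (A \<union> B)) \<le> card (C - (A \<union> B))"
    using ex_has_least_nat[of ?S B1 "\<lambda>X. card (X - (A \<union> B))"] A B1 by blast
  have fX: "finite X" using X basisD by blast
  have "X \<subseteq> A \<union> B"
  proof (rule ccontr)
    assume "\<not> X \<subseteq> A \<union> B"
    then obtain i where i: "i \<in> X" "i \<notin> A" "i \<notin> B" by auto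
    obtain j where j: "j \<in> B" "j \<notin> X" "insert j (X - {i}) \<in> \<B>"
      using basis_exchangeD[OF exchange _ B i(1,3)] X by auto
    have "?S (insert j (X - {i}))" using X i j by auto
    then have "card (X - (A \<union> B)) \<le> card (insert j (X - {i}) - (A \<union> B))" by (rule min)
    also have "insert j (X - {i}) - (A \<union> B) = (X - (A \<union> B)) - {i}" using j by auto
    finally show False using i fX by (metis card_Diff1_less_iff DiffI UnE finite_Diff leD)
  qed
  then show ?thesis using that X by blast
qed

text \<open>If \<open>\<tau>\<close> has \<open>r + 1\<close> elements and contains a basis, this is
  the unique circuit inside \<open>\<tau>\<close>; if it contains no basis, the set is
  empty.\<close>

definition circ :: "'e set \<Rightarrow> 'e set" where
  "circ \<tau> = {x \<in> \<tau>. \<tau> - {x} \<in> \<B>}"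

text \<open>If \<open>B\<close> contained the circuit, it would contain some \<open>i\<close> with
  \<open>\<tau> - {i}\<close> a basis. Bringing \<open>i\<close> into that basis by dual exchange
  against \<open>B\<close> removes some \<open>y\<close> outside \<open>B\<close>, and then
  \<open>y\<close> belongs to the circuit.\<close>

lemma circ_not_subset_basis:
  assumes "circ \<tau> \<noteq> {}" "B \<in> \<B>"
  shows "\<not> circ \<tau> \<subseteq> B"
proof
  assume sub: "circ \<tau> \<subseteq> B"
  obtain i where i: "i \<in> \<tau>" "\<tau> - {i} \<in> \<B>" using assms unfolding circ_def by auto
  have "i \<in> B" using i sub unfolding circ_def by auto
  then obtain y where y: "y \<in> \<tau> - {i}" "y \<notin> B" "insert i (\<tau> - {i} - {y}) \<in> \<B>"
    using dual_exchange[OF i(2) assms(2)] by blast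
  have "insert i (\<tau> - {i} - {y}) = \<tau> - {y}" using i y by auto
  then have "y \<in> circ \<tau>" using y unfolding circ_def by auto
  then show False using sub y by auto
qed

text \<open>Choose a basis \<open>B\<close> missing as little of \<open>A\<close> as possible. For a
  missing \<open>e\<close>, the circuit inside \<open>insert e B\<close> has an element outside
  \<open>A\<close>; swapping that element for \<open>e\<close> gives a better basis.\<close>

lemma circuit_free_subset_basis:
  assumes ne: "\<B> \<noteq> {}" and A: "A \<subseteq> E"
    and free: "\<And>\<tau>. \<tau> \<in> nsets E (Suc r) \<Longrightarrow> circ \<tau> \<noteq> {} \<Longrightarrow> \<not> circ \<tau> \<subseteq> A"
  obtains B where "B \<in> \<B>" "A \<subseteq> B"
proof -
  have "finite A" using A finite_ground finite_subset by blast
  obtain B0 where "B0 \<in> \<B>" using ne by auto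
  then obtain B where B: "B \<in> \<B>" and min: "\<And>C. C \<in> \<B> \<Longrightarrow> card (A - B) \<le> card (A - C)"
    using ex_has_least_nat[of "\<lambda>B. B \<in> \<B>" B0 "\<lambda>B. card (A - B)"] by blast
  have "A \<subseteq> B"
  proof (rule ccontr)
    assume "\<not> A \<subseteq> B"
    then obtain e where e: "e \<in> A" "e \<notin> B" by auto
    let ?t = "insert e B"
    have t: "?t \<in> nsets E (Suc r)" using e A basisD[OF B] by (auto simp: nsets_def)
    have et: "e \<in> circ ?t" using e B by (auto simp: circ_def)
    then obtain x where x: "x \<in> circ ?t" "x \<notin> A" using free[OF t] by auto
    then have xb: "?t - {x} \<in> \<B>" "x \<noteq> e" "x \<in> B" using e by (auto simp: circ_def)
    have "A - (?t - {x}) = (A - B) - {e}" using x by auto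
    then show False using min[OF xb(1)] e \<open>finite A\<close>
      by (metis card_Diff1_less_iff DiffI finite_Diff leD)
  qed
  then show ?thesis using that B by blast
qed

text \<open>When \<open>v\<close> is the valuation of a Pluecker vector over the tropical extension,
  these are the bases of its initial matroid at the finite weight \<open>u\<close>.\<close>

definition minimizers :: "('e set \<Rightarrow> 'g::linordered_ab_group_add) \<Rightarrow> ('e \<Rightarrow> 'g) \<Rightarrow> 'e set set" where
  "minimizers v u = {B \<in> \<B>. \<forall>B' \<in> \<B>. v B - sum u B \<le> v B' - sum u B'}"

text \<open>
  If no minimizer of \<open>v - u\<close> lies strictly between two minimizers \<open>I\<close> and \<open>J\<close> at distance at
  least 3, then tilting \<open>u\<close> towards some \<open>i0 \<in> I - J\<close> and \<open>j0 \<in> J - I\<close> (and towards the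
  interval from \<open>I \<inter> J\<close> to \<open>I \<union> J\<close>) until the first basis containing both becomes a minimizer
  keeps \<open>I\<close> and \<open>J\<close> minimal; exchanges at smaller distance then lead to a contradiction.
\<close>

lemma minimizers_tilt:
  fixes v :: "'e set \<Rightarrow> 'g::linordered_ab_group_add"
  assumes I: "I \<in> minimizers v u" and J: "J \<in> minimizers v u"
    and i0: "i0 \<in> I" "i0 \<notin> J" and j0: "j0 \<in> J" "j0 \<notin> I"
    and K0: "K0 \<in> \<B>" "I \<inter> J \<subseteq> K0" "K0 \<subseteq> I \<union> J" "i0 \<in> K0" "j0 \<in> K0"
    and none: "\<And>K. K \<in> minimizers v u \<Longrightarrow> I \<inter> J \<subseteq> K \<Longrightarrow> K \<subseteq> I \<union> J \<Longrightarrow> K = I \<or> K = J"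
  obtains u' K where "I \<in> minimizers v u'" "J \<in> minimizers v u'" "K \<in> minimizers v u'"
    "I \<inter> J \<subseteq> K" "K \<subseteq> I \<union> J" "i0 \<in> K" "j0 \<in> K"
    "\<And>L. L \<in> minimizers v u' \<Longrightarrow> I \<inter> J \<subseteq> L \<Longrightarrow> L \<subseteq> I \<union> J \<Longrightarrow> L \<noteq> I \<Longrightarrow> L \<noteq> J
      \<Longrightarrow> i0 \<in> L \<and> j0 \<in> L"
proof -
  have IB: "I \<in> \<B>" and JB: "J \<in> \<B>" using I J unfolding minimizers_def by auto
  define g where "g K = v K - sum u K" for K
  have gI: "\<And>K. K \<in> \<B> \<Longrightarrow> g I \<le> g K" using I unfolding minimizers_def g_def by auto
  have gJ: "g J = g I" using I J unfolding minimizers_def g_def by (auto intro: antisym)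
  define \<K> where "\<K> = {K \<in> \<B>. I \<inter> J \<subseteq> K \<and> K \<subseteq> I \<union> J \<and> i0 \<in> K \<and> j0 \<in> K}"
  have "finite \<B>" using subset_nsets finite_ground
    by (meson finite_imp_finite_nsets finite_subset)
  then have "finite \<K>" "\<K> \<noteq> {}" using K0 unfolding \<K>_def by auto
  then obtain K where K: "K \<in> \<K>" and Kmin: "\<And>L. L \<in> \<K> \<Longrightarrow> g K \<le> g L"
    using arg_min_if_finite[of \<K> g] by (metis linorder_not_le)
  \<comment> \<open>The gap between the optimum and the best basis of the interval that contains
    both \<open>i0\<close> and \<open>j0\<close>. It is positive by \<open>none\<close>, because
    such a basis is neither \<open>I\<close> nor \<open>J\<close>.\<close>
  define t where "t = g K - g I"
  have min_iff: "L \<in> minimizers v u \<longleftrightarrow> L \<in> \<B> \<and> g L \<le> g I" for L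
    using gI IB unfolding minimizers_def g_def by (auto intro: order_trans)
  have "g I < g K"
    using none[of K] K i0 j0 min_iff[of K] unfolding \<K>_def by force
  then have t: "0 < t" by (simp add: t_def)
  define p where "p = insert i0 (insert j0 (I \<inter> J))"
  \<comment> \<open>Each element of \<open>p\<close> earns \<open>t\<close> and each element outside
    \<open>I \<union> J\<close> costs \<open>t\<close>. A basis in \<open>\<K>\<close> collects the
    full amount \<open>\<tau>\<close>, whereas \<open>I\<close> and \<open>J\<close> miss exactly
    one element of \<open>p\<close>; the difference just closes the gap \<open>t\<close>.\<close>
  define w where "w x = (if x \<in> p then t else if x \<in> I \<union> J then 0 else - t)" for x
  define \<tau> where "\<tau> = sum (\<lambda>_. t) p"
  have fin: "finite I" "finite J" "finite p" using basisD IB JB by (auto simp: p_def)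
  have wsplit: "sum w L = sum (\<lambda>_. t) (L \<inter> p) + sum (\<lambda>_. - t) (L - (I \<union> J))" if "finite L" for L
  proof -
    have pIJ: "p \<subseteq> I \<union> J" using i0 j0 by (auto simp: p_def)
    have "sum w L = sum w (L \<inter> p) + sum w (L - p)" using that by (metis sum.Int_Diff)
    also have "sum w (L - p) = sum w (L - (I \<union> J))"
      using that pIJ by (intro sum.mono_neutral_right) (auto simp: w_def)
    also have "sum w (L - (I \<union> J)) = sum (\<lambda>_. - t) (L - (I \<union> J))"
      using pIJ by (intro sum.cong) (auto simp: w_def)
    also have "sum w (L \<inter> p) = sum (\<lambda>_. t) (L \<inter> p)"
      by (intro sum.cong) (auto simp: w_def)
    finally show ?thesis .
  qed
  have less: "sum (\<lambda>_. t) (L \<inter> p) \<le> \<tau> - t" if "x \<in> p" "x \<notin> L" for x L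
  proof -
    have "sum (\<lambda>_. t) (L \<inter> p) \<le> sum (\<lambda>_. t) (p - {x})"
      using that fin t by (intro sum_mono2) auto
    also have "\<dots> = \<tau> - t" unfolding \<tau>_def using fin that by (simp add: sum_diff1)
    finally show ?thesis .
  qed
  have wI: "sum w I = \<tau> - t"
  proof -
    have e: "I \<inter> p = p - {j0}" "I - (I \<union> J) = {}" using i0 j0 by (auto simp: p_def)
    have "sum (\<lambda>_. t) (p - {j0}) = \<tau> - t"
      using fin i0 j0 by (simp add: \<tau>_def sum_diff1 p_def)
    then show ?thesis unfolding wsplit[OF fin(1)] e by simp
  qed
  have wJ: "sum w J = \<tau> - t"
  proof -
    have e: "J \<inter> p = p - {i0}" "J - (I \<union> J) = {}" using i0 j0 by (auto simp: p_def)
    have "sum (\<lambda>_. t) (p - {i0}) = \<tau> - t"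
      using fin i0 j0 by (simp add: \<tau>_def sum_diff1 p_def)
    then show ?thesis unfolding wsplit[OF fin(2)] e by simp
  qed
  have wK: "sum w L = \<tau>" if "L \<in> \<K>" for L
  proof -
    have e: "L \<inter> p = p" "L - (I \<union> J) = {}" using that by (auto simp: p_def \<K>_def)
    have "finite L" using that basisD by (auto simp: \<K>_def)
    then show ?thesis unfolding wsplit[OF \<open>finite L\<close>] e by (simp add: \<tau>_def)
  qed
  \<comment> \<open>A basis outside \<open>\<K>\<close> either misses an element of \<open>p\<close>
    or contains \<open>p\<close> and also an element outside \<open>I \<union> J\<close>; either way
    it falls short by at least \<open>t\<close>.\<close>
  have wL: "sum w L \<le> \<tau> - t" if L: "L \<in> \<B>" "L \<notin> \<K>" for L
  proof (cases "p \<subseteq> L")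
    case True
    have fL: "finite L" using that basisD by auto
    obtain x where x: "x \<in> L" "x \<notin> I \<union> J" using True L unfolding p_def \<K>_def by blast
    have "sum (\<lambda>_. - t) (L - (I \<union> J)) \<le> sum (\<lambda>_. - t) {x}"
    proof -
      have "sum (\<lambda>_. t) {x} \<le> sum (\<lambda>_. t) (L - (I \<union> J))"
        using x fL t by (intro sum_mono2) auto
      then show ?thesis by (simp add: sum_negf)
    qed
    moreover have "L \<inter> p = p" using True by auto
    ultimately show ?thesis using wsplit[OF fL] by (simp add: \<tau>_def)
  next
    case False
    then obtain x where x: "x \<in> p" "x \<notin> L" by auto
    have fL: "finite L" using that basisD by auto
    have "sum (\<lambda>_. - t) (L - (I \<union> J)) \<le> 0" using t by (intro sum_nonpos) auto
    then show ?thesis using less[OF x] wsplit[OF fL] by (metis add.right_neutral add_mono)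
  qed
  define u' where "u' x = u x + w x" for x
  have gu': "v L - sum u' L = g L - sum w L" for L
    by (simp add: u'_def g_def sum.distrib)
  have low: "g I - (\<tau> - t) \<le> g L - sum w L" if "L \<in> \<B>" for L
  proof (cases "L \<in> \<K>")
    case True
    have "g I + t \<le> g L" using Kmin[OF True] by (simp add: t_def)
    then show ?thesis using wK[OF True] by (simp add: algebra_simps)
  next
    case False
    show ?thesis using wL[OF that False] gI[OF that] by (rule diff_mono[rotated])
  qed
  have min'_iff: "L \<in> minimizers v u' \<longleftrightarrow> L \<in> \<B> \<and> g L - sum w L \<le> g I - (\<tau> - t)" for L
    unfolding minimizers_def gu' using low IB wI by (auto intro: order_trans)
  \<comment> \<open>Otherwise \<open>L\<close> gains no more from the tilt than \<open>I\<close>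
    does, so it was already a minimizer for \<open>u\<close>, and there only \<open>I\<close> and
    \<open>J\<close> lie in the interval.\<close>
  have between: "i0 \<in> L \<and> j0 \<in> L"
    if L: "L \<in> minimizers v u'" "I \<inter> J \<subseteq> L" "L \<subseteq> I \<union> J" "L \<noteq> I" "L \<noteq> J" for L
  proof (rule ccontr)
    assume "\<not> (i0 \<in> L \<and> j0 \<in> L)"
    then have nK: "L \<notin> \<K>" by (auto simp: \<K>_def)
    have LB: "L \<in> \<B>" and le: "g L - sum w L \<le> g I - (\<tau> - t)" using L(1) min'_iff by auto
    have "g L \<le> g I - (\<tau> - t) + sum w L" using le by (simp add: diff_le_eq)
    also have "\<dots> \<le> g I - (\<tau> - t) + (\<tau> - t)" using wL[OF LB nK] by (rule add_left_mono)
    finally have "L \<in> minimizers v u" using min_iff LB by simp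
    then show False using none L by blast
  qed
  have "I \<in> minimizers v u'" "J \<in> minimizers v u'"
    using min'_iff IB JB wI wJ gJ by auto
  moreover have "K \<in> minimizers v u'"
    using min'_iff K wK[OF K] unfolding t_def by (auto simp: \<K>_def algebra_simps)
  ultimately show ?thesis using that[of u' K] K between unfolding \<K>_def by blast
qed

text \<open>Induction on \<open>card (I - J)\<close> for all weights at once, since tilting replaces
  \<open>u\<close>; this is why \<open>local\<close> is assumed for every \<open>u\<close>. A
  minimizer strictly between \<open>I\<close> and \<open>J\<close> is nearer to both and splits the
  exchange into shorter ones. If there is none, the tilted weight has one, and shorter exchanges for
  that weight produce a minimizer that cannot exist.\<close>

lemma basis_exchange_minimizers:
  fixes v :: "'e set \<Rightarrow> 'g::linordered_ab_group_add"
  assumes local: "\<And>u I J i. I \<in> minimizers v u \<Longrightarrow> J \<in> minimizers v u \<Longrightarrow> card (I - J) = 2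
      \<Longrightarrow> i \<in> I - J \<Longrightarrow> \<exists>j \<in> J - I. insert j (I - {i}) \<in> minimizers v u"
  shows "basis_exchange (minimizers v u)"
proof -
  have mB: "I \<in> \<B>" if "I \<in> minimizers v u" for I u using that unfolding minimizers_def by auto
  have "\<exists>j \<in> J - I. insert j (I - {i}) \<in> minimizers v u"
    if "I \<in> minimizers v u" "J \<in> minimizers v u" "i \<in> I - J" for I J i u
    using that
  proof (induction "card (I - J)" arbitrary: I J i u rule: less_induct)
    case (less I J i u)
    note I = less.prems(1) and J = less.prems(2)
    have IB: "I \<in> \<B>" and JB: "J \<in> \<B>" using I J mB by auto
    note fin = basisD(2)[OF IB] basisD(2)[OF JB]
    have i: "i \<in> I" "i \<notin> J" using less.prems by auto
    have cIJ: "card (I - J) = card (J - I)" using card_Diff_basis IB JB by auto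
    have pos: "card (I - J) > 0" using i fin by (auto simp: card_gt_0_iff)
    have smaller: "card (L - J) < card (I - J)"
      if L: "L \<in> \<B>" "I \<inter> J \<subseteq> L" "L \<subseteq> I \<union> J" "L \<noteq> I" for L
    proof -
      obtain x where "x \<in> I" "x \<notin> L" using basis_diff_obtain[OF IB L(1)] L(4) by blast
      then have "L - J \<subset> I - J" using L by auto
      then show ?thesis using fin by (simp add: psubset_card_mono)
    qed
    have smaller': "card (I - L) < card (I - J)"
      if L: "L \<in> \<B>" "I \<inter> J \<subseteq> L" "L \<subseteq> I \<union> J" "L \<noteq> J" for L
    proof -
      obtain x where "x \<in> L" "x \<notin> J" using basis_diff_obtain[OF L(1) JB L(4)] .
      then have "I - L \<subset> I - J" using L by auto
      then show ?thesis using fin by (simp add: psubset_card_mono)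
    qed
    consider "card (I - J) = 1" | "card (I - J) = 2" | "card (I - J) \<ge> 3" using pos by linarith
    then show ?case
    proof cases
      case 1
      then obtain k where "I - J = {k}" by (auto simp: card_1_singleton_iff)
      then have "I - J = {i}" using i by (metis DiffI singletonD)
      moreover obtain j where j: "J - I = {j}" using 1 cIJ by (auto simp: card_1_singleton_iff)
      ultimately have "insert j (I - {i}) = J" by auto
      then show ?thesis using j J by auto
    next
      case 2
      then show ?thesis using local[OF I J 2] i by blast
    next
      case 3
      show ?thesis
      proof (cases "\<exists>K \<in> minimizers v u. I \<inter> J \<subseteq> K \<and> K \<subseteq> I \<union> J \<and> K \<noteq> I \<and> K \<noteq> J")
        case True
        then obtain K where K: "K \<in> minimizers v u" "I \<inter> J \<subseteq> K" "K \<subseteq> I \<union> J" "K \<noteq> I" "K \<noteq> J"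
          by auto
        \<comment> \<open>Exchanging \<open>i\<close> out of \<open>X\<close> towards
          \<open>J\<close> gives a basis without \<open>i\<close> that still contains
          \<open>x\<close>, hence differs from \<open>J\<close>.\<close>
        have far: "\<exists>L \<in> minimizers v u. I \<inter> J \<subseteq> L \<and> L \<subseteq> I \<union> J \<and> L \<noteq> J \<and> i \<notin> L"
          if X: "X \<in> minimizers v u" "I \<inter> J \<subseteq> X" "X \<subseteq> I \<union> J" "X \<noteq> I" "i \<in> X"
            and x: "x \<in> X" "x \<notin> J" "x \<noteq> i" for X x
        proof -
          obtain j where j: "j \<in> J - X" "insert j (X - {i}) \<in> minimizers v u"
            using less.hyps[OF smaller[OF mB[OF X(1)] X(2-4)] X(1) J] i X by blast
          then show ?thesis using X x i by (intro bexI[OF _ j(2)]) auto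
        qed
        obtain L where L: "L \<in> minimizers v u" "I \<inter> J \<subseteq> L" "L \<subseteq> I \<union> J" "L \<noteq> J" "i \<notin> L"
        proof (cases "i \<in> K")
          case False
          then show ?thesis using that K by blast
        next
          case iK: True
          show ?thesis
          proof (cases "\<exists>x \<in> K. x \<notin> J \<and> x \<noteq> i")
            case True
            then show ?thesis using far[OF K(1-4) iK] that by blast
          next
            case False
            \<comment> \<open>Here \<open>i\<close> is the only element of \<open>K\<close> outside
              \<open>J\<close>. Exchanging another element \<open>i'\<close> of \<open>I\<close> for
              one of \<open>K\<close> keeps \<open>i\<close> and a third element of
              \<open>I - J\<close>, so that \<open>far\<close> applies to the result.\<close>
            obtain i' where i': "i' \<in> I" "i' \<notin> K"
              using basis_diff_obtain[OF IB mB[OF K(1)]] K(4) by blast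
            then have i'J: "i' \<notin> J" "i' \<noteq> i" using K iK by auto
            obtain j where j: "j \<in> K - I" "insert j (I - {i'}) \<in> minimizers v u"
              using less.hyps[OF smaller'[OF mB[OF K(1)] K(2,3,5)] I K(1)] i' by blast
            have "\<exists>x \<in> I - J. x \<noteq> i \<and> x \<noteq> i'"
            proof (rule ccontr)
              assume "\<not> ?thesis"
              then have "I - J \<subseteq> {i, i'}" by auto
              then have "card (I - J) \<le> card {i, i'}" by (rule card_mono[rotated]) simp
              then show False using 3 by (simp add: card_insert_if split: if_splits)
            qed
            then obtain x where "x \<in> I" "x \<notin> J" "x \<noteq> i" "x \<noteq> i'" by blast
            then show ?thesis
              using far[OF j(2), of x] that K i' i'J i j by auto
          qed
        qed
        then obtain j where "j \<in> L - I" "insert j (I - {i}) \<in> minimizers v u"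
          using less.hyps[OF smaller'[OF mB[OF L(1)] L(2-4)] I L(1)] i by blast
        then show ?thesis using L by auto
      next
        case False
        then have none: "\<And>K. K \<in> minimizers v u \<Longrightarrow> I \<inter> J \<subseteq> K \<Longrightarrow> K \<subseteq> I \<union> J \<Longrightarrow> K = I \<or> K = J"
          by blast
        \<comment> \<open>An element \<open>i1\<close> other than \<open>i\<close> is exchanged for
          some \<open>j0\<close>, so that the resulting basis contains both \<open>i\<close> and
          \<open>j0\<close>; this is the seed required by the tilt.\<close>
        have "card (I - J - {i}) > 0" using 3 i fin by simp
        then obtain i1 where i1: "i1 \<in> I" "i1 \<notin> J" "i1 \<noteq> i"
          by (auto simp: card_gt_0_iff)
        obtain j0 where j0: "j0 \<in> J" "j0 \<notin> I" "insert j0 (I - {i1}) \<in> \<B>"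
          using basis_exchangeD[OF exchange IB JB i1(1,2)] .
        have K0: "I \<inter> J \<subseteq> insert j0 (I - {i1})" "insert j0 (I - {i1}) \<subseteq> I \<union> J"
          "i \<in> insert j0 (I - {i1})" "j0 \<in> insert j0 (I - {i1})"
          using i i1 j0 by auto
        obtain u' K where u': "I \<in> minimizers v u'" "J \<in> minimizers v u'"
          and K: "K \<in> minimizers v u'" "I \<inter> J \<subseteq> K" "K \<subseteq> I \<union> J" "i \<in> K" "j0 \<in> K"
          and btw: "\<And>L. L \<in> minimizers v u' \<Longrightarrow> I \<inter> J \<subseteq> L \<Longrightarrow> L \<subseteq> I \<union> J \<Longrightarrow> L \<noteq> I \<Longrightarrow> L \<noteq> J
              \<Longrightarrow> i \<in> L \<and> j0 \<in> L"
          by (rule minimizers_tilt[OF I J i j0(1,2,3) K0 none]) blast+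
        obtain i' where i': "i' \<in> I" "i' \<notin> K"
          using basis_diff_obtain[OF IB mB[OF K(1)]] K(5) j0(2) by blast
        then have i'J: "i' \<notin> J" "i' \<noteq> i" using K by auto
        have KJ: "K \<noteq> J" using K i by auto
        obtain j' where j': "j' \<in> K - I" "insert j' (I - {i'}) \<in> minimizers v u'"
          using less.hyps[OF smaller'[OF mB[OF K(1)] K(2,3) KJ] u'(1) K(1)] i' by blast
        let ?L = "insert j' (I - {i'})"
        have L: "I \<inter> J \<subseteq> ?L" "?L \<subseteq> I \<union> J" "?L \<noteq> I" "i \<in> ?L - J"
          using j' K i' i'J i by auto
        obtain j'' where j'': "j'' \<in> J - ?L" "insert j'' (?L - {i}) \<in> minimizers v u'"
          using less.hyps[OF smaller[OF mB[OF j'(2)] L(1-3)] j'(2) u'(2) L(4)] by blast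
        \<comment> \<open>This minimizer lacks \<open>i\<close>, hence is not \<open>I\<close>, and
          keeps a third element of \<open>I - J\<close>, hence is not \<open>J\<close>. By
          \<open>btw\<close> every other minimizer of the interval contains
          \<open>i\<close>.\<close>
        let ?L' = "insert j'' (?L - {i})"
        have "\<exists>x \<in> I - J. x \<noteq> i \<and> x \<noteq> i'"
        proof (rule ccontr)
          assume "\<not> ?thesis"
          then have "I - J \<subseteq> {i, i'}" by auto
          then have "card (I - J) \<le> card {i, i'}" by (rule card_mono[rotated]) simp
          then show False using 3 by (simp add: card_insert_if split: if_splits)
        qed
        then obtain x where "x \<in> I" "x \<notin> J" "x \<noteq> i" "x \<noteq> i'" by blast
        then have "x \<in> ?L'" by simp
        then have "?L' \<noteq> J" using \<open>x \<notin> J\<close> by metis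
        moreover have "i \<notin> ?L'" using i(2) j''(1) by auto
        moreover have "?L' \<noteq> I" using i(1) \<open>i \<notin> ?L'\<close> by metis
        moreover have "I \<inter> J \<subseteq> ?L'" using L(1) i(2) by blast
        moreover have "?L' \<subseteq> I \<union> J" using L(2) j''(1) by blast
        ultimately show ?thesis using btw[OF j''(2)] by blast
      qed
    qed
  qed
  then show ?thesis unfolding basis_exchange_def by blast
qed

end

section \<open>Tracts and formal sums\<close>

lemma formal_sum_cong:
  assumes "\<And>i. i \<in> A \<Longrightarrow> f i = g i"
  shows "formal_sum f A = formal_sum g A"
proof -
  have "{i \<in> A. f i \<noteq> None} = {i \<in> A. g i \<noteq> None}" using assms by auto
  moreover have "f i = g i" if "i \<in># mset_set {i \<in> A. g i \<noteq> None}" for i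
    using that assms by (cases "finite {i \<in> A. g i \<noteq> None}") auto
  ultimately show ?thesis unfolding formal_sum_def by (auto intro: image_mset_cong)
qed

lemma formal_sum_mono_neutral:
  assumes "A \<subseteq> B" "\<And>i. i \<in> B - A \<Longrightarrow> f i = None"
  shows "formal_sum f B = formal_sum f A"
proof -
  have "i \<in> A" if "i \<in> B" "f i \<noteq> None" for i using assms(2)[of i] that by blast
  then have "{i \<in> A. f i \<noteq> None} = {i \<in> B. f i \<noteq> None}" using assms(1) by blast
  then show ?thesis unfolding formal_sum_def by simp
qed

lemma formal_sum_eq_empty:
  assumes "\<And>i. i \<in> A \<Longrightarrow> f i = None"
  shows "formal_sum f A = {#}"
  using formal_sum_mono_neutral[of "{}" A f] assms by (simp add: formal_sum_def)

lemma formal_sum_insert: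
  assumes "finite A" "i \<notin> A" "f i = Some a"
  shows "formal_sum f (insert i A) = add_mset a (formal_sum f A)"
proof -
  have "{j \<in> insert i A. f j \<noteq> None} = insert i {j \<in> A. f j \<noteq> None}" using assms by auto
  then show ?thesis unfolding formal_sum_def using assms by simp
qed

lemma formal_sum_insert_None:
  "f i = None \<Longrightarrow> formal_sum f (insert i A) = formal_sum f A"
  by (rule formal_sum_mono_neutral) auto

lemma formal_sum_empty [simp]: "formal_sum f {} = {#}"
  by (simp add: formal_sum_def)

lemma formal_sum_map_option:
  assumes "finite A"
  shows "formal_sum (\<lambda>i. map_option h (f i)) A = image_mset h (formal_sum f A)"
  using assms
proof (induction A)
  case (insert i A)
  show ?case
  proof (cases "f i")
    case None
    then show ?thesis
      using insert by (simp add: formal_sum_insert_None)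
  next
    case (Some a)
    then show ?thesis using insert by (simp add: formal_sum_insert[where a = a]
        formal_sum_insert[where a = "h a"])
  qed
qed simp

lemma formal_sum_reindex:
  assumes "inj_on \<phi> A"
  shows "formal_sum f (\<phi> ` A) = formal_sum (\<lambda>i. f (\<phi> i)) A"
proof -
  have "{j \<in> \<phi> ` A. f j \<noteq> None} = \<phi> ` {i \<in> A. f (\<phi> i) \<noteq> None}" by auto
  moreover have "inj_on \<phi> {i \<in> A. f (\<phi> i) \<noteq> None}" using assms by (rule inj_on_subset) auto
  ultimately show ?thesis
    unfolding formal_sum_def by (simp add: image_mset_mset_set[symmetric] multiset.map_comp o_def)
qed

section \<open>Arithmetic and signs in a tract with zero\<close>

lemma tmul_simps [simp]:
  "tmul F None y = None" "tmul F x None = None" "tmul F (Some a) (Some b) = Some (a \<otimes>\<^bsub>F\<^esub> b)"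
  by (auto simp: tmul_def split: option.splits)

lemma tmul_eq_None_iff [simp]: "tmul F x y = None \<longleftrightarrow> x = None \<or> y = None"
  by (cases x; cases y) auto

lemma signed_eq_None_iff [simp]: "signed F n x = None \<longleftrightarrow> x = None"
  by (simp add: signed_def)

lemma signed_None [simp]: "signed F n None = None"
  by simp

lemma tconj_eq_None_iff [simp]: "tconj F x = None \<longleftrightarrow> x = None"
  by (simp add: tconj_def)

lemma tconj_None [simp]: "tconj F None = None"
  by simp

lemma elems_simps [simp]: "None \<in> elems F" "Some a \<in> elems F \<longleftrightarrow> a \<in> carrier F"
  by (auto simp: elems_def)

context tract
begin

lemma tmul_closed [simp, intro]: "x \<in> elems F \<Longrightarrow> y \<in> elems F \<Longrightarrow> tmul F x y \<in> elems F"
  by (cases x; cases y) auto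

lemma tmul_comm: "x \<in> elems F \<Longrightarrow> y \<in> elems F \<Longrightarrow> tmul F x y = tmul F y x"
  by (cases x; cases y) (auto simp: m_comm)

lemma tmul_assoc:
  "x \<in> elems F \<Longrightarrow> y \<in> elems F \<Longrightarrow> z \<in> elems F \<Longrightarrow> tmul F (tmul F x y) z = tmul F x (tmul F y z)"
  by (cases x; cases y; cases z) (auto simp: m_assoc)

lemma tmul_left_comm:
  "x \<in> elems F \<Longrightarrow> y \<in> elems F \<Longrightarrow> z \<in> elems F \<Longrightarrow> tmul F x (tmul F y z) = tmul F y (tmul F x z)"
  by (cases x; cases y; cases z) (auto simp: m_lcomm)

lemma tmul_one [simp]: "x \<in> elems F \<Longrightarrow> tmul F (Some \<one>) x = x"
  by (cases x) auto

lemma tmul_left_cancel: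
  assumes "tmul F x y = tmul F x z" "x \<noteq> None" "x \<in> elems F" "y \<in> elems F" "z \<in> elems F"
  shows "y = z"
  using assms by (cases x; cases y; cases z) auto

lemma null_scale_iff:
  assumes "set_mset S \<subseteq> carrier F" "c \<in> carrier F"
  shows "image_mset (\<lambda>a. c \<otimes> a) S \<in> null F \<longleftrightarrow> S \<in> null F"
proof
  assume "image_mset (\<lambda>a. c \<otimes> a) S \<in> null F"
  then have "image_mset (\<lambda>a. inv c \<otimes> a) (image_mset (\<lambda>a. c \<otimes> a) S) \<in> null F"
    using assms by (auto intro!: null_scale[of "image_mset ((\<otimes>) c) S"] simp del: multiset.map_comp)
  moreover have "image_mset (\<lambda>a. inv c \<otimes> a) (image_mset (\<lambda>a. c \<otimes> a) S) = image_mset (\<lambda>a. a) S"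
    unfolding multiset.map_comp
    using assms by (intro image_mset_cong) (auto simp: m_assoc[symmetric] subset_iff)
  ultimately show "S \<in> null F" by (metis multiset.map_ident)
qed (use assms null_scale in auto)

lemma singleton_not_null: "a \<in> carrier F \<Longrightarrow> {#a#} \<notin> null F"
  using null_scale[of "{#a#}" "inv a"] one_not_null by auto

lemma neg_one_props: "neg_one F \<in> carrier F" "{#\<one>, neg_one F#} \<in> null F"
  using theI'[OF unique_neg_one] unfolding neg_one_def by auto

lemma neg_one_closed [simp, intro]: "neg_one F \<in> carrier F"
  by (rule neg_one_props)

lemma neg_one_eqI: "e \<in> carrier F \<Longrightarrow> {#\<one>, e#} \<in> null F \<Longrightarrow> e = neg_one F"
  using unique_neg_one neg_one_props by blast

text \<open>Scaling the null sum of one and minus one by the inverse of minus one gives a null sum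
  of that inverse and one, and uniqueness applies. All sign arithmetic modulo 2 rests on
  this.\<close>

lemma neg_one_inv: "inv (neg_one F) = neg_one F"
proof (rule neg_one_eqI)
  have "image_mset (\<lambda>a. inv (neg_one F) \<otimes> a) {#\<one>, neg_one F#} \<in> null F"
    using neg_one_props by (intro null_scale) auto
  then show "{#\<one>, inv (neg_one F)#} \<in> null F" by (simp add: add_mset_commute)
qed auto

lemma neg_one_square [simp]: "neg_one F \<otimes> neg_one F = \<one>"
  using r_inv[of "neg_one F"] neg_one_inv by simp

lemma pair_null_iff:
  assumes "a \<in> carrier F" "b \<in> carrier F"
  shows "{#a, b#} \<in> null F \<longleftrightarrow> a = neg_one F \<otimes> b"
proof -
  have "{#a, b#} \<in> null F \<longleftrightarrow> image_mset (\<lambda>x. inv b \<otimes> x) {#a, b#} \<in> null F"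
    using assms by (subst null_scale_iff) auto
  also have "\<dots> \<longleftrightarrow> {#\<one>, inv b \<otimes> a#} \<in> null F"
    using assms by (simp add: add_mset_commute)
  also have "\<dots> \<longleftrightarrow> inv b \<otimes> a = neg_one F"
    using assms neg_one_eqI neg_one_props(2) by auto
  also have "\<dots> \<longleftrightarrow> a = neg_one F \<otimes> b"
    using assms by (metis inv_solve_left m_comm neg_one_closed)
  finally show ?thesis .
qed

lemma invol_closed [simp, intro]: "a \<in> carrier F \<Longrightarrow> invol F a \<in> carrier F"
  using invol_hom unfolding tract_hom_def hom_def by auto

lemma invol_mult: "a \<in> carrier F \<Longrightarrow> b \<in> carrier F \<Longrightarrow> invol F (a \<otimes> b) = invol F a \<otimes> invol F b"
  using invol_hom unfolding tract_hom_def hom_def by auto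

lemma invol_null: "S \<in> null F \<Longrightarrow> image_mset (invol F) S \<in> null F"
  using invol_hom unfolding tract_hom_def by auto

lemma invol_null_iff:
  assumes "set_mset S \<subseteq> carrier F"
  shows "image_mset (invol F) S \<in> null F \<longleftrightarrow> S \<in> null F"
proof
  assume "image_mset (invol F) S \<in> null F"
  then have "image_mset (invol F) (image_mset (invol F) S) \<in> null F" by (rule invol_null)
  moreover have "image_mset (invol F) (image_mset (invol F) S) = image_mset (\<lambda>a. a) S"
    unfolding multiset.map_comp using assms
    by (intro image_mset_cong) (auto simp: invol_invol subset_iff)
  ultimately show "S \<in> null F" by (metis multiset.map_ident)
qed (rule invol_null)

lemma invol_one [simp]: "invol F \<one> = \<one>"
  using invol_mult[of \<one> \<one>] invol_closed[of \<one>] by (metis l_one one_closed r_cancel_one)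

lemma invol_neg_one [simp]: "invol F (neg_one F) = neg_one F"
  using invol_null[OF neg_one_props(2)] by (intro neg_one_eqI) auto

lemma tconj_closed [simp, intro]: "x \<in> elems F \<Longrightarrow> tconj F x \<in> elems F"
  by (cases x) (auto simp: tconj_def)

lemma tconj_tconj [simp]: "x \<in> elems F \<Longrightarrow> tconj F (tconj F x) = x"
  by (cases x) (auto simp: tconj_def invol_invol)

lemma tconj_tmul: "x \<in> elems F \<Longrightarrow> y \<in> elems F \<Longrightarrow> tconj F (tmul F x y) = tmul F (tconj F x) (tconj F y)"
  by (cases x; cases y) (auto simp: tconj_def invol_mult)

lemma neg_one_pow_even:
  fixes n :: nat
  assumes "even n"
  shows "neg_one F [^] n = \<one>"
proof -
  have "neg_one F [^] (2 * b) = \<one>" for b :: nat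
    by (induction b) (auto simp: m_assoc)
  then show ?thesis using assms by (auto elim: evenE)
qed

lemma neg_one_pow_cong:
  fixes m n :: nat
  assumes "even (m + n)"
  shows "neg_one F [^] m = neg_one F [^] n"
proof -
  have "neg_one F [^] m \<otimes> neg_one F [^] n = \<one>"
    using neg_one_pow_even[OF assms] by (simp add: nat_pow_mult)
  moreover have "neg_one F [^] n \<otimes> neg_one F [^] n = \<one>"
    using neg_one_pow_even[of "n + n"] by (simp add: nat_pow_mult)
  ultimately show ?thesis by (metis inv_equality nat_pow_closed neg_one_closed)
qed

lemma invol_neg_one_pow: "invol F (neg_one F [^] (n::nat)) = neg_one F [^] n"
  by (induction n) (auto simp: invol_mult)

lemma signed_closed [simp, intro]: "x \<in> elems F \<Longrightarrow> signed F n x \<in> elems F"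
  by (simp add: signed_def)

lemma signed_cong: "even (m + n) \<Longrightarrow> signed F m x = signed F n x"
  unfolding signed_def using neg_one_pow_cong by metis

lemma signed_signed: "x \<in> elems F \<Longrightarrow> signed F m (signed F n x) = signed F (m + n) x"
  by (cases x) (auto simp: signed_def nat_pow_mult[symmetric] m_assoc)

lemma signed_even: "even n \<Longrightarrow> x \<in> elems F \<Longrightarrow> signed F n x = x"
  by (simp add: signed_def neg_one_pow_even)

lemma signed_0 [simp]: "x \<in> elems F \<Longrightarrow> signed F 0 x = x"
  by (simp add: signed_even)

lemma tmul_signed_left:
  "x \<in> elems F \<Longrightarrow> y \<in> elems F \<Longrightarrow> tmul F (signed F n x) y = signed F n (tmul F x y)"
  by (simp add: signed_def tmul_assoc)

lemma tmul_signed_right: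
  "x \<in> elems F \<Longrightarrow> y \<in> elems F \<Longrightarrow> tmul F x (signed F n y) = signed F n (tmul F x y)"
  by (simp add: signed_def tmul_left_comm)

lemma tconj_signed: "x \<in> elems F \<Longrightarrow> tconj F (signed F n x) = signed F n (tconj F x)"
  by (cases x) (auto simp: signed_def tconj_def invol_mult invol_neg_one_pow)

lemmas signed_simps = tmul_signed_left tmul_signed_right signed_signed tconj_signed

lemma formal_sum_carrier:
  assumes "\<And>i. i \<in> A \<Longrightarrow> f i \<in> elems F"
  shows "set_mset (formal_sum f A) \<subseteq> carrier F"
proof (cases "finite {i \<in> A. f i \<noteq> None}")
  case True
  have "the (f i) \<in> carrier F" if "i \<in> A" "f i \<noteq> None" for i
    using assms[of i] that by (cases "f i") auto
  then show ?thesis using True unfolding formal_sum_def by auto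
qed (simp add: formal_sum_def)

lemma formal_sum_scale:
  assumes "finite A" "\<And>i. i \<in> A \<Longrightarrow> f i \<in> elems F" "c \<in> carrier F"
  shows "formal_sum (\<lambda>i. tmul F (Some c) (f i)) A \<in> null F \<longleftrightarrow> formal_sum f A \<in> null F"
proof -
  have "tmul F (Some c) x = map_option (\<lambda>a. c \<otimes> a) x" for x by (cases x) auto
  then show ?thesis
    using null_scale_iff[OF formal_sum_carrier[OF assms(2)] assms(3)] assms(1)
    by (simp add: formal_sum_map_option)
qed

lemma formal_sum_signed:
  assumes "finite A" "\<And>i. i \<in> A \<Longrightarrow> f i \<in> elems F"
  shows "formal_sum (\<lambda>i. signed F n (f i)) A \<in> null F \<longleftrightarrow> formal_sum f A \<in> null F"
  unfolding signed_def using assms by (intro formal_sum_scale) auto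

lemma formal_sum_tconj:
  assumes "finite A" "\<And>i. i \<in> A \<Longrightarrow> f i \<in> elems F"
  shows "formal_sum (\<lambda>i. tconj F (f i)) A \<in> null F \<longleftrightarrow> formal_sum f A \<in> null F"
  unfolding tconj_def using invol_null_iff[OF formal_sum_carrier[OF assms(2)]] assms(1)
  by (simp add: formal_sum_map_option)

text \<open>Serves to replace \<open>I\<close> or \<open>J\<close> in a Pluecker relation by a
  neighbour whose cocircuit or circuit is proportional on the coordinates concerned. The factors on
  both sides avoid writing the ratio as a quotient.\<close>

lemma formal_sum_proportional:
  assumes "finite A" "\<And>i. i \<in> A \<Longrightarrow> f i \<in> elems F" "\<And>i. i \<in> A \<Longrightarrow> g i \<in> elems F"
    and "c \<in> carrier F" "d \<in> carrier F"
    and "\<And>i. i \<in> A \<Longrightarrow> tmul F (Some c) (f i) = tmul F (Some d) (g i)"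
  shows "formal_sum f A \<in> null F \<longleftrightarrow> formal_sum g A \<in> null F"
  using formal_sum_scale[of A f c] formal_sum_scale[of A g d] assms
    formal_sum_cong[of A "\<lambda>i. tmul F (Some c) (f i)" "\<lambda>i. tmul F (Some d) (g i)"] by auto

text \<open>After scaling, uniqueness of minus one decides a sum of two nonzero terms; if one entry
  is zero, so is the other, since a single term is never null. This turns a three-term relation with
  a vanishing term into a proportion.\<close>

lemma formal_sum_two:
  assumes "finite A" "a \<in> A" "b \<in> A" "a \<noteq> b" "\<And>i. i \<in> A \<Longrightarrow> f i \<in> elems F"
    and "\<And>i. i \<in> A \<Longrightarrow> i \<noteq> a \<Longrightarrow> i \<noteq> b \<Longrightarrow> f i = None"
  shows "formal_sum f A \<in> null F \<longleftrightarrow> f a = signed F 1 (f b)"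
proof -
  have eq: "formal_sum f A = formal_sum f {a, b}"
    using assms by (intro formal_sum_mono_neutral) auto
  show ?thesis
  proof (cases "f a")
    case None
    then have "formal_sum f {a, b} = formal_sum f {b}" by (intro formal_sum_mono_neutral) auto
    then show ?thesis
      using None assms(3) assms(5)[of b] singleton_not_null zero_null unfolding eq
      by (cases "f b") (auto simp: formal_sum_insert formal_sum_insert_None signed_def)
  next
    case fa: (Some x)
    then have x: "x \<in> carrier F" using assms(2) assms(5)[of a] by auto
    show ?thesis
    proof (cases "f b")
      case None
      then have "formal_sum f {a, b} = formal_sum f {a}" by (intro formal_sum_mono_neutral) auto
      then show ?thesis
        using None fa x singleton_not_null unfolding eq
        by (auto simp: formal_sum_insert signed_def)
    next
      case (Some y)
      then have "y \<in> carrier F" using assms(3) assms(5)[of b] by auto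
      then show ?thesis using fa x Some pair_null_iff assms(4) unfolding eq
        by (auto simp: formal_sum_insert signed_def)
    qed
  qed
qed

text \<open>A single term is never null, so a nonzero term of a null sum has a partner. This is how
  relations over a tract yield exchange of bases.\<close>

lemma formal_sum_null_other:
  assumes "formal_sum f A \<in> null F" "finite A" "a \<in> A" "f a \<noteq> None" "\<And>i. i \<in> A \<Longrightarrow> f i \<in> elems F"
  obtains b where "b \<in> A" "b \<noteq> a" "f b \<noteq> None"
proof -
  have False if n: "\<And>b. b \<in> A \<Longrightarrow> b \<noteq> a \<Longrightarrow> f b = None"
  proof -
    obtain x where x: "f a = Some x" using assms(4) by auto
    have "formal_sum f A = formal_sum f {a}" using assms n by (intro formal_sum_mono_neutral) auto
    also have "\<dots> = {#x#}" using x by (simp add: formal_sum_insert)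
    finally show False using assms(1) singleton_not_null x assms(3) assms(5)[of a] by auto
  qed
  then show ?thesis using that by blast
qed

end

section \<open>Fundamental circuits\<close>

declare not_None_eq [simp del]

text \<open>Counting from below gives the sign of fundamental circuits directly and is additive over
  disjoint unions; the count from above in \<open>plucker_rel\<close> differs by a sign common to
  all terms.\<close>

definition eps :: "'e::linorder set \<Rightarrow> 'e \<Rightarrow> nat" where
  "eps A i = card {a \<in> A. a < i}"

lemma eps_insert:
  assumes "finite A" "x \<notin> A"
  shows "eps (insert x A) i = (if x < i then 1 else 0) + eps A i"
proof -
  have "{a \<in> insert x A. a < i} = (if x < i then insert x {a \<in> A. a < i} else {a \<in> A. a < i})"
    by auto
  then show ?thesis using assms by (simp add: eps_def)
qed

lemma eps_union:
  assumes "finite A" "finite B" "A \<inter> B = {}"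
  shows "eps (A \<union> B) i = eps A i + eps B i"
proof -
  have "{a \<in> A \<union> B. a < i} = {a \<in> A. a < i} \<union> {a \<in> B. a < i}" by auto
  then show ?thesis unfolding eps_def using assms by (simp add: card_Un_disjoint disjoint_iff)
qed

abbreviation plucker_sum :: "'a tract \<Rightarrow> ('e::linorder set \<Rightarrow> 'a option) \<Rightarrow> 'e set \<Rightarrow> 'e set \<Rightarrow> 'a multiset"
  where "plucker_sum F P I J \<equiv>
    formal_sum (\<lambda>j. signed F (eps J j + eps I j) (tmul F (P (insert j I)) (P (J - {j})))) (J - I)"

abbreviation covec_sum :: "'a tract \<Rightarrow> ('e::linorder set \<Rightarrow> 'a option) \<Rightarrow> ('e \<Rightarrow> 'a option) \<Rightarrow> 'e set
    \<Rightarrow> 'a multiset"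
  where "covec_sum F P W J \<equiv> formal_sum (\<lambda>i. signed F (eps J i) (tmul F (P (J - {i})) (W i))) J"

abbreviation vec_sum :: "'a tract \<Rightarrow> 'e::linorder set \<Rightarrow> ('e set \<Rightarrow> 'a option) \<Rightarrow> ('e \<Rightarrow> 'a option) \<Rightarrow> 'e set
    \<Rightarrow> 'a multiset"
  where "vec_sum F E P Y I \<equiv> formal_sum (\<lambda>i. signed F (eps I i) (tmul F (P (insert i I)) (Y i))) (E - I)"

lemma fund_circuit_eps:
  "fund_circuit F P \<tau> i = (if i \<in> \<tau> then signed F (eps \<tau> i) (P (\<tau> - {i})) else None)"
  by (simp add: fund_circuit_def eps_def)

lemma supp_fund_circuit: "supp (fund_circuit F P \<tau>) = {x \<in> \<tau>. P (\<tau> - {x}) \<noteq> None}"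
  by (auto simp: supp_def fund_circuit_eps)

lemma plucker_funD:
  assumes "plucker_fun F E r P"
  shows "P I \<in> elems F" "P I \<noteq> None \<Longrightarrow> I \<in> nsets E r" "\<exists>I. P I \<noteq> None"
  using assms unfolding plucker_fun_def by auto

text \<open>Covectors and vectors, up to the involution: orthogonality to the fundamental circuits, and
  to the fundamental cocircuits with the involution removed.\<close>

definition covec :: "'a tract \<Rightarrow> 'e::linorder set \<Rightarrow> nat \<Rightarrow> ('e set \<Rightarrow> 'a option)
    \<Rightarrow> ('e \<Rightarrow> 'a option) \<Rightarrow> bool" where
  "covec F E r P W \<longleftrightarrow> (\<forall>J \<in> nsets E (Suc r).
     covec_sum F P W J \<in> null F)"

definition vec :: "'a tract \<Rightarrow> 'e::linorder set \<Rightarrow> nat \<Rightarrow> ('e set \<Rightarrow> 'a option)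
    \<Rightarrow> ('e \<Rightarrow> 'a option) \<Rightarrow> bool" where
  "vec F E r P Y \<longleftrightarrow> (\<forall>I \<subseteq> E. Suc (card I) = r \<longrightarrow>
     vec_sum F E P Y I \<in> null F)"

context tract
begin

text \<open>For \<open>j\<close> in \<open>J\<close> but not in \<open>I\<close>, the elements above
  \<open>j\<close> number \<open>card J - 1 - eps J j\<close> and \<open>card I - eps I j\<close>.
  The two sign conventions thus differ by the parity of \<open>card J + card I + 1\<close>, which
  does not depend on \<open>j\<close>.\<close>

lemma plucker_rel_iff:
  assumes "finite I" "finite J" "\<And>A. P A \<in> elems F"
  shows "plucker_rel F P I J \<longleftrightarrow>
    plucker_sum F P I J \<in> null F"
proof -
  let ?g = "\<lambda>j. signed F (eps J j + eps I j) (tmul F (P (insert j I)) (P (J - {j})))"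
  let ?c = "card J + card I + 1"
  have "formal_sum (\<lambda>j. signed F (card {j' \<in> J. j < j'} + card {i \<in> I. j < i})
              (tmul F (P (insert j I)) (P (J - {j})))) (J - I)
      = formal_sum (\<lambda>j. signed F ?c (?g j)) (J - I)"
  proof (rule formal_sum_cong)
    fix j assume j: "j \<in> J - I"
    have "J = insert j ({j' \<in> J. j < j'} \<union> {a \<in> J. a < j})" using j by auto
    moreover have "card (insert j ({j' \<in> J. j < j'} \<union> {a \<in> J. a < j}))
        = Suc (card {j' \<in> J. j < j'} + eps J j)"
      using assms unfolding eps_def by (subst card_insert_disjoint) (auto intro!: card_Un_disjoint)
    ultimately have 1: "card J = Suc (card {j' \<in> J. j < j'} + eps J j)" by argo
    have "I = {i \<in> I. j < i} \<union> {a \<in> I. a < j}" using j by (auto simp: not_less_iff_gr_or_eq)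
    moreover have "card ({i \<in> I. j < i} \<union> {a \<in> I. a < j}) = card {i \<in> I. j < i} + eps I j"
      using assms unfolding eps_def by (intro card_Un_disjoint) auto
    ultimately have 2: "card I = card {i \<in> I. j < i} + eps I j" by argo
    show "signed F (card {j' \<in> J. j < j'} + card {i \<in> I. j < i}) (tmul F (P (insert j I)) (P (J - {j})))
      = signed F ?c (?g j)"
      using assms(3) by (simp add: signed_signed) (rule signed_cong, use 1 2 in presburger)
  qed
  then show ?thesis unfolding plucker_rel_def using assms by (simp add: formal_sum_signed)
qed

text \<open>The term of \<open>i\<close> in this relation is the product of \<open>P I\<close> and
  \<open>P J\<close>, which is nonzero; any other nonzero term is an exchange.\<close>

lemma exchange_of_plucker_rel:
  assumes P: "\<And>A. P A \<in> elems F" and fin: "finite I" "finite J"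
    and I: "P I \<noteq> None" and J: "P J \<noteq> None" and i: "i \<in> I" "i \<notin> J"
    and rel: "plucker_rel F P (I - {i}) (insert i J)"
  shows "\<exists>j \<in> J - I. P (insert j (I - {i})) \<noteq> None"
proof -
  let ?f = "\<lambda>j. signed F (eps (insert i J) j + eps (I - {i}) j)
    (tmul F (P (insert j (I - {i}))) (P (insert i J - {j})))"
  have "formal_sum ?f (insert i J - (I - {i})) \<in> null F"
    using rel fin by (subst (asm) plucker_rel_iff) (auto simp: P)
  moreover have "insert i (I - {i}) = I" "insert i J - {i} = J" using i by auto
  then have "?f i \<noteq> None" using I J by simp
  ultimately obtain j where "j \<in> insert i J - (I - {i})" "j \<noteq> i" "?f j \<noteq> None"
    using fin i P by (elim formal_sum_null_other[where a = i]) auto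
  then show ?thesis by auto
qed

lemma strong_imp_weak:
  assumes "finite E" "strong_plucker F E r P"
  shows "weak_plucker F E r P"
proof -
  have pf: "plucker_fun F E r P" using assms unfolding strong_plucker_def by auto
  note P = plucker_funD[OF pf]
  have "\<exists>j \<in> J - I. P (insert j (I - {i})) \<noteq> None"
    if "P I \<noteq> None" "P J \<noteq> None" "i \<in> I - J" for I J i
  proof -
    have I: "I \<subseteq> E" "finite I" "card I = r" and J: "J \<subseteq> E" "finite J" "card J = r"
      using that P(2) unfolding nsets_def by auto
    have c: "Suc (card (I - {i})) = r" "card (insert i J) = Suc r"
      using that(3) I J card_Suc_Diff1[of I i] by simp_all
    have s: "I - {i} \<subseteq> E" "insert i J \<subseteq> E" using I J that(3) by auto
    have "plucker_rel F P (I - {i}) (insert i J)"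
      using assms(2) c s unfolding strong_plucker_def by simp
    then show ?thesis using exchange_of_plucker_rel[OF P(1) I(2) J(2) that(1,2)] that(3) by auto
  qed
  then have "basis_exchange {I. P I \<noteq> None}" unfolding basis_exchange_def by auto
  then show ?thesis using assms pf unfolding strong_plucker_def weak_plucker_def by blast
qed

lemma plucker_weak:
  assumes "finite E" "is_plucker k F E r P"
  shows "weak_plucker F E r P"
  using assms strong_imp_weak by (cases k) auto

end

section \<open>Three-term relations and proportional circuits\<close>

locale weak_plucker_fun = tract F for F :: "'a tract" (structure) +
  fixes E :: "'e::linorder set" and r :: nat and P :: "'e set \<Rightarrow> 'a option"
  assumes finite_E: "finite E" and weak: "weak_plucker F E r P"
begin

lemma plucker_fun: "plucker_fun F E r P"
  using weak unfolding weak_plucker_def by auto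

lemma P_closed [simp, intro]: "P I \<in> elems F"
  using plucker_funD(1)[OF plucker_fun] .

lemma P_nsets: "P I \<noteq> None \<Longrightarrow> I \<in> nsets E r"
  using plucker_funD(2)[OF plucker_fun] .

lemma P_nonzero: "\<exists>I. P I \<noteq> None"
  using plucker_funD(3)[OF plucker_fun] .

sublocale bases E r "{I. P I \<noteq> None}"
  using finite_E weak P_nsets unfolding weak_plucker_def by unfold_locales auto

lemma supp_fund_circuit_circ: "supp (fund_circuit F P \<tau>) = circ \<tau>"
  by (simp add: supp_fund_circuit circ_def)

lemma fund_circuit_closed [simp, intro]: "fund_circuit F P \<tau> i \<in> elems F"
  by (simp add: fund_circuit_eps)

lemma weak_rel:
  assumes "I \<subseteq> E" "J \<subseteq> E" "Suc (card I) = r" "card J = Suc r" "card (J - I) = 3"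
  shows "plucker_sum F P I J \<in> null F"
proof -
  have "finite I" "finite J" using assms finite_E finite_subset by blast+
  moreover have "plucker_rel F P I J" using weak assms unfolding weak_plucker_def by auto
  ultimately show ?thesis by (subst (asm) plucker_rel_iff) auto
qed

text \<open>The relation for \<open>\<tau>' - {i, j}\<close> and \<open>\<tau>\<close> has only the
  terms \<open>i\<close>, \<open>j\<close> and \<open>b\<close>. The hypothesis \<open>zero\<close>
  says that the term \<open>b\<close> vanishes, and the other two then make the two fundamental
  circuits proportional on \<open>i\<close> and \<open>j\<close>.\<close>

lemma two_term_circuit:
  assumes \<tau>: "\<tau> \<in> nsets E (Suc r)" and ij: "i \<in> \<tau>" "j \<in> \<tau>" "b \<in> \<tau>" "i \<noteq> j" "b \<noteq> i" "b \<noteq> j"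
    and b': "b' \<in> E" "b' \<notin> \<tau>"
    and zero: "P (\<tau> - {b}) = None \<or> P (insert b' (\<tau> - {i, j})) = None"
  defines "\<tau>' \<equiv> insert b' (\<tau> - {b})"
  shows "tmul F (fund_circuit F P \<tau> i) (fund_circuit F P \<tau>' j)
       = tmul F (fund_circuit F P \<tau> j) (fund_circuit F P \<tau>' i)"
proof -
  have t: "\<tau> \<subseteq> E" "finite \<tau>" "card \<tau> = Suc r" using \<tau> by (auto simp: nsets_def)
  define L where "L = \<tau> - {i, j, b}"
  define I where "I = insert b' L"
  have L: "finite L" "i \<notin> L" "j \<notin> L" "b \<notin> L" "b' \<notin> L" using t b' by (auto simp: L_def)
  have tL: "\<tau> = insert i (insert j (insert b L))" using ij by (auto simp: L_def)
  have ne: "b' \<noteq> i" "b' \<noteq> j" "b' \<noteq> b" using ij b' by auto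
  have cL: "Suc (Suc (card L)) = r" using t(3) L ij unfolding tL by simp
  have I: "I \<subseteq> E" "Suc (card I) = r" "finite I" using b' t cL L by (auto simp: I_def tL)
  have JI: "\<tau> - I = {i, j, b}" using L ij ne by (auto simp: I_def tL)
  have \<tau>': "\<tau>' = insert i (insert j I)" using L ij unfolding \<tau>'_def tL I_def by auto
  have nI: "i \<notin> I" "j \<notin> I" "b \<notin> I" using L ne by (auto simp: I_def)
  let ?f = "\<lambda>k. signed F (eps \<tau> k + eps I k) (tmul F (P (insert k I)) (P (\<tau> - {k})))"
  have "formal_sum ?f (\<tau> - I) \<in> null F" 
    using weak_rel[OF I(1) t(1) I(2) t(3)] JI ij by simp
  moreover have "?f b = None"
  proof -
    have "insert b I = insert b' (\<tau> - {i, j})" using L ij ne by (auto simp: I_def tL)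
    then show ?thesis using zero by auto
  qed
  ultimately have eq: "?f i = signed F 1 (?f j)"
    using formal_sum_two[of "\<tau> - I" i j ?f] JI ij by auto
  have sets: "insert i I = \<tau>' - {j}" "insert j I = \<tau>' - {i}" using nI ij unfolding \<tau>' by auto
  have in': "i \<in> \<tau>'" "j \<in> \<tau>'" using \<tau>' by auto
  have e: "eps \<tau>' i = eps I i + (if j < i then 1 else 0)" "eps \<tau>' j = eps I j + (if i < j then 1 else 0)"
    unfolding \<tau>' using nI I ij by (simp_all add: eps_insert)
  have parity: "even (eps I i + eps \<tau>' j + 1 + eps I j + eps \<tau>' i)"
    unfolding e using ij(4) by (cases i j rule: linorder_cases) auto
  have "tmul F (fund_circuit F P \<tau> i) (fund_circuit F P \<tau>' j)
      = signed F (eps \<tau>' j + eps \<tau> i) (tmul F (P (\<tau>' - {j})) (P (\<tau> - {i})))"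
    using ij in' by (simp add: fund_circuit_eps signed_simps tmul_comm)
  also have "\<dots> = signed F (eps I i + eps \<tau>' j) (?f i)"
    using sets by (simp add: signed_simps) (rule signed_cong, presburger)
  also have "\<dots> = signed F (eps I i + eps \<tau>' j) (signed F 1 (?f j))" using eq by simp
  also have "\<dots> = signed F (eps \<tau>' i + eps \<tau> j) (tmul F (P (\<tau>' - {i})) (P (\<tau> - {j})))"
    using sets parity by (simp add: signed_simps) (rule signed_cong, presburger)
  also have "\<dots> = tmul F (fund_circuit F P \<tau> j) (fund_circuit F P \<tau>' i)"
    using ij in' by (simp add: fund_circuit_eps signed_simps tmul_comm)
  finally show ?thesis .
qed

text \<open>Dual to the proportion for circuits: the relation for \<open>I'\<close> and
  \<open>I\<close> enlarged by \<open>x\<close> and \<open>y\<close> has the terms \<open>f\<close>,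
  \<open>x\<close> and \<open>y\<close>, and the first contains the factor
  \<open>P (insert e I)\<close>, which is zero. So the fundamental cocircuits \<open>D I\<close> and
  \<open>D I'\<close> are proportional on \<open>x\<close> and \<open>y\<close>.\<close>

lemma two_term_cocircuit:
  assumes I: "I \<subseteq> E" "Suc (card I) = r" and f: "f \<in> I" and e: "e \<in> E" "e \<notin> I"
    and x: "x \<in> E" "x \<notin> I" "x \<noteq> e" and y: "y \<in> E" "y \<notin> I" "y \<noteq> e" 
    and zero: "P (insert e I) = None"
  defines "D \<equiv> \<lambda>I x. signed F (eps I x) (P (insert x I))" and "I' \<equiv> insert e (I - {f})"
  shows "tmul F (D I x) (D I' y) = tmul F (D I y) (D I' x)"
proof (cases "x = y")
  case False
  have fI: "finite I" using I finite_E finite_subset by blast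
  define J where "J = insert x (insert y I)"
  have J: "J \<subseteq> E" "card J = Suc r" "finite J" using I x y False fI by (auto simp: J_def)
  have I': "I' \<subseteq> E" "Suc (card I') = r" "finite I'" "x \<notin> I'" "y \<notin> I'"
    using I f e fI x y card_Suc_Diff1[OF fI f] by (auto simp: I'_def)
  have JI: "J - I' = {f, x, y}" using f e x y by (auto simp: J_def I'_def)
  have ne: "f \<noteq> x" "f \<noteq> y" using f x y by auto
  let ?f = "\<lambda>k. signed F (eps J k + eps I' k) (tmul F (P (insert k I')) (P (J - {k})))"
  have "formal_sum ?f (J - I') \<in> null F"
    using weak_rel[OF I'(1) J(1) I'(2) J(2)] JI ne False by simp
  moreover have "?f f = None"
  proof -
    have "insert f I' = insert e I" using f by (auto simp: I'_def)
    then show ?thesis using zero by simp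
  qed
  ultimately have eq: "?f x = signed F 1 (?f y)"
    using formal_sum_two[of "J - I'" x y ?f] JI ne False by auto
  have sets: "J - {x} = insert y I" "J - {y} = insert x I" using x y False by (auto simp: J_def)
  have ep: "eps J x = eps I x + (if y < x then 1 else 0)" "eps J y = eps I y + (if x < y then 1 else 0)"
    unfolding J_def using fI x y False by (simp_all add: eps_insert)
  have parity: "even (eps I x + eps J y + eps I y + eps J x + 1)"
    unfolding ep using False by (cases x y rule: linorder_cases) auto
  have "tmul F (D I x) (D I' y) = signed F (eps I x + eps J y) (?f y)"
    using sets by (simp add: D_def signed_simps tmul_comm) (rule signed_cong, presburger)
  also have "\<dots> = signed F (eps I y + eps J x) (signed F 1 (?f y))"
    using parity by (simp add: signed_signed) (rule signed_cong, presburger)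
  also have "\<dots> = signed F (eps I y + eps J x) (?f x)" using eq by simp
  also have "\<dots> = tmul F (D I y) (D I' x)"
    using sets by (simp add: D_def signed_simps tmul_comm) (rule signed_cong, presburger)
  finally show ?thesis .
qed simp

text \<open>
  Proportionality of two fundamental circuits on \<open>\<tau> \<inter> \<tau>'\<close>: move from \<open>\<tau>\<close> to \<open>\<tau>'\<close> by single
  exchanges, in each of which one of the three terms of the Pluecker relation vanishes.
\<close>

lemma circuit_ratio:
  assumes "\<tau> \<in> nsets E (Suc r)" "\<tau>' \<in> nsets E (Suc r)"
    and "i \<in> \<tau> \<inter> \<tau>'" "j \<in> \<tau> \<inter> \<tau>'" "P (\<tau> - {i}) \<noteq> None" "P (\<tau>' - {i}) \<noteq> None"
    and "\<And>\<sigma> b b'. \<sigma> \<in> nsets E (Suc r) \<Longrightarrow> \<tau> \<inter> \<tau>' \<subseteq> \<sigma> \<Longrightarrow> \<sigma> \<subseteq> \<tau> \<union> \<tau>' \<Longrightarrow> b \<in> \<sigma> - \<tau>' \<Longrightarrow> b' \<in> \<tau>' - \<sigma>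
      \<Longrightarrow> P (\<sigma> - {b}) = None \<or> P (insert b' (\<sigma> - {i, j})) = None"
  shows "tmul F (fund_circuit F P \<tau> i) (fund_circuit F P \<tau>' j)
       = tmul F (fund_circuit F P \<tau> j) (fund_circuit F P \<tau>' i)"
proof (cases "i = j")
  case ij: False
  show ?thesis using assms
  proof (induction "card (\<tau> - \<tau>')" arbitrary: \<tau> rule: less_induct)
    case (less \<tau>)
    note zero = less.prems(7)
    have t: "\<tau> \<subseteq> E" "finite \<tau>" "card \<tau> = Suc r" and t': "\<tau>' \<subseteq> E" "finite \<tau>'" "card \<tau>' = Suc r"
      using less.prems by (auto simp: nsets_def)
    have i: "i \<in> \<tau>" "i \<in> \<tau>'" and j: "j \<in> \<tau>" "j \<in> \<tau>'" using less.prems by auto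
    show ?case
    proof (cases "\<tau> = \<tau>'")
      case False
      then have "\<not> \<tau> \<subseteq> \<tau>'" using t t' card_subset_eq[of \<tau>' \<tau>] by auto
      then obtain b where b: "b \<in> \<tau>" "b \<notin> \<tau>'" by auto
      then have bi: "b \<in> \<tau> - {i}" "b \<notin> \<tau>' - {i}" using i by auto
      \<comment> \<open>Exchanging between the bases \<open>\<tau> - {i}\<close> and
        \<open>\<tau>' - {i}\<close> keeps the entry at \<open>i\<close> nonzero along the whole
        path; the cancellation that joins the steps depends on it.\<close>
      obtain b' where b'': "b' \<in> \<tau>' - {i}" "b' \<notin> \<tau> - {i}"
          "insert b' (\<tau> - {i} - {b}) \<in> {I. P I \<noteq> None}"
        by (rule basis_exchangeD[OF exchange _ _ bi]) (use less.prems(5,6) in auto)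
      then have b': "b' \<in> \<tau>'" "b' \<noteq> i" "b' \<notin> \<tau>" "P (insert b' (\<tau> - {i} - {b})) \<noteq> None" by auto
      have ne: "b \<noteq> i" "b \<noteq> j" "b' \<noteq> j" "b \<noteq> b'" using b b' i j by auto
      define \<sigma> where "\<sigma> = insert b' (\<tau> - {b})"
      have si: "\<sigma> - {i} = insert b' (\<tau> - {i} - {b})" using b' by (auto simp: \<sigma>_def)
      have \<sigma>: "\<sigma> \<in> nsets E (Suc r)" "i \<in> \<sigma>" "j \<in> \<sigma>"
        using t t' b' b i j ne card_Suc_Diff1[OF t(2) b(1)] by (auto simp: nsets_def \<sigma>_def)
      \<comment> \<open>The interval from intersection to union shrinks, so the vanishing hypothesis
        is inherited by the shorter path.\<close>
      have sub: "\<sigma> \<inter> \<tau>' = insert b' (\<tau> \<inter> \<tau>')" "\<sigma> \<union> \<tau>' \<subseteq> \<tau> \<union> \<tau>'" using b b' by (auto simp: \<sigma>_def)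
      have step: "tmul F (fund_circuit F P \<tau> i) (fund_circuit F P \<sigma> j)
          = tmul F (fund_circuit F P \<tau> j) (fund_circuit F P \<sigma> i)"
        unfolding \<sigma>_def
        by (rule two_term_circuit[OF less.prems(1)]) (use i j b b' ne ij t' zero[OF less.prems(1), of b b'] in auto)
      have "\<sigma> - \<tau>' = (\<tau> - \<tau>') - {b}" using b' by (auto simp: \<sigma>_def)
      then have "card (\<sigma> - \<tau>') < card (\<tau> - \<tau>')"
        using b t by (metis card_Diff1_less_iff DiffI finite_Diff)
      then have IH: "tmul F (fund_circuit F P \<sigma> i) (fund_circuit F P \<tau>' j)
          = tmul F (fund_circuit F P \<sigma> j) (fund_circuit F P \<tau>' i)"
      proof (rule less.hyps)
        show "P (\<sigma> - {i}) \<noteq> None" using b' si by simp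
        show "P (\<tau>' - {i}) \<noteq> None" "\<tau>' \<in> nsets E (Suc r)" by (fact less.prems)+
        fix \<rho> c c'
        assume \<rho>: "\<rho> \<in> nsets E (Suc r)" "\<sigma> \<inter> \<tau>' \<subseteq> \<rho>" "\<rho> \<subseteq> \<sigma> \<union> \<tau>'" "c \<in> \<rho> - \<tau>'" "c' \<in> \<tau>' - \<rho>"
        show "P (\<rho> - {c}) = None \<or> P (insert c' (\<rho> - {i, j})) = None"
          using \<rho>(2,3) sub by (intro zero[OF \<rho>(1) _ _ \<rho>(4,5)]) auto
      qed (use \<sigma> i j in auto)
      let ?f = "fund_circuit F P"
      have "tmul F (?f \<sigma> i) (tmul F (?f \<tau> i) (?f \<tau>' j)) = tmul F (?f \<tau> i) (tmul F (?f \<sigma> i) (?f \<tau>' j))"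
        by (rule tmul_left_comm) auto
      also have "\<dots> = tmul F (tmul F (?f \<tau> i) (?f \<sigma> j)) (?f \<tau>' i)" unfolding IH by (rule tmul_assoc[symmetric]) auto
      also have "\<dots> = tmul F (?f \<sigma> i) (tmul F (?f \<tau> j) (?f \<tau>' i))" unfolding step
        using tmul_comm[of "?f \<tau> j" "?f \<sigma> i"] tmul_assoc[of "?f \<sigma> i" "?f \<tau> j"] by simp
      finally show ?thesis
        by (rule tmul_left_cancel) (use b' si \<sigma> in \<open>auto simp: fund_circuit_eps\<close>)
    next
      case True
      then show ?thesis using tmul_comm by simp
    qed
  qed
qed simp

end

section \<open>Circuits of a matroid and orthogonality to them\<close>

context tract
begin

lemma weak_plucker_funI:
  assumes "finite E" "is_plucker k F E r P"
  shows "weak_plucker_fun F E r P"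
  using assms plucker_weak tract_axioms
  by (simp add: weak_plucker_fun_def weak_plucker_fun_axioms_def)

lemma tmul_fund_circuit:
  assumes "c \<in> carrier F" "\<And>I. P I \<in> elems F"
  shows "fund_circuit F (\<lambda>I. tmul F (Some c) (P I)) \<tau> i = tmul F (Some c) (fund_circuit F P \<tau> i)"
  using assms by (simp add: fund_circuit_eps tmul_signed_right)

lemma circuits_eq:
  assumes P: "\<And>I. P I \<in> elems F" and M: "pluckers M = scale_class F P"
  shows "circuits F M = {\<lambda>i. tmul F (Some c) (fund_circuit F P \<tau> i) | c \<tau>.
    c \<in> carrier F \<and> \<tau> \<in> nsets (ground M) (Suc (rk M)) \<and> supp (fund_circuit F P \<tau>) \<noteq> {}}"
    (is "_ = ?R")
proof
  have fc: "fund_circuit F P \<tau> i \<in> elems F" for \<tau> i using P by (simp add: fund_circuit_eps)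
  show "circuits F M \<subseteq> ?R"
  proof
    fix C assume "C \<in> circuits F M"
    then obtain c Q \<tau> where C: "C = (\<lambda>i. tmul F (Some c) (fund_circuit F Q \<tau> i))" "c \<in> carrier F"
      "Q \<in> pluckers M" "\<tau> \<in> nsets (ground M) (Suc (rk M))" "supp (fund_circuit F Q \<tau>) \<noteq> {}"
      unfolding circuits_def by blast
    obtain d where d: "d \<in> carrier F" "Q = (\<lambda>I. tmul F (Some d) (P I))"
      using C(3) M unfolding scale_class_def by blast
    have Q: "fund_circuit F Q \<tau> i = tmul F (Some d) (fund_circuit F P \<tau> i)" for i
      using tmul_fund_circuit[of d P \<tau> i] d P by simp
    have "C = (\<lambda>i. tmul F (Some (c \<otimes> d)) (fund_circuit F P \<tau> i))"
      unfolding C(1) Q using C(2) d fc tmul_assoc[of "Some c" "Some d"] by simp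
    moreover have "supp (fund_circuit F P \<tau>) \<noteq> {}"
      using C(5) Q by (auto simp: supp_def)
    ultimately show "C \<in> ?R" using C d by blast
  qed
  have "P \<in> pluckers M" unfolding M scale_class_def using P by (auto intro!: exI[of _ \<one>])
  then show "?R \<subseteq> circuits F M" unfolding circuits_def by blast
qed

text \<open>Applying the involution to an orthogonality relation moves the conjugation from the
  circuit to \<open>X\<close>, and a zero fundamental circuit gives the empty sum. The set
  \<open>E'\<close> may exceed the ground set because adding coloops enlarges the ground set but
  keeps the circuits.\<close>

lemma perp_circuits_iff:
  assumes P: "\<And>I. P I \<in> elems F" and M: "pluckers M = scale_class F P"
    and E': "finite E'" "ground M \<subseteq> E'"
  shows "X \<in> perp F E' (circuits F M) \<longleftrightarrow>
    X \<in> tuples F E' \<and> covec F (ground M) (rk M) P (\<lambda>i. tconj F (X i))"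
proof (cases "X \<in> tuples F E'")
  case True
  have X: "X i \<in> elems F" for i using True unfolding tuples_def by (cases "i \<in> E'") auto
  have fc: "fund_circuit F P \<tau> i \<in> elems F" for \<tau> i using P by (simp add: fund_circuit_eps)
  let ?T = "nsets (ground M) (Suc (rk M))"
  have orth: "orthogonal F E' X (\<lambda>i. tmul F (Some c) (fund_circuit F P \<tau> i)) \<longleftrightarrow>
      formal_sum (\<lambda>i. signed F (eps \<tau> i) (tmul F (P (\<tau> - {i})) (tconj F (X i)))) \<tau> \<in> null F"
    if c: "c \<in> carrier F" and \<tau>: "\<tau> \<in> ?T" for c \<tau>
  proof -
    have \<tau>': "\<tau> \<subseteq> E'" "finite \<tau>" using \<tau> E' by (auto simp: nsets_def)
    have "orthogonal F E' X (\<lambda>i. tmul F (Some c) (fund_circuit F P \<tau> i)) \<longleftrightarrow>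
      formal_sum (\<lambda>i. tmul F (Some (invol F c)) (tmul F (X i) (tconj F (fund_circuit F P \<tau> i)))) E' \<in> null F"
      unfolding orthogonal_def using c X fc
      by (intro arg_cong2[where f = "(\<in>)"] formal_sum_cong)
        (auto simp: tconj_tmul tmul_left_comm, simp add: tconj_def)
    also have "\<dots> \<longleftrightarrow> formal_sum (\<lambda>i. tmul F (X i) (tconj F (fund_circuit F P \<tau> i))) E' \<in> null F"
      using c X fc E' by (intro formal_sum_scale) auto
    also have "\<dots> \<longleftrightarrow> formal_sum (\<lambda>i. tconj F (tmul F (X i) (tconj F (fund_circuit F P \<tau> i)))) E' \<in> null F"
      using X fc E' by (intro formal_sum_tconj[symmetric]) auto
    also have "formal_sum (\<lambda>i. tconj F (tmul F (X i) (tconj F (fund_circuit F P \<tau> i)))) E'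
        = formal_sum (\<lambda>i. tconj F (tmul F (X i) (tconj F (fund_circuit F P \<tau> i)))) \<tau>"
      using \<tau>' by (intro formal_sum_mono_neutral) (auto simp: fund_circuit_eps)
    also have "\<dots> = formal_sum (\<lambda>i. signed F (eps \<tau> i) (tmul F (P (\<tau> - {i})) (tconj F (X i)))) \<tau>"
      using X fc P by (intro formal_sum_cong)
        (simp add: tconj_tmul tmul_comm, simp add: fund_circuit_eps tmul_signed_left tmul_signed_right tmul_comm)
    finally show ?thesis .
  qed
  have zero: "formal_sum (\<lambda>i. signed F (eps \<tau> i) (tmul F (P (\<tau> - {i})) (tconj F (X i)))) \<tau> \<in> null F"
    if "supp (fund_circuit F P \<tau>) = {}" for \<tau>
  proof -
    have "P (\<tau> - {i}) = None" if "i \<in> \<tau>" for i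
      using \<open>supp (fund_circuit F P \<tau>) = {}\<close> that by (auto simp: supp_fund_circuit)
    then show ?thesis using zero_null by (subst formal_sum_eq_empty) auto
  qed
  show ?thesis
  proof
    assume "X \<in> perp F E' (circuits F M)"
    then have a: "\<And>C. C \<in> circuits F M \<Longrightarrow> orthogonal F E' X C" unfolding perp_def by auto
    have "formal_sum (\<lambda>i. signed F (eps \<tau> i) (tmul F (P (\<tau> - {i})) (tconj F (X i)))) \<tau> \<in> null F"
      if \<tau>: "\<tau> \<in> ?T" for \<tau>
    proof (cases "supp (fund_circuit F P \<tau>) = {}")
      case False
      then have "(\<lambda>i. tmul F (Some \<one>) (fund_circuit F P \<tau> i)) \<in> circuits F M"
        unfolding circuits_eq[OF P M] using \<tau> by blast
      then show ?thesis using a orth[OF one_closed \<tau>] by blast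
    qed (rule zero)
    then show "X \<in> tuples F E' \<and> covec F (ground M) (rk M) P (\<lambda>i. tconj F (X i))"
      using True unfolding covec_def by auto
  next
    assume "X \<in> tuples F E' \<and> covec F (ground M) (rk M) P (\<lambda>i. tconj F (X i))"
    then show "X \<in> perp F E' (circuits F M)"
      unfolding perp_def circuits_eq[OF P M] covec_def using orth by auto
  qed
qed (auto simp: perp_def)

lemma fmatroid_weakD:
  assumes "is_fmatroid Weak F N"
  obtains P where "weak_plucker_fun F (ground N) (rk N) P" "pluckers N = scale_class F P"
proof -
  obtain P where "weak_plucker F (ground N) (rk N) P" "pluckers N = scale_class F P"
    "finite (ground N)"
    using assms unfolding is_fmatroid_def by auto
  then show ?thesis using that tract_axioms
    by (auto simp: weak_plucker_fun_def weak_plucker_fun_axioms_def)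
qed

end

section \<open>A matroid is determined by its circuits\<close>

text \<open>Every set on the path from \<open>\<tau>\<close> to \<open>\<tau>'\<close> contains the
  circuit inside \<open>\<tau>'\<close>, even after an element outside \<open>\<tau>'\<close> is
  removed. What remains is therefore not a basis, which is the vanishing that
  \<open>circuit_ratio\<close> asks for.\<close>

lemma (in weak_plucker_fun) circuit_ratio_subset:
  assumes \<tau>: "\<tau> \<in> nsets E (Suc r)" "\<tau>' \<in> nsets E (Suc r)" and sub: "circ \<tau>' \<subseteq> \<tau>"
    and ij: "i \<in> circ \<tau>'" "j \<in> circ \<tau>'" and i: "P (\<tau> - {i}) \<noteq> None"
  shows "tmul F (fund_circuit F P \<tau> i) (fund_circuit F P \<tau>' j)
       = tmul F (fund_circuit F P \<tau> j) (fund_circuit F P \<tau>' i)"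
proof (rule circuit_ratio[OF \<tau> _ _ i])
  have sub': "circ \<tau>' \<subseteq> \<tau> \<inter> \<tau>'" using sub by (auto simp: circ_def)
  then show "i \<in> \<tau> \<inter> \<tau>'" "j \<in> \<tau> \<inter> \<tau>'" using ij by auto
  show "P (\<tau>' - {i}) \<noteq> None" using ij by (auto simp: circ_def)
  fix \<sigma> b b' assume "\<tau> \<inter> \<tau>' \<subseteq> \<sigma>" "b \<in> \<sigma> - \<tau>'"
  then have "circ \<tau>' \<subseteq> \<sigma> - {b}" using sub' by auto
  then show "P (\<sigma> - {b}) = None \<or> P (insert b' (\<sigma> - {i, j})) = None"
    using circ_not_subset_basis[of \<tau>' "\<sigma> - {b}"] ij by auto
qed

context tract
begin

lemma scale_class_scale:
  assumes "c \<in> carrier F" "\<And>I. P I \<in> elems F" "\<And>I. P' I = tmul F (Some c) (P I)"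
  shows "scale_class F P' = scale_class F P"
proof -
  have *: "(\<lambda>I. tmul F (Some d) (P' I)) = (\<lambda>I. tmul F (Some (d \<otimes> c)) (P I))" if "d \<in> carrier F" for d
    using tmul_assoc[of "Some d" "Some c"] that assms by simp
  have **: "(\<lambda>I. tmul F (Some d) (P I)) = (\<lambda>I. tmul F (Some (d \<otimes> inv c)) (P' I))"
    if "d \<in> carrier F" for d
    using *[of "d \<otimes> inv c"] that assms by (simp add: m_assoc)
  show ?thesis
  proof
    show "scale_class F P' \<subseteq> scale_class F P"
      unfolding scale_class_def using * assms(1) by blast
    show "scale_class F P \<subseteq> scale_class F P'"
      unfolding scale_class_def using ** assms(1) by blast
  qed
qed

text \<open>A basis of the first matroid contains none of its circuits, hence no circuit of the
  second, and so it extends to a basis there. The ranks may differ at this stage.\<close>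

lemma bases_mono_circuits:
  assumes N: "weak_plucker_fun F E r P" and N': "weak_plucker_fun F E r' P'"
    and circ: "\<And>\<tau>'. \<tau>' \<in> nsets E (Suc r') \<Longrightarrow> supp (fund_circuit F P' \<tau>') \<noteq> {}
      \<Longrightarrow> \<exists>\<tau>. supp (fund_circuit F P \<tau>) = supp (fund_circuit F P' \<tau>')"
    and B: "P B \<noteq> None"
  obtains B' where "P' B' \<noteq> None" "B \<subseteq> B'"
proof -
  interpret N: weak_plucker_fun F E r P by fact
  interpret N': weak_plucker_fun F E r' P' by fact
  have "\<not> N'.circ \<tau>' \<subseteq> B" if \<tau>': "\<tau>' \<in> nsets E (Suc r')" "N'.circ \<tau>' \<noteq> {}" for \<tau>'
  proof -
    have "supp (fund_circuit F P' \<tau>') \<noteq> {}" using \<tau>' N'.supp_fund_circuit_circ by auto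
    then obtain \<tau> where "N.circ \<tau> = N'.circ \<tau>'"
      using circ[OF \<tau>'(1)] unfolding N'.supp_fund_circuit_circ N.supp_fund_circuit_circ by auto
    then show ?thesis using N.circ_not_subset_basis[of \<tau> B] \<tau>' B by auto
  qed
  moreover have "B \<subseteq> E" using N.basisD(1)[of B] B by auto
  ultimately show ?thesis
    using N'.circuit_free_subset_basis[of B thesis] N'.P_nonzero that by blast
qed

lemma circuits_supp_obtain:
  assumes N: "weak_plucker_fun F E r P" "ground M = E" "rk M = r" "pluckers M = scale_class F P"
    and N': "weak_plucker_fun F E r' P'" "ground M' = E" "rk M' = r'" "pluckers M' = scale_class F P'"
    and sub: "circuits F M \<subseteq> circuits F M'"
    and \<tau>: "\<tau> \<in> nsets E (Suc r)" "supp (fund_circuit F P \<tau>) \<noteq> {}"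
  obtains c \<tau>' where "c \<in> carrier F" "\<tau>' \<in> nsets E (Suc r')"
    "\<And>i. fund_circuit F P \<tau> i = tmul F (Some c) (fund_circuit F P' \<tau>' i)"
    "supp (fund_circuit F P \<tau>) = supp (fund_circuit F P' \<tau>')"
proof -
  interpret N: weak_plucker_fun F E r P by fact
  interpret N': weak_plucker_fun F E r' P' by fact
  have "fund_circuit F P \<tau> = (\<lambda>i. tmul F (Some \<one>) (fund_circuit F P \<tau> i))" by auto
  then have "fund_circuit F P \<tau> \<in> circuits F M'"
    using sub \<tau> unfolding circuits_eq[of P M, OF N.P_closed N(4)] N(2,3) by blast
  then obtain c \<tau>' where c: "c \<in> carrier F" "\<tau>' \<in> nsets E (Suc r')"
    "fund_circuit F P \<tau> = (\<lambda>i. tmul F (Some c) (fund_circuit F P' \<tau>' i))"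
    unfolding circuits_eq[of P' M', OF N'.P_closed N'(4)] N'(2,3) by blast
  then show ?thesis using that[OF c(1,2)] by (auto simp: supp_def)
qed

text \<open>Circuits determine the rank and the bases. For two bases differing by one exchange, the
  ratio of their Pluecker coordinates is, up to sign, a ratio of two entries of one circuit; since
  bases are connected by exchanges, the two Pluecker vectors are proportional. This makes the
  definite descriptions of contraction and of coloops meaningful.\<close>

lemma fmatroid_eqI:
  assumes M: "is_fmatroid Weak F M" and M': "is_fmatroid Weak F M'"
    and ground: "ground M = ground M'" and circuits: "circuits F M = circuits F M'"
  shows "M = M'"
proof -
  define E where "E = ground M"
  obtain P where P: "weak_plucker_fun F E (rk M) P" "pluckers M = scale_class F P"
    using fmatroid_weakD[OF M] unfolding E_def .
  obtain P' where P': "weak_plucker_fun F E (rk M') P'" "pluckers M' = scale_class F P'"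
    using fmatroid_weakD[OF M'] unfolding E_def ground .
  interpret N: weak_plucker_fun F E "rk M" P by (rule P(1))
  interpret N': weak_plucker_fun F E "rk M'" P' by (rule P'(1))
  note obt = circuits_supp_obtain[OF P(1) _ _ P(2) P'(1) _ _ P'(2)]
  note obt' = circuits_supp_obtain[OF P'(1) _ _ P'(2) P(1) _ _ P(2)]
  have up: "\<exists>B'. P' B' \<noteq> None \<and> B \<subseteq> B'" if B: "P B \<noteq> None" for B
  proof (rule bases_mono_circuits[OF P(1) P'(1) _ B])
    fix \<tau>' assume "\<tau>' \<in> nsets E (Suc (rk M'))" "supp (fund_circuit F P' \<tau>') \<noteq> {}"
    then show "\<exists>\<tau>. supp (fund_circuit F P \<tau>) = supp (fund_circuit F P' \<tau>')"
      using obt'[of \<tau>'] circuits ground E_def by (metis order_refl)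
  qed blast
  have up': "\<exists>B'. P B' \<noteq> None \<and> B \<subseteq> B'" if B: "P' B \<noteq> None" for B
  proof (rule bases_mono_circuits[OF P'(1) P(1) _ B])
    fix \<tau>' assume "\<tau>' \<in> nsets E (Suc (rk M))" "supp (fund_circuit F P \<tau>') \<noteq> {}"
    then show "\<exists>\<tau>. supp (fund_circuit F P' \<tau>) = supp (fund_circuit F P \<tau>')"
      using obt[of \<tau>'] circuits ground E_def by (metis order_refl)
  qed blast
  have card: "card B = rk M \<and> finite B" if "P B \<noteq> None" for B using N.basisD[of B] that by auto
  have card': "card B = rk M' \<and> finite B" if "P' B \<noteq> None" for B using N'.basisD[of B] that by auto
  obtain B1 where B1: "P B1 \<noteq> None" using N.P_nonzero by auto
  obtain B2 where B2: "P' B2 \<noteq> None" using N'.P_nonzero by auto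
  \<comment> \<open>Every basis of either matroid lies in a basis of the other, so the ranks agree
    and these inclusions are equalities.\<close>
  have rk: "rk M = rk M'"
    using up[OF B1] up'[OF B2] card[OF B1] card'[OF B2] card card' by (metis card_mono order_antisym)
  have bases: "P B \<noteq> None \<longleftrightarrow> P' B \<noteq> None" for B
    using up[of B] up'[of B] card card' rk by (metis card_subset_eq)
  have adj: "tmul F (P (insert y (B - {x}))) (P' B) = tmul F (P B) (P' (insert y (B - {x})))"
    if B: "P B \<noteq> None" and x: "x \<in> B" and y: "y \<notin> B" and B': "P (insert y (B - {x})) \<noteq> None" for B x y
  proof -
    define \<tau> where "\<tau> = insert y B"
    have sets: "\<tau> - {y} = B" "\<tau> - {x} = insert y (B - {x})" using x y by (auto simp: \<tau>_def)
    have "x \<in> \<tau>" "y \<in> \<tau>" using x by (auto simp: \<tau>_def)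
    have "y \<in> E" using N.basisD(1)[of "insert y (B - {x})"] B' by auto
    then have \<tau>: "\<tau> \<in> nsets E (Suc (rk M))" using N.basisD[of B] B y by (auto simp: nsets_def \<tau>_def)
    have supp: "x \<in> supp (fund_circuit F P \<tau>)" "y \<in> supp (fund_circuit F P \<tau>)"
      using B B' x sets by (auto simp: supp_fund_circuit \<tau>_def)
    \<comment> \<open>The circuit of \<open>M\<close> inside \<open>\<tau>\<close> is a circuit of
      \<open>M'\<close>, possibly coming from a different set \<open>\<tau>'\<close>;
      \<open>circuit_ratio_subset\<close> carries the ratio of its entries back to
      \<open>\<tau>\<close>.\<close>
    obtain c \<tau>' where c: "c \<in> carrier F" "\<tau>' \<in> nsets E (Suc (rk M'))"
      "\<And>i. fund_circuit F P \<tau> i = tmul F (Some c) (fund_circuit F P' \<tau>' i)"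
      "supp (fund_circuit F P \<tau>) = supp (fund_circuit F P' \<tau>')"
      by (rule obt[OF _ _ _ _ _ \<tau>]) (use supp circuits ground E_def in auto)
    have s: "supp (fund_circuit F P \<tau>) = supp (fund_circuit F P' \<tau>)"
      unfolding supp_fund_circuit using bases by auto
    have sub: "N'.circ \<tau>' \<subseteq> \<tau>" using c(4) N'.supp_fund_circuit_circ by (auto simp: supp_fund_circuit)
    have xy: "x \<in> N'.circ \<tau>'" "y \<in> N'.circ \<tau>'" using supp c(4) N'.supp_fund_circuit_circ by auto
    have "P' (\<tau> - {x}) \<noteq> None" using B' bases sets by auto
    then have r: "tmul F (fund_circuit F P' \<tau> x) (fund_circuit F P' \<tau>' y)
       = tmul F (fund_circuit F P' \<tau> y) (fund_circuit F P' \<tau>' x)"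
      using \<tau> rk by (intro N'.circuit_ratio_subset[OF _ c(2) sub xy]) auto
    have "tmul F (fund_circuit F P' \<tau> x) (fund_circuit F P \<tau> y)
        = tmul F (Some c) (tmul F (fund_circuit F P' \<tau> x) (fund_circuit F P' \<tau>' y))"
      unfolding c(3) using c(1) by (intro tmul_left_comm) auto
    also have "\<dots> = tmul F (fund_circuit F P' \<tau> y) (fund_circuit F P \<tau> x)"
      unfolding c(3) r using c(1) by (intro tmul_left_comm) auto
    finally have "signed F (eps \<tau> x + eps \<tau> y) (tmul F (P' (insert y (B - {x}))) (P B)) =
        signed F (eps \<tau> x + eps \<tau> y) (tmul F (P' B) (P (insert y (B - {x}))))"
      using sets \<open>x \<in> \<tau>\<close> \<open>y \<in> \<tau>\<close> by (simp add: fund_circuit_eps signed_simps add.commute)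
    then have "tmul F (P' (insert y (B - {x}))) (P B) = tmul F (P' B) (P (insert y (B - {x})))"
      unfolding signed_def by (rule tmul_left_cancel) auto
    then show ?thesis using tmul_comm by (metis N.P_closed N'.P_closed)
  qed
  \<comment> \<open>Walk from \<open>B\<close> to \<open>B1\<close> by single exchanges, with
    \<open>adj\<close> comparing the two vectors along each of them.\<close>
  have proportional: "tmul F (P B) (P' B1) = tmul F (P B1) (P' B)" if "P B \<noteq> None" for B
    using that
  proof (induction "card (B - B1)" arbitrary: B rule: less_induct)
    case (less B)
    show ?case
    proof (cases "B = B1")
      case False
      obtain x where x: "x \<in> B" "x \<notin> B1"
        using N.basis_diff_obtain[of B B1] less.prems B1 False by auto
      obtain y where y: "y \<in> B1" "y \<notin> B" "insert y (B - {x}) \<in> {I. P I \<noteq> None}"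
        by (rule basis_exchangeD[OF N.exchange _ _ x]) (use less.prems B1 in auto)
      define B' where "B' = insert y (B - {x})"
      have PB': "P B' \<noteq> None" using y by (simp add: B'_def)
      have "B' - B1 = (B - B1) - {x}" using y by (auto simp: B'_def)
      then have "card (B' - B1) < card (B - B1)"
        using x card[OF less.prems] by (metis card_Diff1_less_iff DiffI finite_Diff)
      then have IH: "tmul F (P B') (P' B1) = tmul F (P B1) (P' B')" using less.hyps PB' by blast
      have a: "tmul F (P B') (P' B) = tmul F (P B) (P' B')"
        using adj[OF less.prems x(1) y(2)] PB' unfolding B'_def by blast
      have "tmul F (P B') (tmul F (P B) (P' B1)) = tmul F (P B) (tmul F (P B') (P' B1))"
        by (rule tmul_left_comm) auto
      also have "\<dots> = tmul F (P B1) (tmul F (P B) (P' B'))" unfolding IH by (rule tmul_left_comm) auto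
      also have "\<dots> = tmul F (P B') (tmul F (P B1) (P' B))" unfolding a[symmetric] by (rule tmul_left_comm) auto
      finally show ?thesis by (rule tmul_left_cancel) (use PB' in auto)
    qed simp
  qed
  obtain a where a: "P B1 = Some a" "a \<in> carrier F" using B1 N.P_closed[of B1] by (cases "P B1") auto
  obtain b where b: "P' B1 = Some b" "b \<in> carrier F"
    using B1 bases N'.P_closed[of B1] by (cases "P' B1") auto
  have "P' B = tmul F (Some (inv a \<otimes> b)) (P B)" for B
  proof (cases "P B")
    case None
    then show ?thesis using bases[of B] by auto
  next
    case (Some p)
    then obtain q where q: "P' B = Some q" using bases[of B] by auto
    have c: "p \<in> carrier F" "q \<in> carrier F" using N.P_closed[of B] N'.P_closed[of B] Some q by auto
    have "p \<otimes> b = a \<otimes> q" using proportional[of B] Some q a b by simp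
    then have "q = inv a \<otimes> b \<otimes> p" using a b c by (metis inv_solve_left m_assoc m_comm inv_closed m_closed)
    then show ?thesis using Some q by simp
  qed
  then have "scale_class F P' = scale_class F P"
    using a b by (intro scale_class_scale[of "inv a \<otimes> b"]) auto
  then show ?thesis using P P' rk ground by simp
qed

end

section \<open>Minors, contractions and coloops\<close>

text \<open>The signs are chosen such that fundamental circuits restrict to fundamental circuits.\<close>

definition minor_plucker :: "'a tract \<Rightarrow> 'e::linorder set \<Rightarrow> 'e set \<Rightarrow> ('e set \<Rightarrow> 'a option)
    \<Rightarrow> 'e set \<Rightarrow> 'a option" where
  "minor_plucker F K S P = (\<lambda>B. if B \<subseteq> S then signed F (\<Sum>b\<in>B. eps K b) (P (K \<union> B)) else None)"

text \<open>A right inverse of contraction: \<open>minor_plucker F A E\<close> takes it back to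
  \<open>P\<close>, and this fixes the signs.\<close>

definition coloop_plucker :: "'a tract \<Rightarrow> 'e::linorder set \<Rightarrow> 'e set \<Rightarrow> ('e set \<Rightarrow> 'a option)
    \<Rightarrow> 'e set \<Rightarrow> 'a option" where
  "coloop_plucker F A E P = (\<lambda>B. if A \<subseteq> B \<and> B \<subseteq> A \<union> E
     then signed F (\<Sum>b\<in>B - A. eps A b) (P (B - A)) else None)"

context tract
begin

lemma minor_plucker_closed [simp, intro]:
  "(\<And>I. P I \<in> elems F) \<Longrightarrow> minor_plucker F K S P B \<in> elems F"
  by (simp add: minor_plucker_def)

text \<open>The factors of each term carry the sign exponents of \<open>insert j I\<close> and
  \<open>J - {j}\<close>, whose sum does not depend on \<open>j\<close>. On the other side
  \<open>eps K j\<close> enters twice and cancels.\<close>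

lemma minor_plucker_rel_iff:
  assumes P: "\<And>I. P I \<in> elems F" and fin: "finite K" "finite S" and K: "K \<inter> S = {}"
    and IJ: "I \<subseteq> S" "J \<subseteq> S"
  shows "plucker_rel F (minor_plucker F K S P) I J \<longleftrightarrow> plucker_rel F P (K \<union> I) (K \<union> J)"
proof -
  have f: "finite I" "finite J" using IJ fin finite_subset by auto
  let ?g = "\<lambda>j. signed F (eps (K \<union> J) j + eps (K \<union> I) j)
      (tmul F (P (insert j (K \<union> I))) (P (K \<union> J - {j})))"
  let ?c = "(\<Sum>b\<in>I. eps K b) + (\<Sum>b\<in>J. eps K b)"
  have D: "K \<union> J - (K \<union> I) = J - I" using K IJ by auto
  have "formal_sum (\<lambda>j. signed F (eps J j + eps I j)
      (tmul F (minor_plucker F K S P (insert j I)) (minor_plucker F K S P (J - {j})))) (J - I)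
    = formal_sum (\<lambda>j. signed F ?c (?g j)) (J - I)"
  proof (rule formal_sum_cong)
    fix j assume j: "j \<in> J - I"
    have jK: "j \<notin> K" "j \<in> S" using j K IJ by auto
    have s: "K \<union> insert j I = insert j (K \<union> I)" "K \<union> (J - {j}) = K \<union> J - {j}" using jK by auto
    have e: "eps (K \<union> J) j = eps K j + eps J j" "eps (K \<union> I) j = eps K j + eps I j"
      using fin f K IJ by (auto intro!: eps_union)
    have "(\<Sum>b\<in>J. eps K b) = eps K j + (\<Sum>b\<in>J - {j}. eps K b)"
      using j f by (simp add: sum.remove)
    moreover have "(\<Sum>b\<in>insert j I. eps K b) = eps K j + (\<Sum>b\<in>I. eps K b)" using j f by simp
    ultimately show "signed F (eps J j + eps I j)
        (tmul F (minor_plucker F K S P (insert j I)) (minor_plucker F K S P (J - {j})))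
      = signed F ?c (?g j)"
      using IJ jK P unfolding minor_plucker_def s e
      by (auto simp: signed_simps intro!: signed_cong)
  qed
  then show ?thesis
    using P fin f D by (simp add: plucker_rel_iff formal_sum_signed)
qed

lemma fund_circuit_minor:
  assumes P: "\<And>I. P I \<in> elems F" and fin: "finite K" and K: "K \<inter> S = {}"
    and T: "T \<subseteq> S" "finite T" and i: "i \<notin> K"
  shows "fund_circuit F (minor_plucker F K S P) T i
       = signed F (\<Sum>b\<in>T. eps K b) (fund_circuit F P (K \<union> T) i)"
proof (cases "i \<in> T")
  case True
  have "K \<union> (T - {i}) = K \<union> T - {i}" using i by auto
  moreover have "eps (K \<union> T) i = eps K i + eps T i"
    using fin T K by (auto intro!: eps_union)
  moreover have "(\<Sum>b\<in>T. eps K b) = eps K i + (\<Sum>b\<in>T - {i}. eps K b)"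
    using True T by (simp add: sum.remove)
  moreover have "T - {i} \<subseteq> S" using T by auto
  ultimately show ?thesis
    using True P by (auto simp: fund_circuit_eps minor_plucker_def signed_simps intro!: signed_cong)
qed (use i in \<open>auto simp: fund_circuit_eps\<close>)

text \<open>This is the contraction of \<open>K\<close> followed by the deletion of all elements
  outside \<open>S\<close>. Adding \<open>K\<close> to both \<open>I\<close> and \<open>J\<close>
  does not change \<open>J - I\<close>, so three-term relations remain three-term relations.\<close>

lemma plucker_minor:
  assumes P: "is_plucker k F E r P" and E: "finite E" and KS: "K \<subseteq> E" "S \<subseteq> E" "K \<inter> S = {}"
    and r: "r = card K + r'" and ne: "B0 \<subseteq> S" "P (K \<union> B0) \<noteq> None"
  shows "is_plucker k F S r' (minor_plucker F K S P)"
proof -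
  interpret P: weak_plucker_fun F E r P
    by (rule weak_plucker_funI[OF E P])
  let ?Q = "minor_plucker F K S P"
  have fin: "finite K" "finite S" using KS E by (auto intro: finite_subset)
  have card: "card (K \<union> B) = card K + card B" if "B \<subseteq> S" for B
    using that fin KS by (intro card_Un_disjoint) (auto intro: finite_subset)
  have supp: "?Q B \<noteq> None \<longleftrightarrow> B \<subseteq> S \<and> P (K \<union> B) \<noteq> None" for B
    by (simp add: minor_plucker_def)
  have pf: "plucker_fun F S r' ?Q"
    unfolding plucker_fun_def
  proof (intro conjI allI impI)
    fix I assume I: "I \<notin> nsets S r'"
    show "?Q I = None"
    proof (rule ccontr)
      assume "?Q I \<noteq> None"
      then have "I \<subseteq> S" "card (K \<union> I) = r" using supp P.basisD(3)[of "K \<union> I"] by auto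
      then show False using I card[of I] r fin by (auto simp: nsets_def intro: finite_subset)
    qed
  qed (use ne supp in auto)
  have ex: "basis_exchange {I. ?Q I \<noteq> None}"
    unfolding basis_exchange_def
  proof (intro ballI)
    fix I J i assume I: "I \<in> {I. ?Q I \<noteq> None}" and J: "J \<in> {I. ?Q I \<noteq> None}" and i: "i \<in> I - J"
    have iK: "i \<notin> K" using i I supp KS by auto
    then obtain j where j: "j \<in> K \<union> J" "j \<notin> K \<union> I" "insert j (K \<union> I - {i}) \<in> {I. P I \<noteq> None}"
      by (rule_tac basis_exchangeD[OF P.exchange, of "K \<union> I" "K \<union> J" i]) (use I J i supp in auto)
    have "insert j (K \<union> I - {i}) = K \<union> insert j (I - {i})" using iK by auto
    then show "\<exists>j \<in> J - I. insert j (I - {i}) \<in> {I. ?Q I \<noteq> None}"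
      using j I J supp by (intro bexI[of _ j]) auto
  qed
  have cards: "Suc (card (K \<union> I)) = r" "card (K \<union> J) = Suc r" "card (K \<union> J - (K \<union> I)) = card (J - I)"
    if "I \<subseteq> S" "J \<subseteq> S" "Suc (card I) = r'" "card J = Suc r'" for I J
  proof -
    have "K \<union> J - (K \<union> I) = J - I" using that KS by auto
    then show "card (K \<union> J - (K \<union> I)) = card (J - I)" by simp
  qed (use card r that in auto)
  have sub: "K \<union> I \<subseteq> E" if "I \<subseteq> S" for I using that KS by auto
  note rel = minor_plucker_rel_iff[of P, OF P.P_closed fin KS(3)]
  show ?thesis
  proof (cases k)
    case Weak
    have "plucker_rel F (minor_plucker F K S P) I J"
      if "I \<subseteq> S" "J \<subseteq> S" "Suc (card I) = r'" "card J = Suc r'" "card (J - I) = 3" for I J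
      using cards[OF that(1-4)] that sub P Weak unfolding rel[OF that(1,2)]
      by (simp add: weak_plucker_def)
    then have "weak_plucker F S r' (minor_plucker F K S P)"
      unfolding weak_plucker_def using pf ex by blast
    then show ?thesis using Weak by simp
  next
    case Strong
    have "plucker_rel F (minor_plucker F K S P) I J"
      if "I \<subseteq> S" "J \<subseteq> S" "Suc (card I) = r'" "card J = Suc r'" for I J
      using cards[OF that(1-4)] that sub P Strong unfolding rel[OF that(1,2)]
      by (simp add: strong_plucker_def)
    then have "strong_plucker F S r' (minor_plucker F K S P)"
      unfolding strong_plucker_def using pf by blast
    then show ?thesis using Strong by simp
  qed
qed

text \<open>The circuit of the minor on \<open>T\<close> is, up to sign, the circuit of
  \<open>P\<close> on \<open>K \<union> T\<close> with the coordinates in \<open>K\<close>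
  forgotten; the terms lost in this way vanish because \<open>W\<close> is zero there.\<close>

lemma covec_minor:
  assumes P: "\<And>I. P I \<in> elems F" and W: "\<And>i. W i \<in> elems F" and fin: "finite K" "finite S"
    and K: "K \<inter> S = {}" "K \<subseteq> E" "S \<subseteq> E" and r: "r = card K + r'"
    and zero: "\<And>i. i \<in> K \<Longrightarrow> W i = None"
    and cov: "covec F E r P W"
  shows "covec F S r' (minor_plucker F K S P) W"
  unfolding covec_def
proof
  fix T assume "T \<in> nsets S (Suc r')"
  then have T: "T \<subseteq> S" "finite T" "card T = Suc r'" by (auto simp: nsets_def)
  have KT: "K \<union> T \<in> nsets E (Suc r)"
    using T K fin r card_Un_disjoint[of K T] by (auto simp: nsets_def)
  let ?c = "\<Sum>b\<in>T. eps K b"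
  have "covec_sum F (minor_plucker F K S P) W T
    = formal_sum (\<lambda>i. signed F ?c (signed F (eps (K \<union> T) i) (tmul F (P (K \<union> T - {i})) (W i)))) T"
  proof (rule formal_sum_cong)
    fix i assume i: "i \<in> T"
    then have "i \<notin> K" using T K by auto
    then show "signed F (eps T i) (tmul F (minor_plucker F K S P (T - {i})) (W i))
      = signed F ?c (signed F (eps (K \<union> T) i) (tmul F (P (K \<union> T - {i})) (W i)))"
      using fund_circuit_minor[of P K S T i, OF P fin(1) K(1) T(1,2)] i P W
      by (simp add: fund_circuit_eps tmul_signed_left[symmetric])
  qed
  moreover have "formal_sum (\<lambda>i. signed F (eps (K \<union> T) i) (tmul F (P (K \<union> T - {i})) (W i))) (K \<union> T)
     = formal_sum (\<lambda>i. signed F (eps (K \<union> T) i) (tmul F (P (K \<union> T - {i})) (W i))) T"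
    using zero T K by (intro formal_sum_mono_neutral) auto
  moreover have "formal_sum (\<lambda>i. signed F (eps (K \<union> T) i) (tmul F (P (K \<union> T - {i})) (W i))) (K \<union> T) \<in> null F"
    using cov KT unfolding covec_def by (rule bspec)
  ultimately show "covec_sum F (minor_plucker F K S P) W T
      \<in> null F"
    using P W T by (simp add: formal_sum_signed)
qed

end

section \<open>Circuits of a contraction\<close>

context weak_plucker_fun
begin

text \<open>Take \<open>e\<close> in the circuit outside \<open>A\<close> and extend the circuit
  without \<open>e\<close> to a basis by elements of \<open>K \<union> (T - {i})\<close>. This basis
  cannot contain \<open>e\<close>, so it has fewer than \<open>card (T - {i})\<close> elements
  outside \<open>A\<close> and at most \<open>card K\<close> inside, which is too few.\<close>

lemma contraction_support:
  assumes T: "T \<inter> A = {}" "finite T" and K: "K \<subseteq> A" and max: "\<And>B. P B \<noteq> None \<Longrightarrow> card (B \<inter> A) \<le> card K"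
    and i: "i \<in> T" "P (K \<union> (T - {i})) \<noteq> None"
    and C: "circ \<tau> - A \<noteq> {}" "circ \<tau> - A \<subseteq> T - {i}"
  shows False
proof -
  obtain e where e: "e \<in> circ \<tau>" "e \<notin> A" using C by auto
  then have eT: "e \<in> T" "e \<noteq> i" using C by auto
  have 1: "\<tau> - {e} \<in> {I. P I \<noteq> None}" using e by (auto simp: circ_def)
  have 2: "circ \<tau> - {e} \<subseteq> \<tau> - {e}" by (auto simp: circ_def)
  obtain B where B: "B \<in> {I. P I \<noteq> None}" "circ \<tau> - {e} \<subseteq> B" "B \<subseteq> (circ \<tau> - {e}) \<union> (K \<union> (T - {i}))"
    by (rule augment[OF 1 2, of "K \<union> (T - {i})"]) (use i in auto)
  have "e \<notin> B" using circ_not_subset_basis[of \<tau> B] B e by auto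
  then have "B - A \<subseteq> T - {i} - {e}" using B C K by auto
  then have le: "card (B - A) \<le> card (T - {i} - {e})" using T by (intro card_mono) auto
  have "card (T - {i} - {e}) < card (T - {i})" using T eT by (intro card_Diff1_less) auto
  moreover have "card (B \<inter> A) \<le> card K" using max B by auto
  moreover have "card B = card (B \<inter> A) + card (B - A)"
    using basisD(2)[OF B(1)] by (simp add: card_Int_Diff)
  moreover have "card B = card K + card (T - {i})"
  proof -
    have "finite K" using basisD(2)[of "K \<union> (T - {i})"] i by auto
    then have "card (K \<union> (T - {i})) = card K + card (T - {i})"
      using T K by (intro card_Un_disjoint) auto
    then show ?thesis using basisD(3)[OF B(1)] basisD(3)[of "K \<union> (T - {i})"] i by auto
  qed
  ultimately show False using le by linarith
qed

text \<open>A circuit with minimal trace outside \<open>A\<close> is compared with the fundamental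
  circuit of \<open>K \<union> T\<close> through a third set \<open>\<tau>\<close>, which contains
  the whole circuit and meets \<open>A\<close> in some \<open>K'\<close> of the same size as
  \<open>K\<close>.\<close>

lemma contraction_circuit:
  assumes K: "K \<subseteq> A" and B0: "P B0 \<noteq> None" "B0 \<inter> A = K"
    and max: "\<And>B. P B \<noteq> None \<Longrightarrow> card (B \<inter> A) \<le> card K"
    and \<tau>': "\<tau>' \<in> nsets E (Suc r)" and D: "i \<in> circ \<tau>'" "i \<notin> A"
    and minimal: "\<And>\<sigma>. \<sigma> \<in> nsets E (Suc r) \<Longrightarrow> circ \<sigma> - A \<noteq> {} \<Longrightarrow> \<not> circ \<sigma> - A \<subset> circ \<tau>' - A"
  obtains T where "T \<subseteq> E - A" "K \<union> T \<in> nsets E (Suc r)" "i \<in> T" "P (K \<union> T - {i}) \<noteq> None"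
    "circ \<tau>' - A \<subseteq> T"
    "\<And>j. j \<in> circ \<tau>' - A \<Longrightarrow> tmul F (fund_circuit F P (K \<union> T) i) (fund_circuit F P \<tau>' j)
      = tmul F (fund_circuit F P (K \<union> T) j) (fund_circuit F P \<tau>' i)"
proof -
  have mem: "X \<in> {I. P I \<noteq> None}" if "P X \<noteq> None" for X using that by simp
  have fin: "finite B" if "P B \<noteq> None" for B using basisD(2)[OF mem[OF that]] .
  have card: "card B = r" if "P B \<noteq> None" for B using basisD(3)[OF mem[OF that]] .
  have \<tau>'i: "\<tau>' - {i} \<in> {I. P I \<noteq> None}" using D by (auto simp: circ_def)
  have "circ \<tau>' \<inter> A \<subseteq> \<tau>' - {i}" using D by (auto simp: circ_def)
  then obtain B1 where "B1 \<in> {I. P I \<noteq> None}" "circ \<tau>' \<inter> A \<subseteq> B1" "B1 \<subseteq> (circ \<tau>' \<inter> A) \<union> B0"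
    by (rule augment[OF \<tau>'i _ mem[OF B0(1)]])
  then have B1: "P B1 \<noteq> None" "circ \<tau>' \<inter> A \<subseteq> B1" "B1 \<subseteq> (circ \<tau>' \<inter> A) \<union> B0" by auto
  \<comment> \<open>Another maximum independent subset of \<open>A\<close>, now containing the part
    of the given circuit that lies in \<open>A\<close>.\<close>
  define K' where "K' = B1 \<inter> A"
  have K'max: "card K' = card K"
  proof (rule antisym)
    show "card K' \<le> card K" using max B1(1) by (simp add: K'_def)
    have "B1 - A \<subseteq> B0 - A" using B1(3) by auto
    then have "card (B1 - A) \<le> card (B0 - A)" using fin[OF B0(1)] by (intro card_mono) auto
    moreover have "card B1 = card K' + card (B1 - A)" "card B0 = card K + card (B0 - A)"
      using fin B1(1) B0 unfolding K'_def by (metis card_Int_Diff)+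
    ultimately show "card K \<le> card K'" using card[OF B0(1)] card[OF B1(1)] by linarith
  qed
  have fK': "finite K'" using fin[OF B1(1)] by (simp add: K'_def)
  \<comment> \<open>\<open>L\<close> contains no circuit: one inside \<open>A\<close> would lie in
    the basis \<open>B1\<close>, and any other would have a strictly smaller trace outside
    \<open>A\<close>, since \<open>i\<close> is missing.\<close>
  define L where "L = K' \<union> (circ \<tau>' - {i})"
  have "\<tau>' \<subseteq> E" using \<tau>' by (auto simp: nsets_def)
  then have LE: "L \<subseteq> E" using basisD(1)[OF mem[OF B1(1)]] by (auto simp: L_def K'_def circ_def)
  have free: "\<not> circ \<sigma> \<subseteq> L" if \<sigma>: "\<sigma> \<in> nsets E (Suc r)" "circ \<sigma> \<noteq> {}" for \<sigma>
  proof
    assume sub: "circ \<sigma> \<subseteq> L"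
    show False
    proof (cases "circ \<sigma> - A = {}")
      case True
      then have "circ \<sigma> \<subseteq> B1" using sub B1(2) by (auto simp: L_def K'_def)
      then show False using circ_not_subset_basis[OF \<sigma>(2) mem[OF B1(1)]] by blast
    next
      case False
      have "circ \<sigma> - A \<subset> circ \<tau>' - A" using sub D by (auto simp: L_def K'_def)
      then show False using minimal \<sigma>(1) False by blast
    qed
  qed
  obtain B where B: "P B \<noteq> None" "L \<subseteq> B"
    by (rule circuit_free_subset_basis[of L]) (use P_nonzero LE free in auto)
  have BA: "B \<inter> A = K'"
  proof (rule card_seteq[symmetric])
    show "K' \<subseteq> B \<inter> A" using B(2) by (auto simp: L_def K'_def)
  qed (use max[OF B(1)] K'max fin[OF B(1)] in auto)
  have iB: "i \<notin> B"
  proof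
    assume "i \<in> B"
    then have "circ \<tau>' \<subseteq> B" using B(2) by (auto simp: L_def)
    then show False using circ_not_subset_basis[of \<tau>' B] D B by auto
  qed
  have "i \<in> E" using D \<open>\<tau>' \<subseteq> E\<close> by (auto simp: circ_def)
  define \<tau> where "\<tau> = insert i B"
  define T where "T = insert i (B - A)"
  have BE: "B \<subseteq> E" using basisD(1)[OF mem[OF B(1)]] .
  have \<tau>: "\<tau> \<in> nsets E (Suc r)" "\<tau> - {i} = B"
    using iB BE card[OF B(1)] fin[OF B(1)] \<open>i \<in> E\<close> by (auto simp: \<tau>_def nsets_def)
  \<comment> \<open>Extending \<open>K\<close> by elements of \<open>B\<close> gives a basis that
    meets \<open>A\<close> in \<open>K\<close> alone, by maximality of \<open>K\<close>; by size it
    then contains all of \<open>B - A\<close>.\<close>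
  have KB: "P (K \<union> (B - A)) \<noteq> None"
  proof -
    have "K \<subseteq> B0" using B0 by auto
    then obtain B3 where "B3 \<in> {I. P I \<noteq> None}" "K \<subseteq> B3" "B3 \<subseteq> K \<union> B"
      by (rule augment[OF mem[OF B0(1)] _ mem[OF B(1)]])
    then have B3: "P B3 \<noteq> None" "K \<subseteq> B3" "B3 \<subseteq> K \<union> B" by auto
    have "B3 \<inter> A = K"
      by (rule card_seteq[symmetric]) (use B3 K max[OF B3(1)] fin[OF B3(1)] in auto)
    then have "B3 \<subseteq> K \<union> (B - A)" using B3 by auto
    moreover have "card (K \<union> (B - A)) \<le> card B3"
    proof -
      have "card (K \<union> (B - A)) \<le> card K + card (B - A)" by (rule card_Un_le)
      moreover have "card B = card K' + card (B - A)" using BA fin[OF B(1)] by (metis card_Int_Diff)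
      ultimately show ?thesis using card[OF B(1)] card[OF B3(1)] K'max by simp
    qed
    moreover have "finite (K \<union> (B - A))" using fin[OF B(1)] fin[OF B0(1)] B0(2) by auto
    ultimately have "B3 = K \<union> (B - A)" using card_seteq[of "K \<union> (B - A)" B3] by simp
    then show ?thesis using B3 by simp
  qed
  have KTi: "K \<union> T - {i} = K \<union> (B - A)" using iB D K by (auto simp: T_def)
  have TE: "T \<subseteq> E - A" using BE D \<open>i \<in> E\<close> by (auto simp: T_def)
  have KT: "K \<union> T \<in> nsets E (Suc r)"
  proof -
    have "K \<union> T = insert i (K \<union> (B - A))" by (auto simp: T_def)
    moreover have "i \<notin> K \<union> (B - A)" using iB K D by auto
    ultimately show ?thesis using card[OF KB] fin[OF KB] basisD(1)[OF mem[OF KB]] \<open>i \<in> E\<close>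
      by (auto simp: nsets_def)
  qed
  have sub: "circ \<tau>' \<subseteq> \<tau>" using B(2) by (auto simp: \<tau>_def L_def)
  have \<tau>T: "\<tau> = K' \<union> T" using BA by (auto simp: \<tau>_def T_def)
  have circT: "circ \<tau>' - A \<subseteq> T" using sub by (auto simp: \<tau>_def T_def)
  have r1: "tmul F (fund_circuit F P \<tau> i) (fund_circuit F P \<tau>' j)
       = tmul F (fund_circuit F P \<tau> j) (fund_circuit F P \<tau>' i)" if "j \<in> circ \<tau>'" for j
    using circuit_ratio_subset[OF \<tau>(1) \<tau>' sub D(1) that] B(1) \<tau>(2) by simp
  \<comment> \<open>The path from \<open>\<tau>\<close> to \<open>K \<union> T\<close> only changes
    elements of \<open>A\<close>. Each set \<open>\<sigma>\<close> on it already has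
    \<open>card K\<close> elements in \<open>A\<close>, so inserting a further \<open>b'\<close>
    exceeds the maximum and the coordinate in question is zero.\<close>
  have r2: "tmul F (fund_circuit F P \<tau> i) (fund_circuit F P (K \<union> T) j)
       = tmul F (fund_circuit F P \<tau> j) (fund_circuit F P (K \<union> T) i)" if j: "j \<in> T" for j
  proof (rule circuit_ratio[OF \<tau>(1) KT])
    show "i \<in> \<tau> \<inter> (K \<union> T)" "j \<in> \<tau> \<inter> (K \<union> T)" using j by (auto simp: \<tau>T) (auto simp: T_def)
    show "P (\<tau> - {i}) \<noteq> None" "P (K \<union> T - {i}) \<noteq> None" using B KB \<tau>(2) KTi by auto
    fix \<sigma> b b' assume \<sigma>: "\<sigma> \<in> nsets E (Suc r)" "\<tau> \<inter> (K \<union> T) \<subseteq> \<sigma>" "\<sigma> \<subseteq> \<tau> \<union> (K \<union> T)"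
      and b': "b' \<in> K \<union> T - \<sigma>"
    have f: "finite \<sigma>" using \<sigma>(1) by (auto simp: nsets_def)
    have T\<sigma>: "T \<subseteq> \<sigma>" using \<sigma>(2) by (auto simp: \<tau>T)
    then have b'K: "b' \<in> A" "b' \<notin> \<sigma>" using b' K by auto
    have "\<sigma> - A = T" using \<sigma>(3) T\<sigma> TE K by (auto simp: \<tau>T K'_def)
    then have "card \<sigma> = card (\<sigma> \<inter> A) + card T" using f by (metis card_Int_Diff)
    moreover have "card \<tau> = card K' + card T"
    proof -
      have "\<tau> \<inter> A = K'" "\<tau> - A = T" using TE by (auto simp: \<tau>T K'_def)
      then show ?thesis using \<tau>(1) by (metis (no_types, lifting) card_Int_Diff mem_Collect_eq nsets_def)
    qed
    ultimately have "card (\<sigma> \<inter> A) = card K" using \<sigma>(1) \<tau>(1) K'max by (auto simp: nsets_def)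
    moreover have "insert b' (\<sigma> - {i, j}) \<inter> A = insert b' (\<sigma> \<inter> A)" using b'K D j TE by auto
    ultimately have "card (insert b' (\<sigma> - {i, j}) \<inter> A) = Suc (card K)" using b'K f by simp
    then show "P (\<sigma> - {b}) = None \<or> P (insert b' (\<sigma> - {i, j})) = None"
      using max[of "insert b' (\<sigma> - {i, j})"] by fastforce
  qed
  show ?thesis
  proof (rule that[OF TE KT _ _ circT])
    show "i \<in> T" by (simp add: T_def)
    show "P (K \<union> T - {i}) \<noteq> None" using KB KTi by simp
    fix j assume j: "j \<in> circ \<tau>' - A"
    let ?f = "fund_circuit F P"
    have "tmul F (?f \<tau> i) (tmul F (?f (K \<union> T) i) (?f \<tau>' j)) = tmul F (?f (K \<union> T) i) (tmul F (?f \<tau> i) (?f \<tau>' j))"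
      by (rule tmul_left_comm) auto
    also have "\<dots> = tmul F (?f (K \<union> T) i) (tmul F (?f \<tau> j) (?f \<tau>' i))" using r1[of j] j by simp
    also have "\<dots> = tmul F (tmul F (?f \<tau> j) (?f (K \<union> T) i)) (?f \<tau>' i)"
      using tmul_left_comm[of "?f (K \<union> T) i" "?f \<tau> j" "?f \<tau>' i"] tmul_assoc[of "?f \<tau> j" "?f (K \<union> T) i" "?f \<tau>' i"]
      by simp
    also have "\<dots> = tmul F (?f \<tau> i) (tmul F (?f (K \<union> T) j) (?f \<tau>' i))"
      using r2[of j] j circT tmul_assoc[of "?f \<tau> i" "?f (K \<union> T) j" "?f \<tau>' i"] by auto
    finally show "tmul F (?f (K \<union> T) i) (?f \<tau>' j) = tmul F (?f (K \<union> T) j) (?f \<tau>' i)"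
      by (rule tmul_left_cancel) (use B \<tau> in \<open>auto simp: fund_circuit_eps \<tau>_def\<close>)
  qed
qed

end

context tract
begin

lemma signed_eq_tmul: "signed F n x = tmul F (Some (neg_one F [^] n)) x"
  by (simp add: signed_def)

lemma signed_swap: "y \<in> elems F \<Longrightarrow> x = signed F n y \<Longrightarrow> y = signed F n x"
  by (simp add: signed_signed signed_even)

lemma circuitsI:
  assumes "\<And>I. P I \<in> elems F" "pluckers M = scale_class F P" "ground M = E" "rk M = r"
    and "c \<in> carrier F" "\<tau> \<in> nsets E (Suc r)" "supp (fund_circuit F P \<tau>) \<noteq> {}"
    and "\<And>i. C i = tmul F (Some c) (fund_circuit F P \<tau> i)"
  shows "C \<in> circuits F M"
proof -
  have "C = (\<lambda>i. tmul F (Some c) (fund_circuit F P \<tau> i))" using assms by auto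
  then show ?thesis unfolding circuits_eq[of P M, OF assms(1,2)] assms(3,4) using assms(5-7) by blast
qed

lemma circuitsE:
  assumes "C \<in> circuits F M"
    and "\<And>I. P I \<in> elems F" "pluckers M = scale_class F P" "ground M = E" "rk M = r"
  obtains c \<tau> where "c \<in> carrier F" "\<tau> \<in> nsets E (Suc r)" "supp (fund_circuit F P \<tau>) \<noteq> {}"
    "\<And>i. C i = tmul F (Some c) (fund_circuit F P \<tau> i)"
proof -
  obtain c \<tau> where c: "c \<in> carrier F" "\<tau> \<in> nsets E (Suc r)" "supp (fund_circuit F P \<tau>) \<noteq> {}"
    and "C = (\<lambda>i. tmul F (Some c) (fund_circuit F P \<tau> i))"
    using assms(1) unfolding circuits_eq[of P M, OF assms(2,3)] assms(4,5) by blast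
  then show ?thesis using that[OF c] by simp
qed

text \<open>\<open>K\<close> is a maximum independent subset of \<open>A\<close>, so the circuits of
  the minor at \<open>K\<close> are traces of fundamental circuits of sets
  \<open>K \<union> T\<close>. Their supports are minimal by \<open>contraction_support\<close>, and
  by \<open>contraction_circuit\<close> every minimal trace is proportional to one of them.\<close>

lemma circuits_contraction:
  assumes P: "weak_plucker_fun F E r P" and M: "pluckers M = scale_class F P" "ground M = E" "rk M = r"
    and A: "A \<subseteq> E" and K: "K \<subseteq> A" and B0: "P B0 \<noteq> None" "B0 \<inter> A = K"
    and max: "\<And>B. P B \<noteq> None \<Longrightarrow> card (B \<inter> A) \<le> card K" and r: "r = card K + r'"
    and N: "pluckers N = scale_class F (minor_plucker F K (E - A) P)" "ground N = E - A" "rk N = r'"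
  shows "circuits F N = MinSupp ((\<lambda>C. remove_coords C A) ` circuits F M)"
proof -
  interpret P: weak_plucker_fun F E r P by fact
  let ?Q = "minor_plucker F K (E - A) P"
  let ?X = "(\<lambda>C. remove_coords C A) ` circuits F M"
  have fin: "finite K" "finite E" using K A P.finite_E by (auto intro: finite_subset)
  have Q: "?Q I \<in> elems F" for I by simp
  define s where "s T = (\<Sum>b\<in>T. eps K b)" for T
  have fcQ: "fund_circuit F ?Q T i = signed F (s T) (fund_circuit F P (K \<union> T) i)"
    if "T \<subseteq> E - A" "i \<notin> A" for T i
    unfolding s_def using that K fin
    by (intro fund_circuit_minor) (auto intro: finite_subset)
  have fcQ0: "fund_circuit F ?Q T i = None" if "T \<subseteq> E - A" "i \<in> A" for T i
    using that by (auto simp: fund_circuit_eps)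
  have suppX: "supp (remove_coords C A) = P.circ \<tau> - A"
    if "c \<in> carrier F" "\<And>i. C i = tmul F (Some c) (fund_circuit F P \<tau> i)" for c C \<tau>
    using that P.supp_fund_circuit_circ[of \<tau>] by (auto simp: supp_def remove_coords_def)
  have Xobt: "\<exists>c \<tau>. c \<in> carrier F \<and> \<tau> \<in> nsets E (Suc r) \<and> P.circ \<tau> \<noteq> {} \<and> supp Y = P.circ \<tau> - A \<and>
      (\<forall>i. Y i = (if i \<in> A then None else tmul F (Some c) (fund_circuit F P \<tau> i)))" if Y: "Y \<in> ?X" for Y
  proof -
    obtain C where C: "C \<in> circuits F M" "Y = remove_coords C A" using Y by auto
    obtain c \<tau> where c: "c \<in> carrier F" "\<tau> \<in> nsets E (Suc r)" "supp (fund_circuit F P \<tau>) \<noteq> {}"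
      "\<And>i. C i = tmul F (Some c) (fund_circuit F P \<tau> i)"
      using circuitsE[of C M P E r, OF C(1) P.P_closed M] by blast
    have "supp Y = P.circ \<tau> - A" unfolding C(2) using c by (intro suppX)
    moreover have "Y i = (if i \<in> A then None else tmul F (Some c) (fund_circuit F P \<tau> i))" for i
      unfolding C(2) remove_coords_def using c by simp
    ultimately show ?thesis using c P.supp_fund_circuit_circ by blast
  qed
  have XI: "remove_coords (fund_circuit F P \<tau>) A \<in> ?X"
    "supp (remove_coords (fund_circuit F P \<tau>) A) = P.circ \<tau> - A"
    if "\<tau> \<in> nsets E (Suc r)" "P.circ \<tau> - A \<noteq> {}" for \<tau>
  proof -
    have "fund_circuit F P \<tau> \<in> circuits F M"
      using that by (intro circuitsI[of P M E r \<one> \<tau>]) (auto simp: M P.supp_fund_circuit_circ)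
    then show "remove_coords (fund_circuit F P \<tau>) A \<in> ?X" by blast
    show "supp (remove_coords (fund_circuit F P \<tau>) A) = P.circ \<tau> - A"
      by (intro suppX[of \<one>]) auto
  qed
  have KT: "K \<union> T \<in> nsets E (Suc r)" if T: "T \<in> nsets (E - A) (Suc r')" for T
    using T K A r fin card_Un_disjoint[of K T] by (auto simp: nsets_def)
  have minQ: "C \<in> MinSupp ?X" if T: "T \<in> nsets (E - A) (Suc r')" and ne: "supp (fund_circuit F ?Q T) \<noteq> {}"
    and c: "c \<in> carrier F" and C: "\<And>i. C i = tmul F (Some c) (fund_circuit F ?Q T i)" for T c C
  proof -
    have TE: "T \<subseteq> E - A" "finite T" using T by (auto simp: nsets_def)
    define d where "d = c \<otimes> neg_one F [^] (s T)"
    have d: "d \<in> carrier F" using c by (simp add: d_def)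
    have Cd: "C i = (if i \<in> A then None else tmul F (Some d) (fund_circuit F P (K \<union> T) i))" for i
      using C fcQ[OF TE(1)] fcQ0[OF TE(1)] c tmul_assoc[of "Some c" "Some (neg_one F [^] (s T))"]
      by (simp add: d_def signed_eq_tmul)
    have suppC: "supp C = P.circ (K \<union> T) - A"
      unfolding P.supp_fund_circuit_circ[symmetric] using Cd by (auto simp: supp_def)
    have suppQ: "supp C = supp (fund_circuit F ?Q T)" using C by (auto simp: supp_def)
    have CX: "C \<in> ?X"
    proof (rule image_eqI)
      show "C = remove_coords (\<lambda>i. tmul F (Some d) (fund_circuit F P (K \<union> T) i)) A"
        using Cd by (auto simp: remove_coords_def)
      show "(\<lambda>i. tmul F (Some d) (fund_circuit F P (K \<union> T) i)) \<in> circuits F M"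
      proof (rule circuitsI[of P M E r d "K \<union> T"])
        show "supp (fund_circuit F P (K \<union> T)) \<noteq> {}"
          using suppC suppQ ne P.supp_fund_circuit_circ by auto
      qed (use d KT[OF T] M in auto)
    qed
    have "\<not> supp Y \<subset> supp C" if Y: "Y \<in> ?X" "supp Y \<noteq> {}" for Y
    proof
      assume less: "supp Y \<subset> supp C"
      obtain \<tau> where \<tau>: "supp Y = P.circ \<tau> - A" using Xobt[OF Y(1)] by blast
      obtain i where i: "i \<in> supp C" "i \<notin> supp Y" using less by auto
      have "P (K \<union> T - {i}) \<noteq> None" "i \<in> T"
        using i K suppC by (auto simp: P.circ_def)
      moreover have "K \<union> T - {i} = K \<union> (T - {i})" using i suppC K by auto
      moreover have "P.circ \<tau> - A \<subseteq> T - {i}"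
        using less \<tau> suppC i K by (auto simp: P.circ_def)
      ultimately show False
        using P.contraction_support[of T A K i \<tau>, OF _ TE(2) K max] TE(1) Y(2) \<tau> by auto
    qed
    then show ?thesis unfolding MinSupp_def using CX suppQ ne by auto
  qed
  show ?thesis
  proof
    show "circuits F N \<subseteq> MinSupp ?X"
    proof
      fix C assume C: "C \<in> circuits F N"
      show "C \<in> MinSupp ?X"
        by (rule circuitsE[OF C Q N]) (rule minQ)
    qed
    show "MinSupp ?X \<subseteq> circuits F N"
    proof
      fix C assume C: "C \<in> MinSupp ?X"
      then have CX: "C \<in> ?X" "supp C \<noteq> {}" and Cmin: "\<And>Y. Y \<in> ?X \<Longrightarrow> supp Y \<noteq> {} \<Longrightarrow> \<not> supp Y \<subset> supp C"
        unfolding MinSupp_def by auto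
      obtain c \<tau> where c: "c \<in> carrier F" "\<tau> \<in> nsets E (Suc r)" "supp C = P.circ \<tau> - A"
        and Ci: "\<And>i. C i = (if i \<in> A then None else tmul F (Some c) (fund_circuit F P \<tau> i))"
        using Xobt[OF CX(1)] by blast
      obtain i where i: "i \<in> P.circ \<tau>" "i \<notin> A" using CX c by auto
      have minimal: "\<not> P.circ \<sigma> - A \<subset> P.circ \<tau> - A" if "\<sigma> \<in> nsets E (Suc r)" "P.circ \<sigma> - A \<noteq> {}" for \<sigma>
        using Cmin[OF XI(1)[OF that]] XI(2)[OF that] that(2) c(3) by auto
      obtain T where T: "T \<subseteq> E - A" "K \<union> T \<in> nsets E (Suc r)" "i \<in> T" "P (K \<union> T - {i}) \<noteq> None"
        "P.circ \<tau> - A \<subseteq> T"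
        and ratio: "\<And>j. j \<in> P.circ \<tau> - A \<Longrightarrow> tmul F (fund_circuit F P (K \<union> T) i) (fund_circuit F P \<tau> j)
          = tmul F (fund_circuit F P (K \<union> T) j) (fund_circuit F P \<tau> i)"
        using P.contraction_circuit[OF K B0 max c(2) i minimal] by blast
      have fT: "finite T" using T(1) fin by (auto intro: finite_subset)
      have "card (K \<union> T) = card K + card T"
        using fin(1) fT T(1) K by (intro card_Un_disjoint) auto
      then have Tn: "T \<in> nsets (E - A) (Suc r')" using T fT r by (auto simp: nsets_def)
      let ?f = "fund_circuit F P (K \<union> T)"
      have "?f i \<noteq> None" "fund_circuit F P \<tau> i \<noteq> None"
        using T i by (auto simp: fund_circuit_eps P.circ_def)
      then obtain a b where ab: "?f i = Some a" "fund_circuit F P \<tau> i = Some b" by auto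
      then have a: "?f i = Some a" "a \<in> carrier F"
        and b: "fund_circuit F P \<tau> i = Some b" "b \<in> carrier F"
        using P.fund_circuit_closed[of "K \<union> T" i] P.fund_circuit_closed[of \<tau> i] by auto
      have \<tau>j: "fund_circuit F P \<tau> j = tmul F (Some (inv a \<otimes> b)) (?f j)" if j: "j \<in> P.circ \<tau> - A" for j
      proof (rule tmul_left_cancel[of "?f i"])
        have "tmul F (?f i) (tmul F (Some (inv a \<otimes> b)) (?f j)) = tmul F (Some b) (?f j)"
          using a b tmul_assoc[of "Some a" "Some (inv a \<otimes> b)" "?f j"] by (simp add: m_assoc[symmetric])
        then show "tmul F (?f i) (fund_circuit F P \<tau> j) = tmul F (?f i) (tmul F (Some (inv a \<otimes> b)) (?f j))"
          using ratio[OF j] b tmul_comm[of "Some b" "?f j"] by simp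
      qed (use a b in auto)
      have circsub: "P.circ \<tau> - A \<subseteq> P.circ (K \<union> T) - A"
      proof
        fix j assume j: "j \<in> P.circ \<tau> - A"
        then have "fund_circuit F P \<tau> j \<noteq> None" using P.supp_fund_circuit_circ[of \<tau>] by (auto simp: supp_def)
        then have "?f j \<noteq> None" using \<tau>j[OF j] by auto
        then show "j \<in> P.circ (K \<union> T) - A" using j P.supp_fund_circuit_circ[of "K \<union> T"] by (auto simp: supp_def)
      qed
      have "fund_circuit F ?Q T j \<noteq> None \<longleftrightarrow> j \<notin> A \<and> ?f j \<noteq> None" for j
        using fcQ[OF T(1), of j] fcQ0[OF T(1), of j] by (cases "j \<in> A") simp_all
      then have suppQ: "supp (fund_circuit F ?Q T) = P.circ (K \<union> T) - A"
        unfolding P.supp_fund_circuit_circ[symmetric] unfolding supp_def by blast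
      have neQ: "supp (fund_circuit F ?Q T) \<noteq> {}" using suppQ circsub i by auto
      \<comment> \<open>The support of the circuit found contains that of \<open>C\<close>; as it is
        itself minimal among the traces, both supports agree, so the proportion holds at every
        coordinate.\<close>
      have "(\<lambda>i. tmul F (Some \<one>) (fund_circuit F ?Q T i)) \<in> MinSupp ?X"
        by (rule minQ[OF Tn neQ one_closed]) simp
      then have "\<not> supp C \<subset> supp (\<lambda>i. tmul F (Some \<one>) (fund_circuit F ?Q T i))"
        using CX unfolding MinSupp_def by blast
      then have eq: "P.circ \<tau> - A = P.circ (K \<union> T) - A"
        using c(3) circsub suppQ by (auto simp: supp_def)
      define e where "e = c \<otimes> (inv a \<otimes> b) \<otimes> neg_one F [^] (s T)"
      have e: "e \<in> carrier F" using a b c by (simp add: e_def)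
      have fcQe: "fund_circuit F ?Q T j \<in> elems F" for j using Q by (simp add: fund_circuit_eps)
      have "C j = tmul F (Some e) (fund_circuit F ?Q T j)" for j
      proof (cases "j \<in> P.circ \<tau> - A")
        case True
        have "?f j = tmul F (Some (neg_one F [^] (s T))) (fund_circuit F ?Q T j)"
          using signed_swap[OF _ fcQ[OF T(1), of j]] True by (simp add: signed_eq_tmul)
        then have "C j = tmul F (Some c) (tmul F (Some (inv a \<otimes> b)) (tmul F (Some (neg_one F [^] (s T))) (fund_circuit F ?Q T j)))"
          using Ci \<tau>j[OF True] True by simp
        also have "\<dots> = tmul F (Some e) (fund_circuit F ?Q T j)"
          using a(2) b(2) c(1) fcQe[of j] unfolding e_def
          by (cases "fund_circuit F ?Q T j") (auto simp: m_assoc)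
        finally show ?thesis .
      next
        case False
        then have "C j = None" "fund_circuit F ?Q T j = None"
          using c(3) eq suppQ by (auto simp: supp_def)
        then show ?thesis by simp
      qed
      then show "C \<in> circuits F N"
        using Tn neQ e N Q by (intro circuitsI[of ?Q N "E - A" r' e T]) auto
    qed
  qed
qed

text \<open>\<open>K\<close> comes from a basis meeting \<open>A\<close> in as many elements as
  possible, and \<open>fmatroid_eqI\<close> resolves the definite description. The explicit Pluecker
  vector has the strength of \<open>P\<close>, although the description speaks of weak matroids. The
  maximality of \<open>K\<close> is exported because relations at sets \<open>K \<union> I\<close>
  are later cut down to the complement of \<open>A\<close>.\<close>

lemma contract_obtain:
  assumes P: "is_plucker k F (ground M) (rk M) P" and E: "finite (ground M)"
    and M: "pluckers M = scale_class F P" and A: "A \<subseteq> ground M"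
  obtains K r' where "K \<subseteq> A" "rk M = card K + r'" "\<And>B. P B \<noteq> None \<Longrightarrow> card (B \<inter> A) \<le> card K"
    "is_plucker k F (ground M - A) r' (minor_plucker F K (ground M - A) P)"
    "contract F M A = \<lparr>ground = ground M - A, rk = r',
       pluckers = scale_class F (minor_plucker F K (ground M - A) P)\<rparr>"
proof -
  let ?E = "ground M"
  have wp: "weak_plucker_fun F ?E (rk M) P"
    by (rule weak_plucker_funI[OF E P])
  interpret P: weak_plucker_fun F ?E "rk M" P by (rule wp)
  have fA: "finite A" using A E by (rule finite_subset)
  obtain B where B: "P B \<noteq> None" using P.P_nonzero by auto
  then obtain B0 where B0: "P B0 \<noteq> None" and max: "\<And>B. P B \<noteq> None \<Longrightarrow> card (B \<inter> A) \<le> card (B0 \<inter> A)"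
    using ex_has_greatest_nat[of "\<lambda>B. P B \<noteq> None" B "\<lambda>B. card (B \<inter> A)" "Suc (card A)"] fA
    by (auto simp: less_Suc_eq_le intro: card_mono)
  define K where "K = B0 \<inter> A"
  have B0E: "B0 \<subseteq> ?E" "finite B0" "card B0 = rk M" using P.basisD[of B0] B0 by auto
  define r' where "r' = card (B0 - A)"
  have r: "rk M = card K + r'" using B0E by (metis K_def card_Int_Diff r'_def)
  let ?Q = "minor_plucker F K (?E - A) P"
  have KA: "K \<subseteq> A" by (auto simp: K_def)
  have "K \<union> (B0 - A) = B0" by (auto simp: K_def)
  then have Q: "is_plucker k F (?E - A) r' ?Q"
    using B0 B0E KA A r by (intro plucker_minor[OF P E, of K "?E - A" r' "B0 - A"]) auto
  define N where "N = \<lparr>ground = ?E - A, rk = r', pluckers = scale_class F ?Q\<rparr>"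
  have N: "is_fmatroid Weak F N"
    unfolding is_fmatroid_def using plucker_weak[OF _ Q] E by (auto simp: N_def)
  have circ: "circuits F N = MinSupp ((\<lambda>C. remove_coords C A) ` circuits F M)"
    by (rule circuits_contraction[OF wp M refl refl A KA B0]) (use r max in \<open>auto simp: K_def N_def\<close>)
  have "contract F M A = N"
    unfolding contract_def
  proof (rule the_equality)
    show "is_fmatroid Weak F N \<and> ground N = ?E - A \<and> circuits F N = MinSupp ((\<lambda>C. remove_coords C A) ` circuits F M)"
      using N circ by (simp add: N_def)
    fix N' assume "is_fmatroid Weak F N' \<and> ground N' = ?E - A \<and>
      circuits F N' = MinSupp ((\<lambda>C. remove_coords C A) ` circuits F M)"
    then show "N' = N" using N circ by (intro fmatroid_eqI) (auto simp: N_def)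
  qed
  then show ?thesis using that[OF KA r _ Q] max by (simp add: N_def K_def)
qed

text \<open>Contracting \<open>A\<close> takes \<open>coloop_plucker\<close> back to
  \<open>P\<close>, which reduces its relations and circuits to those of \<open>P\<close>; its rank
  is \<open>r + card A\<close>. It satisfies the definite description, and
  \<open>fmatroid_eqI\<close> gives uniqueness.\<close>

lemma add_coloops:
  assumes P: "weak_plucker_fun F E r P" and A: "finite A" "A \<inter> E = {}"
    and N: "ground N = E" "rk N = r" "pluckers N = scale_class F P"
  shows "is_fmatroid Weak F (add_coloops F N A)" "ground (add_coloops F N A) = E \<union> A"
    "circuits F (add_coloops F N A) = circuits F N"
proof -
  interpret P: weak_plucker_fun F E r P by fact
  let ?Q = "coloop_plucker F A E P"
  let ?r = "r + card A"
  have Q: "?Q I \<in> elems F" for I by (simp add: coloop_plucker_def)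
  have minor: "minor_plucker F A E ?Q = P"
  proof
    fix B
    show "minor_plucker F A E ?Q B = P B"
    proof (cases "B \<subseteq> E")
      case True
      then have "A \<union> B - A = B" "A \<union> B \<subseteq> A \<union> E" using A by auto
      then show ?thesis using True by (simp add: minor_plucker_def coloop_plucker_def signed_signed signed_even)
    next
      case False
      then show ?thesis using P.basisD(1)[of B] by (auto simp: minor_plucker_def)
    qed
  qed
  have supp: "?Q B \<noteq> None \<longleftrightarrow> A \<subseteq> B \<and> B \<subseteq> A \<union> E \<and> P (B - A) \<noteq> None" for B
    by (auto simp: coloop_plucker_def)
  have card: "card B = card A + card (B - A)" if "A \<subseteq> B" "finite B" for B
    using that A by (metis Int_absorb1 card_Int_Diff)
  have fEA: "finite (E \<union> A)" using A P.finite_E by auto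
  have "weak_plucker F (E \<union> A) ?r ?Q"
    unfolding weak_plucker_def
  proof (intro conjI allI impI)
    show "plucker_fun F (E \<union> A) ?r ?Q"
      unfolding plucker_fun_def
    proof (intro conjI allI impI)
      fix I assume I: "I \<notin> nsets (E \<union> A) ?r"
      show "?Q I = None"
      proof (rule ccontr)
        assume "?Q I \<noteq> None"
        then have "A \<subseteq> I" "I \<subseteq> E \<union> A" "card (I - A) = r" using supp P.basisD(3)[of "I - A"] by auto
        then show False using I card[of I] fEA by (auto simp: nsets_def intro: finite_subset)
      qed
    next
      obtain B where B: "P B \<noteq> None" using P.P_nonzero by auto
      then have "A \<union> B - A = B" "B \<subseteq> E" using A P.basisD(1)[of B] by auto
      then have "?Q (A \<union> B) \<noteq> None" using supp B by auto
      then show "\<exists>I. ?Q I \<noteq> None" by blast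
    qed (rule Q)
    show "basis_exchange {I. ?Q I \<noteq> None}"
      unfolding basis_exchange_def
    proof (intro ballI)
      fix I J i assume I: "I \<in> {I. ?Q I \<noteq> None}" and J: "J \<in> {I. ?Q I \<noteq> None}" and i: "i \<in> I - J"
      have iA: "i \<notin> A" using i J supp by auto
      obtain j where j: "j \<in> J - A" "j \<notin> I - A" "insert j (I - A - {i}) \<in> {I. P I \<noteq> None}"
        by (rule basis_exchangeD[OF P.exchange, of "I - A" "J - A" i]) (use I J i iA supp in auto)
      have "insert j (I - {i}) - A = insert j (I - A - {i})" using j by auto
      then have "?Q (insert j (I - {i})) \<noteq> None" using supp I J j iA by auto
      then show "\<exists>j \<in> J - I. insert j (I - {i}) \<in> {I. ?Q I \<noteq> None}" using j by auto
    qed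
  next
    fix I J assume IJ: "I \<subseteq> E \<union> A \<and> J \<subseteq> E \<union> A \<and> Suc (card I) = ?r \<and> card J = Suc ?r \<and> card (J - I) = 3"
    then have f: "finite I" "finite J" using fEA finite_subset by blast+
    show "plucker_rel F ?Q I J"
    proof (cases "A \<subseteq> I \<and> A \<subseteq> J")
      case True
      then have sets: "A \<union> (I - A) = I" "A \<union> (J - A) = J" "J - A - (I - A) = J - I" by auto
      have sub: "I - A \<subseteq> E" "J - A \<subseteq> E" and "Suc (card (I - A)) = r" "card (J - A) = Suc r"
        using IJ card[of I] card[of J] f True by auto
      with sub have "plucker_rel F P (I - A) (J - A)"
        using P.weak IJ sets(3) unfolding weak_plucker_def by simp
      then show ?thesis
        using minor_plucker_rel_iff[of ?Q A E "I - A" "J - A"] Q A P.finite_E sub sets minor by auto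
    next
      case False
      \<comment> \<open>If both \<open>insert j I\<close> and \<open>J - {j}\<close> contained
        \<open>A\<close>, then \<open>j\<close> would not be in \<open>A\<close>, and both
        \<open>I\<close> and \<open>J\<close> would contain \<open>A\<close>. So each term has a
        zero factor.\<close>
      have "formal_sum (\<lambda>j. signed F (card {j' \<in> J. j < j'} + card {i \<in> I. j < i})
              (tmul F (?Q (insert j I)) (?Q (J - {j})))) (J - I) = {#}"
      proof (rule formal_sum_eq_empty)
        fix j assume "j \<in> J - I"
        then have "\<not> A \<subseteq> insert j I \<or> \<not> A \<subseteq> J - {j}" using False by auto
        then show "signed F (card {j' \<in> J. j < j'} + card {i \<in> I. j < i})
              (tmul F (?Q (insert j I)) (?Q (J - {j}))) = None"
          by (auto simp: coloop_plucker_def)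
      qed
      then show ?thesis unfolding plucker_rel_def using zero_null by simp
    qed
  qed
  define N' where "N' = \<lparr>ground = E \<union> A, rk = ?r, pluckers = scale_class F ?Q\<rparr>"
  have N': "is_fmatroid Weak F N'"
    unfolding is_fmatroid_def using \<open>weak_plucker F (E \<union> A) ?r ?Q\<close> fEA by (auto simp: N'_def)
  have N'_sel: "pluckers N' = scale_class F ?Q" "ground N' = E \<union> A" "rk N' = ?r" by (auto simp: N'_def)
  have fc: "fund_circuit F P T i = signed F (\<Sum>b\<in>T. eps A b) (fund_circuit F ?Q (A \<union> T) i)"
    if "T \<subseteq> E" for T i
  proof (cases "i \<in> A")
    case False
    then show ?thesis
      using fund_circuit_minor[of ?Q A E T i] Q A that minor P.finite_E by (auto intro: finite_subset)
  next
    case True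
    then have "fund_circuit F ?Q (A \<union> T) i = None" by (auto simp: fund_circuit_eps coloop_plucker_def)
    then show ?thesis using True that A by (auto simp: fund_circuit_eps)
  qed
  have fQ: "fund_circuit F ?Q \<tau> i \<in> elems F" for \<tau> i using Q by (simp add: fund_circuit_eps)
  have circ: "circuits F N' = circuits F N"
  proof
    show "circuits F N' \<subseteq> circuits F N"
    proof
      fix C assume "C \<in> circuits F N'"
      then obtain c \<tau> where c: "c \<in> carrier F" "\<tau> \<in> nsets (E \<union> A) (Suc ?r)" "supp (fund_circuit F ?Q \<tau>) \<noteq> {}"
        "\<And>i. C i = tmul F (Some c) (fund_circuit F ?Q \<tau> i)"
        by (rule circuitsE[OF _ Q N'_sel]) blast
      have \<tau>: "\<tau> \<subseteq> E \<union> A" "finite \<tau>" "card \<tau> = Suc ?r" using c(2) by (auto simp: nsets_def)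
      have A\<tau>: "A \<subseteq> \<tau>" using c(3) supp by (auto simp: supp_fund_circuit)
      define T where "T = \<tau> - A"
      have T: "T \<subseteq> E" "A \<union> T = \<tau>" "T \<in> nsets E (Suc r)"
        using \<tau> A\<tau> card[of \<tau>] by (auto simp: T_def nsets_def)
      define n where "n = (\<Sum>b\<in>T. eps A b)"
      have fcT: "fund_circuit F P T i = signed F n (fund_circuit F ?Q \<tau> i)" for i
        using fc[OF T(1)] T(2) by (simp add: n_def)
      then have "fund_circuit F ?Q \<tau> i = signed F n (fund_circuit F P T i)" for i
        using signed_swap fQ by blast
      then have "C i = tmul F (Some (c \<otimes> neg_one F [^] n)) (fund_circuit F P T i)" for i
        using c(1,4) tmul_assoc[of "Some c" "Some (neg_one F [^] n)"] by (simp add: signed_eq_tmul)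
      moreover have "supp (fund_circuit F P T) \<noteq> {}" using c(3) fcT by (auto simp: supp_def)
      ultimately show "C \<in> circuits F N"
        using c(1) T N by (intro circuitsI[of P N E r "c \<otimes> neg_one F [^] n" T]) auto
    qed
    show "circuits F N \<subseteq> circuits F N'"
    proof
      fix C assume "C \<in> circuits F N"
      then obtain c T where c: "c \<in> carrier F" "T \<in> nsets E (Suc r)" "supp (fund_circuit F P T) \<noteq> {}"
        "\<And>i. C i = tmul F (Some c) (fund_circuit F P T i)"
        by (rule circuitsE[OF _ P.P_closed N(3,1,2)]) blast
      have T: "T \<subseteq> E" "finite T" "card T = Suc r" using c(2) by (auto simp: nsets_def)
      have "A \<inter> T = {}" using T A by auto
      then have "A \<union> T \<in> nsets (E \<union> A) (Suc ?r)"
        using T A card_Un_disjoint[of A T] by (auto simp: nsets_def)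
      moreover define n where "n = (\<Sum>b\<in>T. eps A b)"
      have fcT: "fund_circuit F P T i = signed F n (fund_circuit F ?Q (A \<union> T) i)" for i
        using fc[OF T(1)] by (simp add: n_def)
      then have "C i = tmul F (Some (c \<otimes> neg_one F [^] n)) (fund_circuit F ?Q (A \<union> T) i)" for i
        using c(1,4) fQ tmul_assoc[of "Some c" "Some (neg_one F [^] n)"] by (simp add: signed_eq_tmul)
      moreover have "supp (fund_circuit F ?Q (A \<union> T)) \<noteq> {}" using c(3) fcT by (auto simp: supp_def)
      ultimately show "C \<in> circuits F N'"
        using c(1) Q N'_sel by (intro circuitsI[of ?Q N' "E \<union> A" ?r "c \<otimes> neg_one F [^] n" "A \<union> T"]) auto
    qed
  qed
  have "add_coloops F N A = N'"
    unfolding add_coloops_def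
  proof (rule the_equality)
    show "is_fmatroid Weak F N' \<and> ground N' = ground N \<union> A \<and> circuits F N' = circuits F N"
      using N' circ N by (simp add: N'_sel)
    fix N'' assume "is_fmatroid Weak F N'' \<and> ground N'' = ground N \<union> A \<and> circuits F N'' = circuits F N"
    then show "N'' = N'" using N' circ N by (intro fmatroid_eqI) (auto simp: N'_sel)
  qed
  then show "is_fmatroid Weak F (add_coloops F N A)" "ground (add_coloops F N A) = E \<union> A"
    "circuits F (add_coloops F N A) = circuits F N"
    using N' circ by (auto simp: N'_sel)
qed

end

section \<open>Duality\<close>

lemma eps_Diff:
  assumes "finite E" "I \<subseteq> E"
  shows "eps E a = eps (E - I) a + eps I a"
proof -
  have "(E - I) \<union> I = E" "(E - I) \<inter> I = {}" "finite I" using assms by (auto intro: finite_subset)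
  then show ?thesis using eps_union[of "E - I" I a] assms by simp
qed

lemma sum_eps_self:
  fixes A :: "'e::linorder set"
  assumes "finite A"
  shows "(\<Sum>a\<in>A. eps A a) = (\<Sum>k<card A. k)"
  using assms
proof (induction A rule: finite_linorder_max_induct)
  case (insert b A)
  have b: "b \<notin> A" using insert by auto
  have "(\<Sum>a\<in>A. eps (insert b A) a) = (\<Sum>a\<in>A. eps A a)"
    using insert b by (intro sum.cong) (auto simp: eps_insert)
  moreover have "{a \<in> insert b A. a < b} = A" using insert by auto
  then have "eps (insert b A) b = card A" by (simp add: eps_def)
  ultimately show ?case using insert b by simp
qed simp

text \<open>The right side counts pairs of an element of \<open>I\<close> and a smaller element of
  \<open>E\<close>. Those whose smaller element is again in \<open>I\<close> number 0 + 1 + ... +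
  (card I - 1), and the others are the inversions.\<close>

lemma card_inversions:
  fixes I :: "'e::linorder set"
  assumes E: "finite E" and I: "I \<subseteq> E"
  shows "card {(i, j). i \<in> I \<and> j \<in> E - I \<and> j < i} + (\<Sum>k<card I. k) = (\<Sum>a\<in>I. eps E a)"
proof -
  have f: "finite I" using I E by (rule finite_subset)
  have "{(i, j). i \<in> I \<and> j \<in> E - I \<and> j < i} = (SIGMA i:I. {j \<in> E - I. j < i})" by auto
  then have "card {(i, j). i \<in> I \<and> j \<in> E - I \<and> j < i} = (\<Sum>i\<in>I. eps (E - I) i)"
    using f E by (simp add: eps_def)
  moreover have "eps E a = eps (E - I) a + eps I a" for a
    using E I by (rule eps_Diff)
  ultimately show ?thesis by (simp add: sum.distrib sum_eps_self[OF f])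
qed

context tract
begin

text \<open>Up to a sign depending on the size of \<open>I\<close> only, the sign of the dual is a
  product over the elements of \<open>I\<close>. In this form it can be followed when one element is
  added or removed.\<close>

lemma dual_plucker_eq:
  assumes "\<And>I. P I \<in> elems F" "finite E" "I \<subseteq> E"
  shows "dual_plucker F E P I
       = signed F ((\<Sum>a\<in>I. eps E a) + (\<Sum>k<card I. k)) (tconj F (P (E - I)))"
proof -
  have "card {(i, j). i \<in> I \<and> j \<in> E - I \<and> j < i} + (\<Sum>k<card I. k) = (\<Sum>a\<in>I. eps E a)"
    using card_inversions assms by blast
  from arg_cong[OF this, of even]
  have "even (card {(i, j). i \<in> I \<and> j \<in> E - I \<and> j < i} + ((\<Sum>a\<in>I. eps E a) + (\<Sum>k<card I. k)))"
    unfolding even_add by argo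
  then show ?thesis unfolding dual_plucker_def using assms(3) by (simp add: signed_cong)
qed

lemma dual_plucker_closed [simp, intro]:
  "(\<And>I. P I \<in> elems F) \<Longrightarrow> dual_plucker F E P I \<in> elems F"
  by (simp add: dual_plucker_def)

lemma dual_plucker_None_iff: "dual_plucker F E P I \<noteq> None \<longleftrightarrow> I \<subseteq> E \<and> P (E - I) \<noteq> None"
  by (auto simp: dual_plucker_def)

text \<open>Complementation interchanges the two factors of each term: removing \<open>j\<close>
  from \<open>E - I\<close> complements \<open>insert j I\<close>, and adding \<open>j\<close> to
  \<open>E - J\<close> complements \<open>J - {j}\<close>. The relation is the conjugate of the one
  assumed, up to a common sign.\<close>

lemma dual_plucker_rel:
  assumes P: "\<And>I. P I \<in> elems F" and E: "finite E" and IJ: "I \<subseteq> E" "J \<subseteq> E"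
    and rel: "plucker_rel F P (E - J) (E - I)"
  shows "plucker_rel F (dual_plucker F E P) I J"
proof -
  have f: "finite I" "finite J" using IJ E by (auto intro: finite_subset)
  let ?D = "dual_plucker F E P"
  \<comment> \<open>The sign contributions that do not depend on \<open>j\<close>;
    \<open>Suc (card I)\<close> and \<open>card J - Suc 0\<close> are the sizes of
    \<open>insert j I\<close> and \<open>J - {j}\<close>.\<close>
  define c where "c = (\<Sum>a\<in>I. eps E a) + (\<Sum>a\<in>J. eps E a) + (\<Sum>k<Suc (card I). k) + (\<Sum>k<card J - Suc 0. k)"
  let ?g = "\<lambda>j. signed F (eps (E - I) j + eps (E - J) j) (tmul F (P (insert j (E - J))) (P (E - I - {j})))"
  have D: "E - I - (E - J) = J - I" using IJ by auto
  have "plucker_sum F ?D I J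
      = formal_sum (\<lambda>j. signed F c (tconj F (?g j))) (J - I)"
  proof (rule formal_sum_cong)
    fix j assume j: "j \<in> J - I"
    have s: "E - insert j I = E - I - {j}" "E - (J - {j}) = insert j (E - J)" using j IJ by auto
    have e: "eps E j = eps (E - I) j + eps I j" "eps E j = eps (E - J) j + eps J j"
      using E IJ by (auto intro: eps_Diff)
    have 1: "?D (insert j I) = signed F (eps E j + (\<Sum>a\<in>I. eps E a) + (\<Sum>k<Suc (card I). k))
        (tconj F (P (E - I - {j})))"
      using j IJ f s P E by (subst dual_plucker_eq) (auto simp: add.assoc)
    have 2: "?D (J - {j}) = signed F ((\<Sum>a\<in>J - {j}. eps E a) + (\<Sum>k<card J - Suc 0. k))
        (tconj F (P (insert j (E - J))))"
      using j IJ f s P E by (subst dual_plucker_eq) auto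
    have 3: "(\<Sum>a\<in>J. eps E a) = eps E j + (\<Sum>a\<in>J - {j}. eps E a)"
      using j f by (simp add: sum.remove)
    have par: "even ((eps J j + eps I j) + (eps E j + (\<Sum>a\<in>I. eps E a) + (\<Sum>k<Suc (card I). k))
        + ((\<Sum>a\<in>J - {j}. eps E a) + (\<Sum>k<card J - Suc 0. k)) + (c + (eps (E - I) j + eps (E - J) j)))"
      unfolding c_def 3 using arg_cong[OF e(1), of even] arg_cong[OF e(2), of even]
      unfolding even_add by argo
    show "signed F (eps J j + eps I j) (tmul F (?D (insert j I)) (?D (J - {j})))
        = signed F c (tconj F (?g j))"
      unfolding 1 2 using P
      by (simp add: signed_simps tconj_tmul tmul_comm del: sum.lessThan_Suc)
        (rule signed_cong, insert par, unfold even_add, argo)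
  qed
  moreover have "formal_sum ?g (J - I) \<in> null F"
    using rel P E D by (simp add: plucker_rel_iff)
  ultimately have "plucker_sum F ?D I J \<in> null F"
    using P f by (simp add: formal_sum_signed formal_sum_tconj)
  then show ?thesis using P f by (simp add: plucker_rel_iff)
qed

text \<open>Exchange for complements of bases is \<open>dual_exchange\<close>. The relation for
  \<open>I\<close> and \<open>J\<close> comes from that for \<open>E - J\<close> and
  \<open>E - I\<close>, whose difference is again \<open>J - I\<close>, so the number of terms is
  preserved.\<close>

lemma plucker_dual:
  assumes P: "is_plucker k F E r P" and E: "finite E"
  shows "is_plucker k F E (card E - r) (dual_plucker F E P)"
proof -
  interpret P: weak_plucker_fun F E r P
    by (rule weak_plucker_funI[OF E P])
  let ?D = "dual_plucker F E P"
  obtain B where B: "P B \<noteq> None" using P.P_nonzero by auto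
  then have BE: "B \<subseteq> E" "card B = r" using P.basisD[of B] by auto
  then have r: "r \<le> card E" using card_mono[OF E] by auto
  have card: "card (E - I) = card E - card I" "card I \<le> card E" if "I \<subseteq> E" for I
    using that E by (auto intro: card_mono simp: card_Diff_subset finite_subset)
  have pf: "plucker_fun F E (card E - r) ?D"
    unfolding plucker_fun_def
  proof (intro conjI allI impI)
    fix I assume I: "I \<notin> nsets E (card E - r)"
    show "?D I = None"
    proof (rule ccontr)
      assume "?D I \<noteq> None"
      then have "I \<subseteq> E" "P (E - I) \<noteq> None" by (auto simp: dual_plucker_None_iff)
      then have "card E - card I = r" "card I \<le> card E" using card[of I] P.basisD(3)[of "E - I"] by auto
      then show False using I \<open>I \<subseteq> E\<close> E by (auto simp: nsets_def intro: finite_subset)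
    qed
  next
    have "?D (E - B) \<noteq> None" using B BE by (simp add: dual_plucker_None_iff double_diff)
    then show "\<exists>I. ?D I \<noteq> None" by blast
  qed simp
  have ex: "basis_exchange {I. ?D I \<noteq> None}"
    unfolding basis_exchange_def
  proof (intro ballI)
    fix I J i assume "I \<in> {I. ?D I \<noteq> None}" "J \<in> {I. ?D I \<noteq> None}" and i: "i \<in> I - J"
    then have I: "I \<subseteq> E" "E - I \<in> {I. P I \<noteq> None}" and J: "J \<subseteq> E" "E - J \<in> {I. P I \<noteq> None}"
      by (auto simp: dual_plucker_None_iff)
    have "i \<in> E - J" "i \<notin> E - I" using i I by auto
    then obtain y where y: "y \<in> E - I" "y \<notin> E - J" "insert i (E - I - {y}) \<in> {I. P I \<noteq> None}"
      by (rule P.dual_exchange[OF I(2) J(2)])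
    have "E - insert y (I - {i}) = insert i (E - I - {y})" using i I y by auto
    then show "\<exists>j \<in> J - I. insert j (I - {i}) \<in> {I. ?D I \<noteq> None}"
      using y I by (intro bexI[of _ y]) (auto simp: dual_plucker_None_iff)
  qed
  have cards: "Suc (card (E - J)) = r" "card (E - I) = Suc r"
    if "I \<subseteq> E" "J \<subseteq> E" "Suc (card I) = card E - r" "card J = Suc (card E - r)" for I J
    using that card[of I] card[of J] r by auto
  have diff: "E - I - (E - J) = J - I" if "J \<subseteq> E" for I J using that by auto
  show ?thesis
  proof (cases k)
    case Weak
    have "plucker_rel F ?D I J"
      if "I \<subseteq> E" "J \<subseteq> E" "Suc (card I) = card E - r" "card J = Suc (card E - r)" "card (J - I) = 3" for I J
    proof (rule dual_plucker_rel[OF P.P_closed E that(1,2)])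
      show "plucker_rel F P (E - J) (E - I)"
        using P.weak cards[OF that(1-4)] diff[OF that(2)] that unfolding weak_plucker_def by simp
    qed
    then have "weak_plucker F E (card E - r) ?D"
      unfolding weak_plucker_def using pf ex by blast
    then show ?thesis using Weak by simp
  next
    case Strong
    have "plucker_rel F ?D I J"
      if "I \<subseteq> E" "J \<subseteq> E" "Suc (card I) = card E - r" "card J = Suc (card E - r)" for I J
    proof (rule dual_plucker_rel[OF P.P_closed E that(1,2)])
      show "plucker_rel F P (E - J) (E - I)"
        using P Strong cards[OF that(1-4)] unfolding strong_plucker_def by (simp add: strong_plucker_def)
    qed
    then have "strong_plucker F E (card E - r) ?D"
      unfolding strong_plucker_def using pf by blast
    then show ?thesis using Strong by simp
  qed
qed

lemma dual_plucker_scale: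
  assumes P: "\<And>I. P I \<in> elems F" and c: "c \<in> carrier F"
  shows "dual_plucker F E (\<lambda>I. tmul F (Some c) (P I)) I = tmul F (Some (invol F c)) (dual_plucker F E P I)"
proof -
  have "tconj F (tmul F (Some c) (P (E - I))) = tmul F (Some (invol F c)) (tconj F (P (E - I)))"
    using P c by (simp add: tconj_tmul) (simp add: tconj_def)
  then show ?thesis using P c by (simp add: dual_plucker_def tmul_signed_right)
qed

lemma pluckers_dual:
  assumes P: "\<And>I. P I \<in> elems F" and M: "pluckers M = scale_class F P"
  shows "pluckers (dual F M) = scale_class F (dual_plucker F (ground M) P)"
proof
  let ?D = "dual_plucker F (ground M)"
  have eq: "?D (\<lambda>I. tmul F (Some c) (P I)) = (\<lambda>I. tmul F (Some (invol F c)) (?D P I))"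
    if "c \<in> carrier F" for c using dual_plucker_scale[of P c] P that by auto
  show "pluckers (dual F M) \<subseteq> scale_class F (?D P)"
  proof
    fix Q assume "Q \<in> pluckers (dual F M)"
    then obtain c where "c \<in> carrier F" "Q = ?D (\<lambda>I. tmul F (Some c) (P I))"
      unfolding dual_def M scale_class_def by auto
    then show "Q \<in> scale_class F (?D P)" unfolding scale_class_def using eq by blast
  qed
  show "scale_class F (?D P) \<subseteq> pluckers (dual F M)"
  proof
    fix Q assume "Q \<in> scale_class F (?D P)"
    then obtain c where c: "c \<in> carrier F" "Q = (\<lambda>I. tmul F (Some c) (?D P I))"
      unfolding scale_class_def by auto
    then have "Q = ?D (\<lambda>I. tmul F (Some (invol F c)) (P I))"
      using eq[of "invol F c"] invol_invol[OF c(1)] by auto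
    then show "Q \<in> pluckers (dual F M)" using c(1) unfolding dual_def M scale_class_def by auto
  qed
qed

lemma dual_simps: "ground (dual F M) = ground M" "rk (dual F M) = card (ground M) - rk M"
  by (auto simp: dual_def)

lemma fmatroid_dual:
  assumes "is_fmatroid k F M"
  shows "is_fmatroid k F (dual F M)"
proof -
  obtain P where P: "is_plucker k F (ground M) (rk M) P" "pluckers M = scale_class F P"
    and f: "finite (ground M)" using assms unfolding is_fmatroid_def by auto
  then interpret P: weak_plucker_fun F "ground M" "rk M" P
    by (intro weak_plucker_funI)
  show ?thesis unfolding is_fmatroid_def dual_simps
    using plucker_dual[OF P(1) f] pluckers_dual[of P M, OF P.P_closed P(2)] f by blast
qed

text \<open>Dualizing twice multiplies a Pluecker vector by a sign whose exponent \<open>n\<close>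
  depends only on the ground set and the rank, hence it preserves the scaling class.\<close>

lemma dual_dual:
  assumes "is_fmatroid Weak F N"
  shows "dual F (dual F N) = N"
proof -
  let ?E = "ground N" and ?r = "rk N"
  obtain P where P: "weak_plucker_fun F ?E ?r P" "pluckers N = scale_class F P"
    using fmatroid_weakD[OF assms] .
  interpret P: weak_plucker_fun F ?E ?r P by (rule P)
  let ?D = "dual_plucker F ?E"
  obtain B where "P B \<noteq> None" using P.P_nonzero by auto
  then have "?r \<le> card ?E" using P.basisD[of B] card_mono[OF P.finite_E, of B] by auto
  then have rk: "card ?E - (card ?E - ?r) = ?r" by simp
  have pl: "pluckers (dual F (dual F N)) = scale_class F (?D (?D P))"
    using pluckers_dual[of "?D P" "dual F N"] pluckers_dual[of P N] P P.P_closed by (simp add: dual_simps)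
  define n where "n = (\<Sum>a\<in>?E. eps ?E a) + (\<Sum>k<?r. k) + (\<Sum>k<card ?E - ?r. k)"
  have "?D (?D P) I = tmul F (Some (neg_one F [^] n)) (P I)" for I
  proof (cases "P I = None")
    case True
    then show ?thesis using dual_plucker_None_iff[of ?E "?D P" I] dual_plucker_None_iff[of ?E P "?E - I"]
      by (cases "I \<subseteq> ?E") (auto simp: double_diff dual_plucker_def)
  next
    case False
    then have I: "I \<subseteq> ?E" "card I = ?r" "finite I" using P.basisD[of I] by auto
    have c: "card (?E - I) = card ?E - ?r" using I P.finite_E by (simp add: card_Diff_subset)
    have s: "?E - (?E - I) = I" using I by auto
    have sum: "(\<Sum>a\<in>?E. eps ?E a) = (\<Sum>a\<in>?E - I. eps ?E a) + (\<Sum>a\<in>I. eps ?E a)"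
      using I P.finite_E by (simp add: sum.subset_diff)
    have "?D (?D P) I = signed F ((\<Sum>a\<in>I. eps ?E a) + (\<Sum>k<?r. k)) (tconj F
      (signed F ((\<Sum>a\<in>?E - I. eps ?E a) + (\<Sum>k<card ?E - ?r. k)) (tconj F (P I))))"
      using I P.finite_E c s by (simp add: dual_plucker_eq)
    also have "\<dots> = signed F n (P I)"
      using P.P_closed by (simp add: signed_simps n_def sum) (rule signed_cong, presburger)
    finally show ?thesis by (simp add: signed_eq_tmul)
  qed
  then have "scale_class F (?D (?D P)) = scale_class F P"
    by (intro scale_class_scale[of "neg_one F [^] n"]) auto
  then show ?thesis using pl P rk by (simp add: dual_def)
qed

section \<open>Covectors and vectors through one Pluecker vector\<close>

lemma covectors_iff:
  assumes "is_plucker k F (ground M) (rk M) P" "pluckers M = scale_class F P" "finite (ground M)"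
  shows "X \<in> covectors F M \<longleftrightarrow>
    X \<in> tuples F (ground M) \<and> covec F (ground M) (rk M) P (\<lambda>i. tconj F (X i))"
proof -
  interpret P: weak_plucker_fun F "ground M" "rk M" P
    by (rule weak_plucker_funI[OF assms(3,1)])
  show ?thesis unfolding covectors_def
    using perp_circuits_iff[of P M "ground M"] assms P.P_closed by simp
qed

lemma vectors_eq_covectors_dual: "vectors F M = covectors F (dual F M)"
  by (simp add: vectors_def covectors_def dual_simps)

text \<open>The fundamental circuit of the dual on \<open>J\<close> is, up to a common sign, the
  conjugate of the cocircuit of \<open>P\<close> at the complement of \<open>J\<close>. The
  condition for the dual is thus the conjugate of the condition in \<open>vec\<close>.\<close>

lemma vec_imp_vectors:
  assumes P: "is_plucker k F (ground M) (rk M) P" "pluckers M = scale_class F P" "finite (ground M)"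
    and Y: "Y \<in> tuples F (ground M)" and vec: "vec F (ground M) (rk M) P Y"
  shows "Y \<in> vectors F M"
proof -
  let ?E = "ground M" and ?r = "rk M"
  interpret P: weak_plucker_fun F ?E ?r P
    by (rule weak_plucker_funI[OF P(3,1)])
  let ?D = "dual_plucker F ?E P"
  have Yc: "Y i \<in> elems F" for i using Y unfolding tuples_def by (cases "i \<in> ?E") auto
  have "covec F ?E (card ?E - ?r) ?D (\<lambda>i. tconj F (Y i))"
    unfolding covec_def
  proof
    fix J assume "J \<in> nsets ?E (Suc (card ?E - ?r))"
    then have J: "J \<subseteq> ?E" "finite J" "card J = Suc (card ?E - ?r)" by (auto simp: nsets_def)
    obtain B where "P B \<noteq> None" using P.P_nonzero by auto
    then have r: "?r \<le> card ?E" using P.basisD[of B] card_mono[OF P(3), of B] by auto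
    define I where "I = ?E - J"
    have "card J \<le> card ?E" using J P(3) by (intro card_mono)
    then have I: "I \<subseteq> ?E" "Suc (card I) = ?r" "?E - I = J" "finite I"
      using J P(3) r by (auto simp: I_def card_Diff_subset finite_subset)
    define c where "c = (\<Sum>a\<in>J. eps ?E a) + (\<Sum>k<card J - Suc 0. k)"
    let ?g = "\<lambda>i. signed F (eps I i) (tmul F (P (insert i I)) (Y i))"
    have "formal_sum (\<lambda>i. signed F (eps J i) (tmul F (?D (J - {i})) (tconj F (Y i)))) J
        = formal_sum (\<lambda>i. signed F c (tconj F (?g i))) J"
    proof (rule formal_sum_cong)
      fix i assume i: "i \<in> J"
      have s: "?E - (J - {i}) = insert i I" using i J by (auto simp: I_def)
      have sum: "(\<Sum>a\<in>J. eps ?E a) = eps ?E i + (\<Sum>a\<in>J - {i}. eps ?E a)"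
        using i J by (simp add: sum.remove)
      have e: "eps ?E i = eps I i + eps J i"
        unfolding I_def using P(3) J(1) by (rule eps_Diff)
      have D: "?D (J - {i}) = signed F ((\<Sum>a\<in>J - {i}. eps ?E a) + (\<Sum>k<card J - Suc 0. k)) (tconj F (P (insert i I)))"
        using i J P(3) s by (subst dual_plucker_eq) auto
      have par: "even (eps J i + ((\<Sum>a\<in>J - {i}. eps ?E a) + (\<Sum>k<card J - Suc 0. k)) + (c + eps I i))"
        unfolding c_def sum e even_add by argo
      show "signed F (eps J i) (tmul F (?D (J - {i})) (tconj F (Y i))) = signed F c (tconj F (?g i))"
        unfolding D using Yc P.P_closed
        by (simp add: signed_simps tconj_tmul) (rule signed_cong, insert par, unfold even_add, argo)
    qed
    moreover have "formal_sum ?g J \<in> null F"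
      using vec I unfolding vec_def by auto
    ultimately show "formal_sum (\<lambda>i. signed F (eps J i) (tmul F (?D (J - {i})) (tconj F (Y i)))) J \<in> null F"
      using Yc J by (simp add: formal_sum_signed formal_sum_tconj)
  qed
  then show ?thesis
    unfolding vectors_eq_covectors_dual
    using covectors_iff[of k "dual F M" ?D] plucker_dual[OF P(1,3)] pluckers_dual[of P M, OF P.P_closed P(2)] P(3) Y
    by (simp add: dual_simps)
qed

end

section \<open>Weak and strong matroids\<close>

text \<open>
  Weak matroids are strong as soon as vectors and covectors of weak matroids of rank 2 are
  orthogonal: by induction on \<open>card (J - I)\<close>, replacing \<open>I\<close> or \<open>J\<close> by a neighbour with the same
  fundamental cocircuit resp. circuit whenever a coefficient vanishes on \<open>J - I\<close>. If none does,
  the relation for \<open>I\<close> and \<open>J\<close> is an orthogonality relation in a rank 2 minor on \<open>J - I\<close>.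
\<close>

lemma (in weak_plucker_fun) strong_rel:
  assumes orth: "\<And>(S :: 'e set) P' W Y. finite S \<Longrightarrow> weak_plucker F S 2 P' \<Longrightarrow> (\<And>i. W i \<in> elems F)
      \<Longrightarrow> (\<And>i. Y i \<in> elems F) \<Longrightarrow> (\<And>i. i \<in> S \<Longrightarrow> W i \<noteq> None)
      \<Longrightarrow> covec F S 2 P' W \<Longrightarrow> vec F S 2 P' Y \<Longrightarrow> formal_sum (\<lambda>i. tmul F (W i) (Y i)) S \<in> null F"
    and "I \<subseteq> E" "J \<subseteq> E" "Suc (card I) = r" "card J = Suc r"
  shows "plucker_sum F P I J \<in> null F"
  using assms(2-)
proof (induction "card (J - I)" arbitrary: I J rule: less_induct)
  case (less I J)
  note I = less.prems(1,3) and J = less.prems(2,4)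
  have fI: "finite I" and fJ: "finite J" using I J finite_E by (auto intro: finite_subset)
  have mem: "X \<in> {I. P I \<noteq> None}" if "P X \<noteq> None" for X using that by simp
  let ?f = "\<lambda>I J j. signed F (eps J j + eps I j) (tmul F (P (insert j I)) (P (J - {j})))"
  have cJ: "card J = Suc (Suc (card I))" using I J by simp
  have cIJ: "card (J - I) = Suc (Suc (card (I - J)))"
    using cJ fI fJ by (metis Int_commute add_Suc_right add_left_cancel card_Int_Diff)
  show ?case
  proof (cases "\<exists>j \<in> J - I. ?f I J j \<noteq> None")
    case False
    then show ?thesis using zero_null by (subst formal_sum_eq_empty) auto
  next
    case True
    then obtain y where y: "y \<in> J" "y \<notin> I" "P (insert y I) \<noteq> None" "P (J - {y}) \<noteq> None" by auto
    consider (A) e where "e \<in> J - I" "P (insert e I) = None"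
      | (B) e where "e \<in> J - I" "P (J - {e}) = None"
      | (C) "\<And>e. e \<in> J - I \<Longrightarrow> P (insert e I) \<noteq> None \<and> P (J - {e}) \<noteq> None"
      by blast
    then show ?thesis
    proof cases
      case A
      then have e: "e \<in> J" "e \<notin> I" "e \<noteq> y" using y by auto
      have "e \<in> J - {y}" "e \<notin> insert y I" using e by auto
      then obtain f where f0: "f \<in> insert y I" "f \<notin> J - {y}" "insert e (insert y I - {f}) \<in> {I. P I \<noteq> None}"
        by (rule dual_exchange[OF mem[OF y(3)] mem[OF y(4)]])
      have "f \<noteq> y" using f0(3) A y by auto
      then have f: "f \<in> I" "f \<notin> J" using f0 y by auto
      \<comment> \<open>The term of \<open>e\<close> vanishes for \<open>I\<close>, and
        \<open>e\<close> belongs to \<open>I'\<close>, so both relations live on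
        \<open>J - I - {e}\<close>. There the cocircuits of \<open>I\<close> and \<open>I'\<close>
        are proportional by \<open>two_term_cocircuit\<close>.\<close>
      define I' where "I' = insert e (I - {f})"
      have yI': "insert y I' = insert e (insert y I - {f})" using \<open>f \<noteq> y\<close> by (auto simp: I'_def)
      have PyI': "P (insert y I') \<noteq> None" using f0(3) yI' by simp
      have I': "I' \<subseteq> E" "Suc (card I') = r"
        using I J e fI card_Suc_Diff1[OF fI f(1)] by (auto simp: I'_def)
      have JI': "J - I' = (J - I) - {e}" using f by (auto simp: I'_def)
      have "card (J - I') < card (J - I)"
        unfolding JI' using A fJ by (intro card_Diff1_less) auto
      then have IH: "formal_sum (?f I' J) (J - I') \<in> null F"
        using less.hyps I' J by blast
      define D where "D I x = signed F (eps I x) (P (insert x I))" for I x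
      have Dc: "D I x \<in> elems F" for I x by (simp add: D_def)
      have fD: "?f I J j = tmul F (D I j) (signed F (eps J j) (P (J - {j})))" for I j
        by (simp add: D_def signed_simps)
      have "D I y \<noteq> None" "D I' y \<noteq> None" using y(3) PyI' by (auto simp: D_def)
      then obtain a b where ab: "D I y = Some a" "D I' y = Some b" by auto
      then have abc: "a \<in> carrier F" "b \<in> carrier F" using Dc[of I y] Dc[of I' y] by auto
      have ratio: "tmul F (Some b) (D I x) = tmul F (Some a) (D I' x)" if x: "x \<in> J - I - {e}" for x
      proof -
        have "tmul F (D I x) (D I' y) = tmul F (D I y) (D I' x)"
          unfolding D_def I'_def
          by (rule two_term_cocircuit[OF I f(1)]) (use e x y J A in auto)
        then show ?thesis using ab tmul_comm[of "Some b" "D I x"] Dc abc by simp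
      qed
      have "formal_sum (?f I J) (J - I) = formal_sum (?f I J) (J - I - {e})"
        using A by (intro formal_sum_mono_neutral) auto
      moreover have "formal_sum (?f I J) (J - I - {e}) \<in> null F \<longleftrightarrow> formal_sum (?f I' J) (J - I - {e}) \<in> null F"
      proof (rule formal_sum_proportional[OF _ _ _ abc(2,1)])
        fix x assume x: "x \<in> J - I - {e}"
        let ?s = "signed F (eps J x) (P (J - {x}))"
        have "tmul F (Some b) (?f I J x) = tmul F (tmul F (Some b) (D I x)) ?s"
          unfolding fD using abc Dc by (intro tmul_assoc[symmetric]) auto
        also have "\<dots> = tmul F (Some a) (?f I' J x)"
          unfolding ratio[OF x] fD using abc Dc by (intro tmul_assoc) auto
        finally show "tmul F (Some b) (?f I J x) = tmul F (Some a) (?f I' J x)" .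
      qed (use fJ in auto)
      ultimately show ?thesis using IH JI' by simp
    next
      case B
      then have e: "e \<in> J" "e \<notin> I" "e \<noteq> y" using y by auto
      have "e \<in> J - {y}" "e \<notin> insert y I" using e by auto
      then obtain f where f0: "f \<in> insert y I" "f \<notin> J - {y}" "insert f (J - {y} - {e}) \<in> {I. P I \<noteq> None}"
        by (rule basis_exchangeD[OF exchange mem[OF y(4)] mem[OF y(3)]])
      have "insert y (J - {y} - {e}) = J - {e}" using y e by auto
      then have "f \<noteq> y" using f0(3) B(2) by (metis mem_Collect_eq)
      then have f: "f \<in> I" "f \<notin> J" using f0 y by auto
      \<comment> \<open>Dually, the term of \<open>e\<close> vanishes for \<open>J\<close>, and
        \<open>e\<close> is absent from \<open>J'\<close>; the new element \<open>f\<close> lies in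
        \<open>I\<close> and contributes no term.\<close>
      define J' where "J' = insert f (J - {e})"
      have "J' - {y} = insert f (J - {y} - {e})" using \<open>f \<noteq> y\<close> by (auto simp: J'_def)
      then have PJ'y: "P (J' - {y}) \<noteq> None" using f0(3) by simp
      have J': "J' \<subseteq> E" "card J' = Suc r"
        using I J e f fJ card_Suc_Diff1[OF fJ e(1)] by (auto simp: J'_def)
      have J'I: "J' - I = (J - I) - {e}" using f by (auto simp: J'_def)
      have "card (J' - I) < card (J - I)"
        unfolding J'I using B fJ by (intro card_Diff1_less) auto
      then have IH: "formal_sum (?f I J') (J' - I) \<in> null F"
        using less.hyps I J' by blast
      let ?C = "fund_circuit F P"
      have fC: "?f I J j = tmul F (signed F (eps I j) (P (insert j I))) (?C J j)" if "j \<in> J" for j J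
        using that by (simp add: fund_circuit_eps signed_simps add.commute)
      have yJ': "y \<in> J'" using y e by (auto simp: J'_def)
      have "?C J y \<noteq> None" "?C J' y \<noteq> None" using y PJ'y yJ' by (auto simp: fund_circuit_eps)
      then obtain a b where ab: "?C J y = Some a" "?C J' y = Some b" by auto
      then have abc: "a \<in> carrier F" "b \<in> carrier F"
        using fund_circuit_closed[of J y] fund_circuit_closed[of J' y] by auto
      have ratio: "tmul F (Some b) (?C J x) = tmul F (Some a) (?C J' x)" if x: "x \<in> J - I - {e}" for x
      proof (cases "x = y")
        case True
        then show ?thesis using ab abc by (simp add: m_comm)
      next
        case False
        have "tmul F (?C J x) (?C J' y) = tmul F (?C J y) (?C J' x)"
          unfolding J'_def
          by (rule two_term_circuit) (use J fJ I f x y e False B in \<open>auto simp: nsets_def\<close>)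
        then show ?thesis using ab tmul_comm[of "Some b" "?C J x"] abc by simp
      qed
      have "formal_sum (?f I J) (J - I) = formal_sum (?f I J) (J - I - {e})"
        using B by (intro formal_sum_mono_neutral) auto
      moreover have "formal_sum (?f I J) (J - I - {e}) \<in> null F \<longleftrightarrow> formal_sum (?f I J') (J - I - {e}) \<in> null F"
      proof (rule formal_sum_proportional[OF _ _ _ abc(2,1)])
        fix x assume x: "x \<in> J - I - {e}"
        then have xJ: "x \<in> J" "x \<in> J'" by (auto simp: J'_def)
        let ?s = "signed F (eps I x) (P (insert x I))"
        have "tmul F (Some b) (?f I J x) = tmul F ?s (tmul F (Some b) (?C J x))"
          unfolding fC[OF xJ(1)] using abc by (intro tmul_left_comm) auto
        also have "\<dots> = tmul F (Some a) (?f I J' x)"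
          unfolding ratio[OF x] fC[OF xJ(2)] using abc by (intro tmul_left_comm) auto
        finally show "tmul F (Some b) (?f I J x) = tmul F (Some a) (?f I J' x)" .
      qed (use fJ in auto)
      ultimately show ?thesis using IH J'I by simp
    next
      case C
      show ?thesis
      proof (cases "I \<subseteq> J")
        case True
        \<comment> \<open>Only two terms remain; they are the same product with opposite
          signs.\<close>
        then have "card (J - I) = 2" using cIJ by (simp add: Diff_eq_empty_iff[THEN iffD2])
        then obtain a b where ab: "J - I = {a, b}" "a \<noteq> b" by (auto simp: card_2_iff)
        have nab: "a \<notin> I" "b \<notin> I" using ab by auto
        have JI: "J = insert a (insert b I)" using ab True by auto
        have sets: "J - {a} = insert b I" "J - {b} = insert a I" using JI nab ab by auto
        have e: "eps J a = eps I a + (if b < a then 1 else 0)" "eps J b = eps I b + (if a < b then 1 else 0)"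
          unfolding JI using fI nab ab by (simp_all add: eps_insert)
        have parity: "even (eps J a + eps I a + (1 + (eps J b + eps I b)))"
          unfolding e using ab(2) by (cases a b rule: linorder_cases) auto
        have "?f I J a = signed F 1 (?f I J b)"
          unfolding sets using tmul_comm[of "P (insert a I)" "P (insert b I)"] parity
          by (simp add: signed_signed signed_cong)
        then show ?thesis using formal_sum_two[of "J - I" a b "?f I J"] ab by simp
      next
        case False
        then obtain g where g: "g \<in> I" "g \<notin> J" by auto
        \<comment> \<open>Contracting all of \<open>I\<close> except one element \<open>g\<close>
          outside \<open>J\<close> leaves rank 2. The pairing is between the cocircuit
          \<open>W\<close> of \<open>I\<close> and the circuit \<open>Y\<close> of \<open>J\<close>,
          both without zeros on \<open>S\<close>.\<close>
        define K where "K = I - {g}"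
        define S where "S = J - I"
        have KS: "K \<subseteq> E" "S \<subseteq> E" "K \<inter> S = {}" using I J by (auto simp: K_def S_def)
        have fin: "finite K" "finite S" using fI fJ by (auto simp: K_def S_def)
        have cK: "r = card K + 2" using I(2) card_Suc_Diff1[OF fI g(1)] by (simp add: K_def)
        have gS: "g \<notin> S" "g \<notin> K" using g by (auto simp: S_def K_def)
        have IK: "I = insert g K" using g by (auto simp: K_def)
        define Q where "Q = minor_plucker F K S P"
        obtain e where e: "e \<in> J" "e \<notin> I" using y by auto
        then have Pe: "P (insert e I) \<noteq> None" "P (J - {e}) \<noteq> None" using C by auto
        have "g \<in> insert e I" "g \<notin> J - {e}" using g by auto
        then obtain j where j: "j \<in> J - {e}" "j \<notin> insert e I" "insert j (insert e I - {g}) \<in> {I. P I \<noteq> None}"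
          by (rule basis_exchangeD[OF exchange mem[OF Pe(1)] mem[OF Pe(2)]])
        have "insert j (insert e I - {g}) = K \<union> {e, j}" using g e by (auto simp: K_def)
        then have PK: "P (K \<union> {e, j}) \<noteq> None" using j by simp
        have "is_plucker Weak F S 2 (minor_plucker F K S P)"
          by (rule plucker_minor[where P = P and ?B0.0 = "{e, j}", OF _ finite_E KS cK]) (use weak PK e j in \<open>auto simp: S_def\<close>)
        then have Qw: "weak_plucker F S 2 Q" by (simp add: Q_def)
        define W where "W x = signed F (eps I x) (P (insert x I))" for x
        define Y where "Y x = signed F (eps J x) (P (J - {x}))" for x
        have Wc: "W x \<in> elems F" and Yc: "Y x \<in> elems F" for x by (simp_all add: W_def Y_def)
        have W0: "W x \<noteq> None" if "x \<in> S" for x using C that by (auto simp: W_def S_def)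
        \<comment> \<open>For a three-element \<open>T\<close> in \<open>S\<close>, the set
          \<open>K \<union> T\<close> exceeds \<open>I\<close> exactly by \<open>T\<close>, so the
          required sums are three-term relations of \<open>P\<close>.\<close>
        have cov: "covec F S 2 Q W"
          unfolding covec_def
        proof
          fix T assume "T \<in> nsets S (Suc 2)"
          then have T: "T \<subseteq> S" "finite T" "card T = 3" by (auto simp: nsets_def)
          let ?c = "\<Sum>b\<in>T. eps K b"
          have "K \<inter> T = {}" using T KS by auto
          then have KT: "K \<union> T \<subseteq> E" "card (K \<union> T) = Suc r" "K \<union> T - I = T"
            using T KS fin cK card_Un_disjoint[of K T] gS by (auto simp: IK)
          have "covec_sum F Q W T
              = formal_sum (\<lambda>i. signed F ?c (?f I (K \<union> T) i)) T"
          proof (rule formal_sum_cong)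
            fix i assume i: "i \<in> T"
            then have iK: "i \<notin> K" using T KS by auto
            have "signed F (eps T i) (Q (T - {i})) = signed F ?c (signed F (eps (K \<union> T) i) (P (K \<union> T - {i})))"
              using fund_circuit_minor[of P K S T i, OF P_closed fin(1) KS(3) T(1,2) iK] i
              by (simp add: fund_circuit_eps Q_def)
            then have "signed F (eps T i) (tmul F (Q (T - {i})) (W i))
                = tmul F (signed F ?c (signed F (eps (K \<union> T) i) (P (K \<union> T - {i})))) (W i)"
              using Wc by (simp add: tmul_signed_left[symmetric] Q_def)
            also have "\<dots> = signed F ?c (?f I (K \<union> T) i)"
              by (simp add: W_def signed_simps tmul_comm add.commute add.left_commute)
            finally show "signed F (eps T i) (tmul F (Q (T - {i})) (W i)) = signed F ?c (?f I (K \<union> T) i)" .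
          qed
          moreover have "formal_sum (?f I (K \<union> T)) T \<in> null F"
            using weak_rel[OF I(1) KT(1) I(2) KT(2)] KT(3) T by simp
          ultimately show "covec_sum F Q W T \<in> null F"
            using T by (simp add: formal_sum_signed)
        qed
        \<comment> \<open>Replacing \<open>g\<close> by an element \<open>x\<close> of
          \<open>S\<close> turns \<open>I\<close> into a set \<open>I'\<close> with
          \<open>J - I'\<close> smaller than \<open>J - I\<close>; the required sums are the
          relations for \<open>I'\<close> and \<open>J\<close>, known by induction.\<close>
        have vec: "vec F S 2 Q Y"
          unfolding vec_def
        proof (intro allI impI)
          fix X assume X: "X \<subseteq> S" "Suc (card X) = 2"
          then obtain x where x: "X = {x}" "x \<in> S" by (auto simp: card_1_singleton_iff)
          define I' where "I' = insert x K"
          have xK: "x \<notin> K" using x KS by auto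
          have I': "I' \<subseteq> E" "Suc (card I') = r" using x KS cK fin xK by (auto simp: I'_def)
          have JI': "J - I' = S - {x}" using g by (auto simp: I'_def K_def S_def)
          have "card (J - I') < card (J - I)"
            unfolding JI' S_def[symmetric] using x fin by (intro card_Diff1_less) auto
          then have IH: "formal_sum (?f I' J) (S - {x}) \<in> null F"
            using less.hyps[OF _ I'(1) J(1) I'(2) J(2)] unfolding JI' by simp
          have "vec_sum F S Q Y {x}
              = formal_sum (\<lambda>i. signed F (eps K x) (?f I' J i)) (S - {x})"
          proof (rule formal_sum_cong)
            fix i assume i: "i \<in> S - {x}"
            have Qi: "Q (insert i {x}) = signed F (eps K i + eps K x) (P (insert i I'))"
              using i x by (auto simp: Q_def minor_plucker_def I'_def insert_commute)
            have "eps I' i = eps {x} i + eps K i"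
              unfolding I'_def using fin xK by (simp add: eps_insert) (simp add: eps_def)
            then have par: "even (eps {x} i + (eps K i + eps K x + eps J i) + (eps K x + (eps J i + eps I' i)))"
              by presburger
            show "signed F (eps {x} i) (tmul F (Q (insert i {x})) (Y i)) = signed F (eps K x) (?f I' J i)"
              unfolding Qi Y_def using par
              by (simp add: signed_simps) (rule signed_cong, presburger)
          qed
          then show "vec_sum F S Q Y X \<in> null F"
            using IH fin by (simp add: formal_sum_signed x)
        qed
        have "formal_sum (\<lambda>i. tmul F (W i) (Y i)) S \<in> null F"
          using fin(2) Qw Wc Yc W0 cov vec by (rule orth[of S Q W Y])
        moreover have "formal_sum (\<lambda>i. tmul F (W i) (Y i)) S = formal_sum (?f I J) S"
          by (rule formal_sum_cong) (simp add: W_def Y_def signed_simps)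
        ultimately show ?thesis by (simp add: S_def)
      qed
    qed
  qed
qed

lemma (in weak_plucker_fun) strong_plucker_of_strong_rel:
  assumes "\<And>I J. I \<subseteq> E \<Longrightarrow> J \<subseteq> E \<Longrightarrow> Suc (card I) = r \<Longrightarrow> card J = Suc r \<Longrightarrow>
    plucker_sum F P I J \<in> null F"
  shows "strong_plucker F E r P"
  unfolding strong_plucker_def
proof (intro conjI allI impI plucker_fun)
  fix I J assume IJ: "I \<subseteq> E \<and> J \<subseteq> E \<and> Suc (card I) = r \<and> card J = Suc r"
  then have "finite I" "finite J" using finite_E by (auto intro: finite_subset)
  then show "plucker_rel F P I J" using assms[of I J] IJ by (subst plucker_rel_iff) auto
qed

section \<open>Perfect tracts\<close>

context tract
begin

text \<open>\<open>perfect\<close> quantifies over ground sets of natural numbers. The position map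
  \<open>eps E\<close> is an order isomorphism onto such a set and preserves every count entering a
  sign, so the matroid, the covector and the vector are transported there.\<close>

lemma perfect_pairing:
  fixes E :: "'e::linorder set"
  assumes perfect: "perfect k F" and P: "is_plucker k F E r P" and E: "finite E"
    and W: "\<And>i. W i \<in> elems F" and Y: "\<And>i. Y i \<in> elems F"
    and cov: "covec F E r P W" and vec: "vec F E r P Y"
  shows "formal_sum (\<lambda>i. tmul F (W i) (Y i)) E \<in> null F"
proof -
  define \<phi> where "\<phi> = eps E"
  have less: "\<phi> x < \<phi> y" if "x \<in> E" "x < y" for x y
    unfolding \<phi>_def eps_def using that E by (intro psubset_card_mono) auto
  have less_iff: "\<phi> x < \<phi> y \<longleftrightarrow> x < y" if "x \<in> E" "y \<in> E" for x y
    using less[of x y] less[of y x] that by (cases x y rule: linorder_cases) auto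
  have inj: "inj_on \<phi> E"
    unfolding inj_on_def using less_iff by (metis linorder_neqE nat_neq_iff)
  define E' where "E' = \<phi> ` E"
  have E': "finite E'" using E by (simp add: E'_def)
  define pull where "pull B = {x \<in> E. \<phi> x \<in> B}" for B
  have pull: "pull (\<phi> ` A) = A" if "A \<subseteq> E" for A
    using that inj unfolding pull_def by (auto dest: inj_onD)
  have push: "\<phi> ` pull B = B" "pull B \<subseteq> E" if "B \<subseteq> E'" for B
    using that unfolding pull_def E'_def by auto
  define P' where "P' B = (if B \<subseteq> E' then P (pull B) else None)" for B
  define W' where "W' n = (if n \<in> E' then W (the_inv_into E \<phi> n) else None)" for n
  define Y' where "Y' n = (if n \<in> E' then Y (the_inv_into E \<phi> n) else None)" for n
  interpret P: weak_plucker_fun F E r P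
    by (rule weak_plucker_funI[OF E P])
  have P'_push: "P' (\<phi> ` A) = P A" if "A \<subseteq> E" for A
    using that pull unfolding P'_def E'_def by (simp add: image_mono)
  have P'c: "P' B \<in> elems F" for B by (simp add: P'_def)
  have W'_push: "W' (\<phi> x) = W x" and Y'_push: "Y' (\<phi> x) = Y x" if "x \<in> E" for x
    using that inj by (auto simp: W'_def Y'_def E'_def the_inv_into_f_f)
  have W'c: "W' n \<in> elems F" and Y'c: "Y' n \<in> elems F" for n using W Y by (auto simp: W'_def Y'_def)
  have eps_push: "eps (\<phi> ` A) (\<phi> x) = eps A x" if "A \<subseteq> E" "x \<in> E" for A x
  proof -
    have "{a \<in> \<phi> ` A. a < \<phi> x} = \<phi> ` {a \<in> A. a < x}" using that less_iff by auto
    moreover have "inj_on \<phi> {a \<in> A. a < x}" using inj that by (auto intro: inj_on_subset)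
    ultimately show ?thesis unfolding eps_def by (simp add: card_image)
  qed
  have card_push: "card (\<phi> ` A) = card A" if "A \<subseteq> E" for A
    using inj that by (meson card_image inj_on_subset)
  have diff_push: "\<phi> ` A - \<phi> ` B = \<phi> ` (A - B)" if "A \<subseteq> E" "B \<subseteq> E" for A B
    using inj_on_image_set_diff[OF inj, of A B] that by auto
  have sum_push: "formal_sum f (\<phi> ` A) = formal_sum (\<lambda>i. f (\<phi> i)) A" if "A \<subseteq> E" for A and f :: "nat \<Rightarrow> 'a option"
    using inj that by (intro formal_sum_reindex) (rule inj_on_subset)
  have remove_push: "\<phi> ` A - {\<phi> x} = \<phi> ` (A - {x})" if "A \<subseteq> E" "x \<in> E" for A x
    using diff_push[of A "{x}"] that by simp
  have fin: "finite A" if "A \<subseteq> E" for A using that E by (rule finite_subset)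
  have P'_rel: "plucker_rel F P' (\<phi> ` I) (\<phi> ` J)" if IJ: "I \<subseteq> E" "J \<subseteq> E" and rel: "plucker_rel F P I J" for I J
  proof -
    have "formal_sum (\<lambda>j. signed F (eps (\<phi> ` J) j + eps (\<phi> ` I) j)
        (tmul F (P' (insert j (\<phi> ` I))) (P' (\<phi> ` J - {j})))) (\<phi> ` J - \<phi> ` I)
      = plucker_sum F P I J"
      unfolding diff_push[OF IJ(2,1)] sum_push[OF order_trans[OF Diff_subset IJ(2)]]
    proof (rule formal_sum_cong)
      fix j assume j: "j \<in> J - I"
      then have jE: "j \<in> E" "J - {j} \<subseteq> E" using IJ by auto
      have "insert (\<phi> j) (\<phi> ` I) = \<phi> ` insert j I" by simp
      then show "signed F (eps (\<phi> ` J) (\<phi> j) + eps (\<phi> ` I) (\<phi> j))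
          (tmul F (P' (insert (\<phi> j) (\<phi> ` I))) (P' (\<phi> ` J - {\<phi> j})))
        = signed F (eps J j + eps I j) (tmul F (P (insert j I)) (P (J - {j})))"
        using IJ jE eps_push P'_push[of "insert j I"] P'_push[OF jE(2)] remove_push[OF IJ(2) jE(1)] by auto
    qed
    then show ?thesis using rel fin IJ P'c by (simp add: plucker_rel_iff)
  qed
  have bases: "\<exists>A. B = \<phi> ` A \<and> A \<subseteq> E \<and> P A \<noteq> None" if "P' B \<noteq> None" for B
    using that push[of B] unfolding P'_def by (metis (full_types))
  have sets: "\<exists>A. B = \<phi> ` A \<and> A \<subseteq> E" if "B \<subseteq> E'" for B using push[OF that] by metis
  have pf: "plucker_fun F E' r P'"
    unfolding plucker_fun_def
  proof (intro conjI allI impI)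
    fix I assume I: "I \<notin> nsets E' r"
    show "P' I = None"
    proof (rule ccontr)
      assume "P' I \<noteq> None"
      then obtain A where A: "I = \<phi> ` A" "A \<subseteq> E" "P A \<noteq> None" using bases by blast
      then show False using I P.basisD(3)[of A] card_push[of A] fin[of A] by (auto simp: nsets_def E'_def)
    qed
  next
    obtain A where "P A \<noteq> None" using P.P_nonzero by auto
    then have "P' (\<phi> ` A) \<noteq> None" using P'_push P.basisD(1)[of A] by auto
    then show "\<exists>I. P' I \<noteq> None" by blast
  qed (rule P'c)
  have ex: "basis_exchange {I. P' I \<noteq> None}"
    unfolding basis_exchange_def
  proof (intro ballI)
    fix I J i assume "I \<in> {I. P' I \<noteq> None}" "J \<in> {I. P' I \<noteq> None}" and i: "i \<in> I - J"
    then obtain A B where A: "I = \<phi> ` A" "A \<subseteq> E" "P A \<noteq> None" and B: "J = \<phi> ` B" "B \<subseteq> E" "P B \<noteq> None"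
      using bases[of I] bases[of J] by auto
    obtain a where a: "a \<in> A" "a \<notin> B" "i = \<phi> a" using i A B by auto
    obtain b where b: "b \<in> B" "b \<notin> A" "insert b (A - {a}) \<in> {I. P I \<noteq> None}"
      by (rule basis_exchangeD[OF P.exchange, of A B a]) (use A B a in auto)
    have "insert (\<phi> b) (I - {i}) = \<phi> ` insert b (A - {a})"
      using remove_push[of A a] A a by auto
    moreover have "P' (\<phi> ` insert b (A - {a})) \<noteq> None"
      using b(3) P'_push[of "insert b (A - {a})"] P.basisD(1)[OF b(3)] by simp
    moreover have "\<phi> b \<in> J - I" using b A B diff_push[of B A] by auto
    ultimately show "\<exists>j \<in> J - I. insert j (I - {i}) \<in> {I. P' I \<noteq> None}"
      by (metis mem_Collect_eq)
  qed
  have P': "is_plucker k F E' r P'"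
  proof (cases k)
    case Weak
    have "plucker_rel F P' I J" if IJ: "I \<subseteq> E'" "J \<subseteq> E'" "Suc (card I) = r" "card J = Suc r" "card (J - I) = 3" for I J
    proof -
      obtain A B where A: "I = \<phi> ` A" "A \<subseteq> E" and B: "J = \<phi> ` B" "B \<subseteq> E"
        using sets[OF IJ(1)] sets[OF IJ(2)] by auto
      have "B - A \<subseteq> E" using B by auto
      then have "card (B - A) = 3"
        using IJ(5) A B diff_push[of B A] card_push[of "B - A"] by simp
      then have "plucker_rel F P A B"
        using P.weak IJ A B card_push unfolding weak_plucker_def by simp
      then show ?thesis using P'_rel A B by blast
    qed
    then show ?thesis using Weak pf ex by (simp add: weak_plucker_def)
  next
    case Strong
    have "plucker_rel F P' I J" if IJ: "I \<subseteq> E'" "J \<subseteq> E'" "Suc (card I) = r" "card J = Suc r" for I J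
    proof -
      obtain A B where A: "I = \<phi> ` A" "A \<subseteq> E" and B: "J = \<phi> ` B" "B \<subseteq> E"
        using sets[OF IJ(1)] sets[OF IJ(2)] by auto
      have "plucker_rel F P A B"
        using P Strong IJ A B card_push by (auto simp: strong_plucker_def)
      then show ?thesis using P'_rel A B by blast
    qed
    then show ?thesis using Strong pf by (simp add: strong_plucker_def)
  qed
  have cov': "covec F E' r P' W'"
    unfolding covec_def
  proof
    fix J assume "J \<in> nsets E' (Suc r)"
    then have J: "J \<subseteq> E'" "card J = Suc r" by (auto simp: nsets_def)
    obtain A where A: "J = \<phi> ` A" "A \<subseteq> E" using sets[OF J(1)] by auto
    then have An: "A \<in> nsets E (Suc r)" using J card_push[of A] fin[of A] by (auto simp: nsets_def)
    have "covec_sum F P' W' J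
        = covec_sum F P W A"
      unfolding A(1) sum_push[OF A(2)]
    proof (rule formal_sum_cong)
      fix i assume i: "i \<in> A"
      then have iE: "i \<in> E" "A - {i} \<subseteq> E" using A by auto
      then show "signed F (eps (\<phi> ` A) (\<phi> i)) (tmul F (P' (\<phi> ` A - {\<phi> i})) (W' (\<phi> i)))
          = signed F (eps A i) (tmul F (P (A - {i})) (W i))"
        using A iE eps_push remove_push P'_push[OF iE(2)] W'_push by auto
    qed
    then show "covec_sum F P' W' J \<in> null F"
      using cov An unfolding covec_def by simp
  qed
  have vec': "vec F E' r P' Y'"
    unfolding vec_def
  proof (intro allI impI)
    fix I assume I: "I \<subseteq> E'" "Suc (card I) = r"
    obtain A where A: "I = \<phi> ` A" "A \<subseteq> E" using sets[OF I(1)] by auto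
    have cA: "Suc (card A) = r" using I A card_push by simp
    have sub: "E - A \<subseteq> E" by auto
    have "vec_sum F E' P' Y' I
        = vec_sum F E P Y A"
      unfolding A(1) E'_def diff_push[OF order_refl A(2)] sum_push[OF sub]
    proof (rule formal_sum_cong)
      fix i assume i: "i \<in> E - A"
      have "insert (\<phi> i) (\<phi> ` A) = \<phi> ` insert i A" by simp
      then show "signed F (eps (\<phi> ` A) (\<phi> i)) (tmul F (P' (insert (\<phi> i) (\<phi> ` A))) (Y' (\<phi> i)))
          = signed F (eps A i) (tmul F (P (insert i A)) (Y i))"
        using A i eps_push P'_push[of "insert i A"] Y'_push by auto
    qed
    then show "vec_sum F E' P' Y' I \<in> null F"
      using vec A cA unfolding vec_def by simp
  qed
  define M :: "(nat, 'a) fmatroid" where "M = \<lparr>ground = E', rk = r, pluckers = scale_class F P'\<rparr>"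
  have M: "ground M = E'" "rk M = r" "pluckers M = scale_class F P'" by (auto simp: M_def)
  have fm: "is_fmatroid k F M" unfolding is_fmatroid_def using M P' E' by auto
  have P'M: "is_plucker k F (ground M) (rk M) P'" using P' M by simp
  have W't: "(\<lambda>i. tconj F (W' i)) \<in> tuples F E'" and Y't: "Y' \<in> tuples F E'"
    using W Y by (auto simp: tuples_def W'_def Y'_def)
  \<comment> \<open>\<open>covec\<close> is stated without the involution, so the covector proper is
    the conjugate of \<open>W'\<close>; conjugating the orthogonality relation then gives the
    bilinear pairing.\<close>
  have "(\<lambda>i. tconj F (W' i)) \<in> covectors F M"
    using covectors_iff[OF P'M M(3)] M E' W't cov' W'c by simp
  moreover have "Y' \<in> vectors F M"
    using vec_imp_vectors[OF P'M M(3)] M E' Y't vec' by simp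
  moreover have "perp F (ground M) (vectors F M) = covectors F M"
    using perfect fm unfolding perfect_def by blast
  ultimately have "orthogonal F E' (\<lambda>i. tconj F (W' i)) Y'" using M(1) unfolding perp_def by auto
  then have "formal_sum (\<lambda>i. tconj F (tmul F (W' i) (Y' i))) E' \<in> null F"
    unfolding orthogonal_def using W'c Y'c by (simp add: tconj_tmul)
  then have "formal_sum (\<lambda>i. tmul F (W' i) (Y' i)) E' \<in> null F"
    using W'c Y'c E' by (simp add: formal_sum_tconj)
  moreover have "formal_sum (\<lambda>i. tmul F (W' i) (Y' i)) E' = formal_sum (\<lambda>i. tmul F (W i) (Y i)) E"
    unfolding E'_def sum_push[OF order_refl] using W'_push Y'_push by (intro formal_sum_cong) auto
  ultimately show ?thesis by simp
qed

end

section \<open>Tropical extensions\<close>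

text \<open>A residue, meaningful only if \<open>\<alpha>\<close> bounds the valuation from below (see \<open>val_ge\<close>).\<close>

definition lead :: "'g \<Rightarrow> ('a \<times> 'g) option \<Rightarrow> 'a option" where
  "lead \<alpha> x = (if val x = Some \<alpha> then theta x else None)"

definition val_ge :: "'g::linordered_ab_group_add \<Rightarrow> ('a \<times> 'g) option \<Rightarrow> bool" where
  "val_ge \<alpha> x \<longleftrightarrow> (\<forall>a \<gamma>. x = Some (a, \<gamma>) \<longrightarrow> \<alpha> \<le> \<gamma>)"

lemma lead_Some: "lead \<alpha> (Some (a, \<gamma>)) = (if \<gamma> = \<alpha> then Some a else None)"
  by (simp add: lead_def val_def theta_def)

lemma lead_None [simp]: "lead \<alpha> None = None"
  by (simp add: lead_def val_def)

lemma val_ge_simps [simp]: "val_ge \<alpha> None" "val_ge \<alpha> (Some (a, \<gamma>)) \<longleftrightarrow> \<alpha> \<le> \<gamma>"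
  by (auto simp: val_ge_def)

lemma trop_ext_simps [simp]:
  "carrier (trop_ext F) = carrier F \<times> UNIV"
  "x \<otimes>\<^bsub>trop_ext F\<^esub> y = (fst x \<otimes>\<^bsub>F\<^esub> fst y, snd x + snd y)"
  "\<one>\<^bsub>trop_ext F\<^esub> = (\<one>\<^bsub>F\<^esub>, 0)"
  "invol (trop_ext F) x = (invol F (fst x), snd x)"
  by (auto simp: trop_ext_def split: prod.splits)

lemma null_trop_ext: "S \<in> null (trop_ext F) \<longleftrightarrow> set_mset S \<subseteq> carrier F \<times> UNIV \<and>
   (S = {#} \<or> image_mset fst (filter_mset (\<lambda>x. \<forall>y \<in># S. snd x \<le> snd y) S) \<in> null F)"
  by (simp add: trop_ext_def)

context tract
begin

lemma tract_trop_ext: "tract (trop_ext F :: ('a \<times> 'g::linordered_ab_group_add) tract)"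
proof -
  let ?T = "trop_ext F :: ('a \<times> 'g) tract"
  interpret T: comm_group ?T
  proof (rule comm_groupI)
    fix x assume "x \<in> carrier ?T"
    then show "\<exists>y \<in> carrier ?T. y \<otimes>\<^bsub>?T\<^esub> x = \<one>\<^bsub>?T\<^esub>"
      by (intro bexI[of _ "(inv (fst x), - snd x)"]) auto
  qed (auto simp: m_assoc add.assoc add.commute intro: m_comm)
  show ?thesis
  proof
    show "\<exists>!e. e \<in> carrier ?T \<and> {#\<one>\<^bsub>?T\<^esub>, e#} \<in> null ?T"
    proof (rule ex1I[of _ "(neg_one F, 0)"])
      show "(neg_one F, 0) \<in> carrier ?T \<and> {#\<one>\<^bsub>?T\<^esub>, (neg_one F, 0)#} \<in> null ?T"
        using neg_one_props by (simp add: null_trop_ext)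
      fix e assume e: "e \<in> carrier ?T \<and> {#\<one>\<^bsub>?T\<^esub>, e#} \<in> null ?T"
      obtain a \<gamma> where [simp]: "e = (a, \<gamma>)" by (cases e)
      \<comment> \<open>If \<open>\<gamma>\<close> is not zero, only one of the two terms has
        minimal value, and a single term is never null.\<close>
      consider "\<gamma> = 0" | "\<gamma> < 0" | "0 < \<gamma>" by (cases \<gamma> "0 :: 'g" rule: linorder_cases) auto
      then show "e = (neg_one F, 0)"
      proof cases
        case 1
        then show ?thesis using e neg_one_eqI by (simp add: null_trop_ext)
      next
        case 2
        then have "\<not> 0 \<le> \<gamma>" "\<gamma> \<le> 0" by auto
        then show ?thesis using e singleton_not_null[of a] by (simp add: null_trop_ext)
      next
        case 3
        then have "\<not> \<gamma> \<le> 0" "0 \<le> \<gamma>" by auto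
        then show ?thesis using e one_not_null by (simp add: null_trop_ext)
      qed
    qed
  next
    fix S c assume S: "S \<in> null ?T" and c: "c \<in> carrier ?T"
    have "filter_mset (\<lambda>x. \<forall>y \<in># image_mset ((\<otimes>\<^bsub>?T\<^esub>) c) S. snd x \<le> snd y) (image_mset ((\<otimes>\<^bsub>?T\<^esub>) c) S)
        = image_mset ((\<otimes>\<^bsub>?T\<^esub>) c) (filter_mset (\<lambda>x. \<forall>y \<in># S. snd x \<le> snd y) S)"
      by (simp add: filter_mset_image_mset)
    moreover have "image_mset fst (image_mset ((\<otimes>\<^bsub>?T\<^esub>) c) X) = image_mset (\<lambda>a. fst c \<otimes> a) (image_mset fst X)" for X
      by (simp add: multiset.map_comp o_def)
    ultimately show "image_mset ((\<otimes>\<^bsub>?T\<^esub>) c) S \<in> null ?T"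
      using S c null_scale unfolding null_trop_ext by auto
  next
    have "image_mset (invol ?T) S \<in> null ?T" if S: "S \<in> null ?T" for S
    proof -
      have "filter_mset (\<lambda>x. \<forall>y \<in># image_mset (invol ?T) S. snd x \<le> snd y) (image_mset (invol ?T) S)
          = image_mset (invol ?T) (filter_mset (\<lambda>x. \<forall>y \<in># S. snd x \<le> snd y) S)"
        by (simp add: filter_mset_image_mset)
      moreover have "image_mset fst (image_mset (invol ?T) X) = image_mset (invol F) (image_mset fst X)" for X :: "('a \<times> 'g) multiset"
        by (simp add: multiset.map_comp o_def)
      ultimately show ?thesis
        using S invol_null unfolding null_trop_ext by auto
    qed
    then show "invol ?T \<in> tract_hom ?T ?T"
      unfolding tract_hom_def hom_def by (auto simp: invol_mult)
  qed (use zero_null one_not_null in \<open>auto simp: null_trop_ext invol_invol\<close>)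
qed

end

section \<open>Initial matroids\<close>

lemma covec_cong: "(\<And>i. i \<in> E \<Longrightarrow> W i = W' i) \<Longrightarrow> covec F E r P W \<longleftrightarrow> covec F E r P W'"
  unfolding covec_def
  by (intro ball_cong refl arg_cong2[where f = "(\<in>)"] formal_sum_cong) (auto simp: nsets_def)

lemma val_eq_None_iff [simp]: "val x = None \<longleftrightarrow> x = None"
  by (simp add: val_def)

lemma val_None [simp]: "val None = None"
  by simp

lemma theta_eq_None_iff [simp]: "theta x = None \<longleftrightarrow> x = None"
  by (simp add: theta_def)

lemma val_ge_val: "val x = Some \<gamma> \<Longrightarrow> val_ge \<alpha> x \<longleftrightarrow> \<alpha> \<le> \<gamma>"
  by (auto simp: val_def)

lemma lead_val: "val x = Some \<alpha> \<Longrightarrow> lead \<alpha> x = theta x"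
  by (simp add: lead_def)

lemma lead_eq_None_iff: "lead \<alpha> x \<noteq> None \<longleftrightarrow> val x = Some \<alpha>"
  by (auto simp: lead_def val_def theta_def)

section \<open>Leading coefficients and initial Pluecker vectors\<close>

context tract
begin

lemma neg_one_trop_ext: "neg_one (trop_ext F :: ('a \<times> 'g::linordered_ab_group_add) tract) = (neg_one F, 0)"
proof -
  interpret T: tract "trop_ext F :: ('a \<times> 'g) tract" by (rule tract_trop_ext)
  show ?thesis
    using T.neg_one_eqI[of "(neg_one F, 0)"] neg_one_props by (simp add: null_trop_ext)
qed

lemma neg_one_pow_trop_ext:
  fixes n :: nat
  shows "neg_one (trop_ext F :: ('a \<times> 'g::linordered_ab_group_add) tract) [^]\<^bsub>trop_ext F\<^esub> n
    = (neg_one F [^] n, 0)"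
proof -
  interpret T: tract "trop_ext F :: ('a \<times> 'g) tract" by (rule tract_trop_ext)
  show ?thesis by (induction n) (auto simp: neg_one_trop_ext)
qed

lemma lead_signed: "lead \<alpha> (signed (trop_ext F) n x) = signed F n (lead \<alpha> x)"
  by (cases x) (auto simp: signed_def neg_one_pow_trop_ext lead_Some)

text \<open>The sum of two lower bounds is attained only if both bounds are attained, so
  coefficients at the bounds multiply even when they vanish.\<close>

lemma lead_tmul:
  assumes "val_ge \<alpha> x" "val_ge \<beta> y"
  shows "lead (\<alpha> + \<beta>) (tmul (trop_ext F) x y) = tmul F (lead \<alpha> x) (lead \<beta> y)"
proof (cases "x = None \<or> y = None")
  case False
  then obtain a \<gamma> b \<delta> where x: "x = Some (a, \<gamma>)" and y: "y = Some (b, \<delta>)" by auto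
  have "\<gamma> + \<delta> = \<alpha> + \<beta> \<longleftrightarrow> \<gamma> = \<alpha> \<and> \<delta> = \<beta>"
    using assms x y by (metis add_le_less_mono add_less_le_mono less_irrefl order_le_less val_ge_simps(2))
  then show ?thesis by (simp add: x y lead_Some)
qed auto

lemma val_tmul_ge: "val_ge \<alpha> x \<Longrightarrow> val_ge \<beta> y \<Longrightarrow> val_ge (\<alpha> + \<beta>) (tmul (trop_ext F) x y)"
  by (cases x; cases y) (auto intro: add_mono)

lemma val_ge_signed [simp]: "val_ge \<alpha> (signed (trop_ext F) n x) \<longleftrightarrow> val_ge \<alpha> x"
  by (cases x) (auto simp: signed_def neg_one_pow_trop_ext)

lemma lead_closed [simp, intro]: "x \<in> elems (trop_ext F) \<Longrightarrow> lead \<alpha> x \<in> elems F"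
  by (cases x) (auto simp: lead_Some)

lemma theta_closed [simp, intro]: "x \<in> elems (trop_ext F) \<Longrightarrow> theta x \<in> elems F"
  by (cases x) (auto simp: theta_def)

lemma theta_tconj: "theta (tconj (trop_ext F) x) = tconj F (theta x)"
  by (cases x) (auto simp: tconj_def theta_def)

lemma val_tconj [simp]: "val (tconj (trop_ext F) x) = val x"
  by (cases x) (auto simp: tconj_def val_def)

lemma formal_sum_lead:
  assumes "finite A"
  shows "formal_sum (\<lambda>i. lead c (f i)) A
       = image_mset fst (filter_mset (\<lambda>x. snd x = c) (formal_sum f A))"
  using assms
proof (induction A)
  case (insert i A)
  show ?case
  proof (cases "f i")
    case None
    then show ?thesis using insert by (simp add: formal_sum_insert_None)
  next
    case (Some x)
    then obtain a \<gamma> where "f i = Some (a, \<gamma>)" by (cases x) auto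
    then show ?thesis
      using insert by (cases "\<gamma> = c")
        (simp_all add: formal_sum_insert formal_sum_insert_None lead_Some)
  qed
qed simp

lemma formal_sum_in:
  assumes "finite A" "x \<in># formal_sum f A"
  obtains i where "i \<in> A" "f i = Some x"
  using assms by (auto simp: formal_sum_def)

text \<open>If the bound \<open>c\<close> is attained, the terms of value \<open>c\<close> are the
  minimal ones and their sum is null by definition; if not, all coefficients at \<open>c\<close>
  vanish and the sum is empty.\<close>

lemma null_lead:
  assumes A: "finite A" and ge: "\<And>i. i \<in> A \<Longrightarrow> val_ge c (f i)"
    and null: "formal_sum f A \<in> null (trop_ext F)"
  shows "formal_sum (\<lambda>i. lead c (f i)) A \<in> null F"
proof -
  let ?S = "formal_sum f A"
  have c: "c \<le> snd x" if "x \<in># ?S" for x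
    using that ge by (elim formal_sum_in[OF A]) (cases x, fastforce)
  show ?thesis
  proof (cases "\<exists>x. x \<in># ?S \<and> snd x = c")
    case True
    then obtain x0 where "x0 \<in># ?S" "snd x0 = c" by auto
    then have "(\<forall>y \<in># ?S. snd x \<le> snd y) \<longleftrightarrow> snd x = c" if "x \<in># ?S" for x
      using c that by (metis order_antisym)
    then have "filter_mset (\<lambda>x. \<forall>y \<in># ?S. snd x \<le> snd y) ?S = filter_mset (\<lambda>x. snd x = c) ?S"
      by (intro filter_mset_cong) auto
    then show ?thesis using null True zero_null
      unfolding null_trop_ext formal_sum_lead[OF A] by auto
  next
    case False
    then have "filter_mset (\<lambda>x. snd x = c) ?S = {#}" using False by (auto simp: multiset_eq_iff not_in_iff)
    then show ?thesis unfolding formal_sum_lead[OF A] using zero_null by (metis image_mset_empty)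
  qed
qed

text \<open>The converse of \<open>null_lead\<close> requires the bound to be attained: otherwise
  the sum of the coefficients at \<open>c\<close> is empty and says nothing about the terms of
  minimal value.\<close>

lemma null_of_lead:
  assumes A: "finite A" and closed: "\<And>i. i \<in> A \<Longrightarrow> f i \<in> elems (trop_ext F)"
    and ge: "\<And>i. i \<in> A \<Longrightarrow> val_ge c (f i)" and i: "i \<in> A" "val (f i) = Some c"
    and null: "formal_sum (\<lambda>i. lead c (f i)) A \<in> null F"
  shows "formal_sum f A \<in> null (trop_ext F)"
proof -
  interpret T: tract "trop_ext F" by (rule tract_trop_ext)
  let ?S = "formal_sum f A"
  have c: "c \<le> snd x" if "x \<in># ?S" for x
    using that ge by (elim formal_sum_in[OF A]) (cases x, fastforce)
  obtain a where fi: "f i = Some (a, c)" using i by (auto simp: val_def)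
  have "?S = add_mset (a, c) (formal_sum f (A - {i}))"
    using formal_sum_insert[of "A - {i}" i f "(a, c)"] A fi i by (simp add: insert_absorb)
  then have "(a, c) \<in># ?S" by simp
  then have "(\<forall>y \<in># ?S. snd x \<le> snd y) \<longleftrightarrow> snd x = c" if "x \<in># ?S" for x
    using c that by (metis order_antisym snd_conv)
  then have "filter_mset (\<lambda>x. \<forall>y \<in># ?S. snd x \<le> snd y) ?S = filter_mset (\<lambda>x. snd x = c) ?S"
    by (intro filter_mset_cong) auto
  then show ?thesis
    using null T.formal_sum_carrier[of A f] closed
    unfolding null_trop_ext formal_sum_lead[OF A] by auto
qed

text \<open>The common scheme by which Pluecker relations, covectors and vectors pass to
  \<open>F\<close>: the bounds of the two factors may vary with the index as long as their sum is
  constant.\<close>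

lemma null_lead_prod:
  assumes A: "finite A" and x: "\<And>i. i \<in> A \<Longrightarrow> val_ge (\<alpha> i) (x i)" and y: "\<And>i. i \<in> A \<Longrightarrow> val_ge (\<beta> i) (y i)"
    and c: "\<And>i. i \<in> A \<Longrightarrow> \<alpha> i + \<beta> i = c"
    and null: "formal_sum (\<lambda>i. signed (trop_ext F) (n i) (tmul (trop_ext F) (x i) (y i))) A \<in> null (trop_ext F)"
  shows "formal_sum (\<lambda>i. signed F (n i) (tmul F (lead (\<alpha> i) (x i)) (lead (\<beta> i) (y i)))) A \<in> null F"
proof -
  have "formal_sum (\<lambda>i. lead c (signed (trop_ext F) (n i) (tmul (trop_ext F) (x i) (y i)))) A \<in> null F"
  proof (rule null_lead[OF A _ null])
    fix i assume i: "i \<in> A"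
    show "val_ge c (signed (trop_ext F) (n i) (tmul (trop_ext F) (x i) (y i)))"
      using val_tmul_ge[OF x[OF i] y[OF i]] c[OF i] by simp
  qed
  moreover have "formal_sum (\<lambda>i. lead c (signed (trop_ext F) (n i) (tmul (trop_ext F) (x i) (y i)))) A
      = formal_sum (\<lambda>i. signed F (n i) (tmul F (lead (\<alpha> i) (x i)) (lead (\<beta> i) (y i)))) A"
  proof (rule formal_sum_cong)
    fix i assume i: "i \<in> A"
    show "lead c (signed (trop_ext F) (n i) (tmul (trop_ext F) (x i) (y i)))
        = signed F (n i) (tmul F (lead (\<alpha> i) (x i)) (lead (\<beta> i) (y i)))"
      using lead_tmul[OF x[OF i] y[OF i]] c[OF i] by (simp add: lead_signed)
  qed
  ultimately show ?thesis by simp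
qed

text \<open>With \<open>m\<close> the least value of the valuation of \<open>P I\<close> minus
  \<open>sum u I\<close>, passing to the initial vector means taking coefficients at the bound
  \<open>m + sum u I\<close>. This bound is affine in \<open>I\<close>, which makes the bounds in
  relations add up to constants.\<close>

lemma initial_plucker_lead:
  fixes P :: "'e set \<Rightarrow> ('a \<times> 'g::linordered_ab_group_add) option"
  assumes P: "plucker_fun (trop_ext F) E r P" and E: "finite E"
  obtains m where "\<And>I. val_ge (m + sum u I) (P I)"
    "\<And>I. initial_plucker E r u P I = lead (m + sum u I) (P I)"
    "\<exists>I. val (P I) = Some (m + sum u I)"
proof -
  define v where "v I = snd (the (P I)) - sum u I" for I
  let ?B = "{I. P I \<noteq> None}"
  have BE: "?B \<subseteq> nsets E r" using plucker_funD(2)[OF P] by auto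
  have "finite ?B" using BE E by (meson finite_imp_finite_nsets finite_subset)
  moreover have "?B \<noteq> {}" using plucker_funD(3)[OF P] by auto
  ultimately obtain I0 where I0: "P I0 \<noteq> None" and min: "\<And>I. P I \<noteq> None \<Longrightarrow> v I0 \<le> v I"
    using arg_min_if_finite[of ?B v] by (metis (mono_tags, lifting) linorder_not_le mem_Collect_eq)
  let ?m = "v I0"
  have v: "val (P I) = Some (v I + sum u I)" if "P I \<noteq> None" for I
    using that by (auto simp: v_def val_def)
  show ?thesis
  proof (rule that[of ?m])
    fix I
    show "val_ge (?m + sum u I) (P I)"
    proof (cases "P I = None")
      case False
      then show ?thesis using v[OF False] min[OF False] by (simp add: val_ge_val)
    qed simp
    show "initial_plucker E r u P I = lead (?m + sum u I) (P I)"
    proof (cases "P I = None")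
      case True
      then show ?thesis by (simp add: initial_plucker_def theta_def)
    next
      case False
      have le: "le_infty (map_option (\<lambda>\<gamma>. \<gamma> - sum u I) (val (P I))) (map_option (\<lambda>\<gamma>. \<gamma> - sum u J) (val (P J)))
          \<longleftrightarrow> (P J \<noteq> None \<longrightarrow> v I \<le> v J)" for J
        using v[OF False] v[of J] by (cases "P J = None") (simp_all add: le_infty_def)
      have "I \<in> nsets E r" "I0 \<in> nsets E r" using BE False I0 by auto
      then have "(I \<in> nsets E r \<and> (\<forall>J \<in> nsets E r. le_infty (map_option (\<lambda>\<gamma>. \<gamma> - sum u I) (val (P I)))
          (map_option (\<lambda>\<gamma>. \<gamma> - sum u J) (val (P J))))) \<longleftrightarrow> v I = ?m"
        unfolding le using min I0 False by (metis order_antisym)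
      then show ?thesis unfolding initial_plucker_def lead_def using v[OF False] by simp
    qed
  next
    show "\<exists>I. val (P I) = Some (?m + sum u I)" using v[OF I0] by blast
  qed
qed

text \<open>In every term the bounds add up to \<open>m + m + sum u I + sum u J\<close>. The
  relation for a given pair passes to the initial vector by itself, hence the argument serves weak
  and strong vectors alike.\<close>

lemma initial_plucker_rel:
  fixes P :: "'e::linorder set \<Rightarrow> ('a \<times> 'g::linordered_ab_group_add) option"
  assumes P: "plucker_fun (trop_ext F) E r P" and E: "finite E" and IJ: "finite I" "finite J"
    and rel: "plucker_rel (trop_ext F) P I J"
  shows "plucker_rel F (initial_plucker E r u P) I J"
proof -
  interpret T: tract "trop_ext F :: ('a \<times> 'g) tract" by (rule tract_trop_ext)
  note Pc = plucker_funD(1)[OF P]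
  obtain m where m: "\<And>I. val_ge (m + sum u I) (P I)"
    "\<And>I. initial_plucker E r u P I = lead (m + sum u I) (P I)"
    by (rule initial_plucker_lead[OF P E, of u]) blast
  let ?Q = "initial_plucker E r u P"
  have Q: "?Q I \<in> elems F" for I using m(2) Pc by simp
  have "plucker_sum F ?Q I J \<in> null F"
    unfolding m(2)
  proof (rule null_lead_prod)
    show "plucker_sum (trop_ext F) P I J \<in> null (trop_ext F)"
      using rel T.plucker_rel_iff[OF IJ, of P] Pc by simp
    fix j assume j: "j \<in> J - I"
    have "sum u J = u j + sum u (J - {j})" using j IJ by (simp add: sum.remove)
    then show "m + sum u (insert j I) + (m + sum u (J - {j})) = m + m + sum u I + sum u J"
      using j IJ by (simp add: algebra_simps)
  qed (use IJ in simp, rule m(1), rule m(1))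
  then show ?thesis using IJ Q by (simp add: plucker_rel_iff)
qed

text \<open>Relations pass to leading terms one at a time. In the weak case the support, which
  consists of the minimizers of the tilted valuation, must also satisfy exchange;
  \<open>basis_exchange_minimizers\<close> reduces this to distance 2.\<close>

lemma is_plucker_initial:
  fixes P :: "'e::linorder set \<Rightarrow> ('a \<times> 'g::linordered_ab_group_add) option"
  assumes P: "is_plucker k (trop_ext F) E r P" and E: "finite E"
  shows "is_plucker k F E r (initial_plucker E r u P)"
proof -
  interpret T: tract "trop_ext F :: ('a \<times> 'g) tract" by (rule tract_trop_ext)
  interpret P: weak_plucker_fun "trop_ext F" E r P
    by (rule T.weak_plucker_funI[OF E P])
  have pf: "plucker_fun F E r (initial_plucker E r u P)" for u
  proof -
    obtain m where m: "\<And>I. initial_plucker E r u P I = lead (m + sum u I) (P I)"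
      "\<exists>I. val (P I) = Some (m + sum u I)"
      by (rule initial_plucker_lead[OF P.plucker_fun E, of u]) blast
    have "initial_plucker E r u P I = None" if "I \<notin> nsets E r" for I
      using that by (simp add: initial_plucker_def)
    moreover have "\<exists>I. initial_plucker E r u P I \<noteq> None"
      unfolding m(1) lead_eq_None_iff by (rule m(2))
    moreover have "initial_plucker E r u P I \<in> elems F" for I unfolding m(1) by simp
    ultimately show ?thesis unfolding plucker_fun_def by blast
  qed
  note rel = initial_plucker_rel[OF P.plucker_fun E]
  have fin: "finite I" if "I \<subseteq> E" for I using that E by (rule finite_subset)
  show ?thesis
  proof (cases k)
    case Strong
    then have "strong_plucker (trop_ext F) E r P" using P by simp
    then have "plucker_rel F (initial_plucker E r u P) I J"
      if "I \<subseteq> E" "J \<subseteq> E" "Suc (card I) = r" "card J = Suc r" for I J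
      using that fin unfolding strong_plucker_def by (intro rel) auto
    then have "strong_plucker F E r (initial_plucker E r u P)"
      using pf unfolding strong_plucker_def by blast
    then show ?thesis using Strong by simp
  next
    case Weak
    define v where "v I = snd (the (P I))" for I
    have min: "{I. initial_plucker E r u P I \<noteq> None} = P.minimizers v u" for u
    proof -
      obtain m where m: "\<And>I. val_ge (m + sum u I) (P I)"
        "\<And>I. initial_plucker E r u P I = lead (m + sum u I) (P I)"
        "\<exists>I. val (P I) = Some (m + sum u I)"
        by (rule initial_plucker_lead[OF P.plucker_fun E, of u]) blast
      have val: "val (P I) = Some (v I)" if "P I \<noteq> None" for I using that by (auto simp: v_def val_def)
      have ge: "m \<le> v I - sum u I" if "P I \<noteq> None" for I
        using m(1)[of I] val[OF that] by (simp add: val_ge_val algebra_simps)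
      obtain I0 where I0: "val (P I0) = Some (m + sum u I0)" using m(3) by blast
      then have "P I0 \<noteq> None" by (metis option.distinct(1) val_None)
      then have I0': "P I0 \<noteq> None" "v I0 - sum u I0 = m" using I0 val by auto
      have "initial_plucker E r u P I \<noteq> None \<longleftrightarrow> P I \<noteq> None \<and> v I - sum u I \<le> m" for I
      proof (cases "P I = None")
        case False
        have "val (P I) = Some (m + sum u I) \<longleftrightarrow> v I - sum u I = m"
          using val[OF False] by (auto simp: algebra_simps)
        then show ?thesis unfolding m(2) lead_eq_None_iff using ge[OF False] False by auto
      qed (simp add: m(2))
      then show ?thesis unfolding P.minimizers_def using ge I0' by (auto intro: order_trans)
    qed
    have "basis_exchange {I. initial_plucker E r u P I \<noteq> None}"
      unfolding min
    proof (rule P.basis_exchange_minimizers)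
      fix u I J i
      assume I: "I \<in> P.minimizers v u" and J: "J \<in> P.minimizers v u"
        and c: "card (I - J) = 2" and i: "i \<in> I - J"
      let ?Q = "initial_plucker E r u P"
      have IB: "I \<in> {I. P I \<noteq> None}" and JB: "J \<in> {I. P I \<noteq> None}"
        using I J unfolding P.minimizers_def by auto
      note Ib = P.basisD[OF IB] and Jb = P.basisD[OF JB]
      \<comment> \<open>Bases at distance 2 are the case in which the relation for
        \<open>I - {i}\<close> and \<open>insert i J\<close> has three terms and so holds for weak
        vectors.\<close>
      have "card (J - I) = 2" using P.card_Diff_basis[OF IB JB] c by simp
      moreover have "insert i J - (I - {i}) = insert i (J - I)" using i by auto
      ultimately have c3: "card (insert i J - (I - {i})) = 3" using i Jb by simp
      have cards: "Suc (card (I - {i})) = r" "card (insert i J) = Suc r"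
        using i Ib Jb card_Suc_Diff1[of I i] by simp_all
      have "I - {i} \<subseteq> E" "insert i J \<subseteq> E" using i Ib Jb by auto
      then have "plucker_rel (trop_ext F) P (I - {i}) (insert i J)"
        using P.weak cards c3 unfolding weak_plucker_def by blast
      then have "plucker_rel F ?Q (I - {i}) (insert i J)" using Ib Jb by (intro rel) auto
      then have "\<exists>j \<in> J - I. ?Q (insert j (I - {i})) \<noteq> None"
        using I J i Ib Jb plucker_funD(1)[OF pf]
        by (intro exchange_of_plucker_rel) (auto simp: min[symmetric])
      then show "\<exists>j \<in> J - I. insert j (I - {i}) \<in> P.minimizers v u"
        unfolding min[symmetric] by auto
    qed
    moreover have "plucker_rel F (initial_plucker E r u P) I J"
      if "I \<subseteq> E" "J \<subseteq> E" "Suc (card I) = r" "card J = Suc r" "card (J - I) = 3" for I J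
      using that fin P.weak unfolding weak_plucker_def by (intro rel) auto
    ultimately have "weak_plucker F E r (initial_plucker E r u P)"
      using pf unfolding weak_plucker_def by blast
    then show ?thesis using Weak by simp
  qed
qed

lemma covec_initial:
  fixes P :: "'e::linorder set \<Rightarrow> ('a \<times> 'g::linordered_ab_group_add) option"
  assumes P: "plucker_fun (trop_ext F) E r P" and E: "finite E"
    and u: "\<And>i. i \<in> E \<Longrightarrow> val_ge (u i) (W i)"
    and cov: "covec (trop_ext F) E r P W"
  shows "covec F E r (initial_plucker E r u P) (\<lambda>i. lead (u i) (W i))"
  unfolding covec_def
proof
  fix J assume J: "J \<in> nsets E (Suc r)"
  then have JE: "J \<subseteq> E" "finite J" by (auto simp: nsets_def)
  obtain m where m: "\<And>I. val_ge (m + sum u I) (P I)"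
    "\<And>I. initial_plucker E r u P I = lead (m + sum u I) (P I)"
    by (rule initial_plucker_lead[OF P E, of u]) blast
  show "formal_sum (\<lambda>i. signed F (eps J i) (tmul F (initial_plucker E r u P (J - {i})) (lead (u i) (W i)))) J \<in> null F"
    unfolding m(2)
  proof (rule null_lead_prod)
    show "covec_sum (trop_ext F) P W J \<in> null (trop_ext F)"
      using cov J unfolding covec_def by blast
    fix i assume i: "i \<in> J"
    show "val_ge (m + sum u (J - {i})) (P (J - {i}))" by (rule m(1))
    show "val_ge (u i) (W i)" using u i JE by auto
    show "m + sum u (J - {i}) + u i = m + sum u J"
      using i JE by (simp add: sum.remove[of J i] add.assoc add.commute)
  qed (rule JE(2))
qed

text \<open>A vector is paired with coordinates at \<open>insert i I\<close>, whose bound grows by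
  \<open>u i\<close>, so its entries must be taken at \<open>c - u i\<close> for the sums to be
  constant. Covectors, paired with coordinates at \<open>J - {i}\<close>, are taken at
  \<open>u i\<close> instead.\<close>

lemma vec_initial:
  fixes P :: "'e::linorder set \<Rightarrow> ('a \<times> 'g::linordered_ab_group_add) option"
  assumes P: "plucker_fun (trop_ext F) E r P" and E: "finite E"
    and u: "\<And>i. i \<in> E \<Longrightarrow> val_ge (c - u i) (Y i)"
    and vec: "vec (trop_ext F) E r P Y"
  shows "vec F E r (initial_plucker E r u P) (\<lambda>i. lead (c - u i) (Y i))"
  unfolding vec_def
proof (intro allI impI)
  fix I assume I: "I \<subseteq> E" "Suc (card I) = r"
  have fI: "finite I" using I(1) E by (rule finite_subset)
  obtain m where m: "\<And>I. val_ge (m + sum u I) (P I)"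
    "\<And>I. initial_plucker E r u P I = lead (m + sum u I) (P I)"
    by (rule initial_plucker_lead[OF P E, of u]) blast
  show "formal_sum (\<lambda>i. signed F (eps I i) (tmul F (initial_plucker E r u P (insert i I)) (lead (c - u i) (Y i)))) (E - I) \<in> null F"
    unfolding m(2)
  proof (rule null_lead_prod)
    show "vec_sum (trop_ext F) E P Y I \<in> null (trop_ext F)"
      using vec I unfolding vec_def by blast
    fix i assume i: "i \<in> E - I"
    show "val_ge (m + sum u (insert i I)) (P (insert i I))" by (rule m(1))
    show "val_ge (c - u i) (Y i)" using u i by auto
    show "m + sum u (insert i I) + (c - u i) = m + sum u I + c"
      using i fI by (simp add: algebra_simps)
  qed (use E in simp)
qed

text \<open>Only the leading part of \<open>W\<close> is known to be a covector, so everything is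
  decided on leading terms. The bound \<open>?c\<close> is the least value of a product of entries
  of \<open>W\<close> and \<open>Y\<close>. Perfectness of \<open>F\<close> makes the sum of the
  coefficients at \<open>?c\<close> null, and \<open>?c\<close> is attained, so
  \<open>null_of_lead\<close> applies.\<close>

lemma perfect_pairing_trop_ext:
  fixes P :: "'e::linorder set \<Rightarrow> ('a \<times> 'g::linordered_ab_group_add) option"
  assumes perfect: "perfect k F" and P: "is_plucker k (trop_ext F) E r P" and E: "finite E"
    and W: "\<And>i. W i \<in> elems (trop_ext F)" and Y: "\<And>i. Y i \<in> elems (trop_ext F)"
    and W0: "\<And>i. i \<in> E \<Longrightarrow> val (W i) = Some (u i)"
    and cov: "covec F E r (initial_plucker E r u P) (\<lambda>i. theta (W i))"
    and vec: "vec (trop_ext F) E r P Y"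
  shows "formal_sum (\<lambda>i. tmul (trop_ext F) (W i) (Y i)) E \<in> null (trop_ext F)"
proof -
  interpret T: tract "trop_ext F :: ('a \<times> 'g) tract" by (rule tract_trop_ext)
  show ?thesis
  proof (cases "\<exists>i \<in> E. Y i \<noteq> None")
    case False
    then show ?thesis using T.zero_null by (subst formal_sum_eq_empty) auto
  next
    case True
    let ?N = "{i \<in> E. Y i \<noteq> None}"
    define w where "w i = snd (the (Y i)) + u i" for i
    have val: "val (Y i) = Some (w i - u i)" if "Y i \<noteq> None" for i
      using that by (auto simp: w_def val_def)
    have "finite ?N" "?N \<noteq> {}" using E True by auto
    then obtain i0 where i0: "i0 \<in> E" "Y i0 \<noteq> None" and min: "\<And>i. i \<in> E \<Longrightarrow> Y i \<noteq> None \<Longrightarrow> w i0 \<le> w i"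
      using arg_min_if_finite[of ?N w] by (metis (mono_tags, lifting) linorder_not_le mem_Collect_eq)
    let ?c = "w i0"
    have ge: "val_ge (?c - u i) (Y i)" if "i \<in> E" for i
    proof (cases "Y i = None")
      case False
      then show ?thesis using val[OF False] min[OF that False] by (simp add: val_ge_val)
    qed simp
    have "plucker_fun (trop_ext F) E r P"
      using T.plucker_weak[OF E P] unfolding weak_plucker_def by blast
    then have vec': "vec F E r (initial_plucker E r u P) (\<lambda>i. lead (?c - u i) (Y i))"
      using E ge vec by (rule vec_initial)
    have "formal_sum (\<lambda>i. tmul F (theta (W i)) (lead (?c - u i) (Y i))) E \<in> null F"
      using W Y by (intro perfect_pairing[OF perfect is_plucker_initial[OF P E] E _ _ cov vec']) auto
    moreover have l: "lead ?c (tmul (trop_ext F) (W i) (Y i)) = tmul F (theta (W i)) (lead (?c - u i) (Y i))"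
      if i: "i \<in> E" for i
      using lead_tmul[of "u i" "W i" "?c - u i" "Y i"] ge[OF i] W0[OF i]
      by (simp add: val_ge_val lead_val)
    have "formal_sum (\<lambda>i. lead ?c (tmul (trop_ext F) (W i) (Y i))) E
        = formal_sum (\<lambda>i. tmul F (theta (W i)) (lead (?c - u i) (Y i))) E"
      by (rule formal_sum_cong) (rule l)
    ultimately have null: "formal_sum (\<lambda>i. lead ?c (tmul (trop_ext F) (W i) (Y i))) E \<in> null F" by simp
    show ?thesis
    proof (rule null_of_lead[OF E _ _ i0(1) _ null])
      fix i assume i: "i \<in> E"
      show "val_ge ?c (tmul (trop_ext F) (W i) (Y i))"
        using val_tmul_ge[of "u i" "W i" "?c - u i" "Y i"] ge[OF i] W0[OF i] by (simp add: val_ge_val)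
    next
      have "lead (?c - u i0) (Y i0) \<noteq> None" using val[OF i0(2)] by (simp add: lead_eq_None_iff)
      moreover have "theta (W i0) \<noteq> None"
        unfolding theta_eq_None_iff using W0[OF i0(1)] by (metis option.distinct(1) val_None)
      ultimately have "lead ?c (tmul (trop_ext F) (W i0) (Y i0)) \<noteq> None" using l[OF i0(1)] by simp
      then show "val (tmul (trop_ext F) (W i0) (Y i0)) = Some ?c" by (simp only: lead_eq_None_iff)
    qed (use W Y in auto)
  qed
qed

section \<open>From initial Pluecker vectors to initial matroids\<close>

lemma initial_plucker_scale:
  fixes P :: "'e set \<Rightarrow> ('a \<times> 'g::linordered_ab_group_add) option"
  shows "initial_plucker E r u (\<lambda>I. tmul (trop_ext F) (Some c) (P I)) I
    = tmul F (Some (fst c)) (initial_plucker E r u P I)"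
proof -
  have v: "map_option (\<lambda>\<gamma>. \<gamma> - s) (val (tmul (trop_ext F) (Some c) x))
      = map_option (\<lambda>\<gamma>. snd c + \<gamma>) (map_option (\<lambda>\<gamma>. \<gamma> - s) (val x))"
    for s :: 'g and x :: "('a \<times> 'g) option"
    by (cases x) (auto simp: val_def algebra_simps)
  have le: "le_infty (map_option (\<lambda>\<gamma>. snd c + \<gamma>) x) (map_option (\<lambda>\<gamma>. snd c + \<gamma>) y) \<longleftrightarrow> le_infty x y"
    for x y :: "'g option"
    by (cases x; cases y) (auto simp: le_infty_def)
  have "theta (tmul (trop_ext F) (Some c) x) = tmul F (Some (fst c)) (theta x)" for x :: "('a \<times> 'g) option"
    by (cases x) (auto simp: theta_def)
  then show ?thesis unfolding initial_plucker_def v le by simp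
qed

lemma pluckers_initial_fin:
  fixes P :: "'e set \<Rightarrow> ('a \<times> 'g::linordered_ab_group_add) option"
  assumes "pluckers M = scale_class (trop_ext F) P"
  shows "pluckers (initial_fin M u) = scale_class F (initial_plucker (ground M) (rk M) u P)"
proof -
  let ?i = "initial_plucker (ground M) (rk M) u"
  have eq: "?i (\<lambda>I. tmul (trop_ext F) (Some c) (P I)) = (\<lambda>I. tmul F (Some (fst c)) (?i P I))" for c
    using initial_plucker_scale by blast
  show ?thesis
  proof
    show "pluckers (initial_fin M u) \<subseteq> scale_class F (?i P)"
      unfolding initial_fin_def assms scale_class_def using eq by auto
    show "scale_class F (?i P) \<subseteq> pluckers (initial_fin M u)"
    proof
      fix Q assume "Q \<in> scale_class F (?i P)"
      then obtain c where c: "c \<in> carrier F" "Q = (\<lambda>I. tmul F (Some c) (?i P I))"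
        unfolding scale_class_def by auto
      then have "Q = ?i (\<lambda>I. tmul (trop_ext F) (Some (c, 0)) (P I))" using eq[of "(c, 0)"] by simp
      moreover have "(\<lambda>I. tmul (trop_ext F) (Some (c, 0)) (P I)) \<in> scale_class (trop_ext F) P"
        unfolding scale_class_def using c(1) by auto
      ultimately show "Q \<in> pluckers (initial_fin M u)"
        unfolding initial_fin_def assms by simp
    qed
  qed
qed

text \<open>Replaces the definite descriptions in \<open>initial\<close> by a Pluecker vector
  \<open>Q\<close> of the contraction, with the strength of \<open>P\<close>. Circuits are zero on
  the coloops \<open>Z\<close>, so covectors are tested on the complement only. The arbitrary values
  of \<open>u\<close> on \<open>Z\<close> never enter, as only sums over subsets of the complement
  occur.\<close>

lemma initial_obtain:
  fixes M :: "('e::linorder, 'a \<times> 'g::linordered_ab_group_add) fmatroid" and v :: "'e \<Rightarrow> 'g option"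
  assumes P: "is_plucker k (trop_ext F) (ground M) (rk M) P" and E: "finite (ground M)"
    and M: "pluckers M = scale_class (trop_ext F) P"
  defines "Z \<equiv> {i \<in> ground M. v i = None}" and "u \<equiv> \<lambda>i. the (v i)"
  obtains K r' Q where "K \<subseteq> Z" "rk M = card K + r'" "Q = minor_plucker (trop_ext F) K (ground M - Z) P"
    "is_plucker k (trop_ext F) (ground M - Z) r' Q"
    "\<And>B. P B \<noteq> None \<Longrightarrow> card (B \<inter> Z) \<le> card K"
    "is_fmatroid Weak F (initial F M v)"
    "\<And>X. X \<in> covectors F (initial F M v) \<longleftrightarrow> X \<in> tuples F (ground M) \<and>
      covec F (ground M - Z) r' (initial_plucker (ground M - Z) r' u Q) (\<lambda>i. tconj F (X i))"
proof -
  interpret T: tract "trop_ext F :: ('a \<times> 'g) tract" by (rule tract_trop_ext)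
  let ?E = "ground M" and ?S = "ground M - Z"
  have Z: "Z \<subseteq> ?E" "finite Z" using E by (auto simp: Z_def)
  obtain K r' where K: "K \<subseteq> Z" "rk M = card K + r'" "\<And>B. P B \<noteq> None \<Longrightarrow> card (B \<inter> Z) \<le> card K"
    and Q: "is_plucker k (trop_ext F) ?S r' (minor_plucker (trop_ext F) K ?S P)"
    and c: "contract (trop_ext F) M Z = \<lparr>ground = ?S, rk = r',
       pluckers = scale_class (trop_ext F) (minor_plucker (trop_ext F) K ?S P)\<rparr>"
    by (rule T.contract_obtain[OF P E M Z(1)]) blast
  let ?Q = "minor_plucker (trop_ext F) K ?S P"
  let ?C = "contract (trop_ext F) M Z"
  let ?I = "initial_plucker ?S r' u ?Q"
  let ?N = "initial_fin ?C u"
  have Csel: "ground ?C = ?S" "rk ?C = r'" "pluckers ?C = scale_class (trop_ext F) ?Q" by (simp_all add: c)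
  have N: "ground ?N = ?S" "rk ?N = r'" "pluckers ?N = scale_class F ?I"
    using pluckers_initial_fin[of ?C ?Q u, OF Csel(3)] unfolding Csel by (simp_all add: initial_fin_def c)
  have "weak_plucker F ?S r' ?I"
    using plucker_weak[OF _ is_plucker_initial[OF Q]] E by simp
  then have wI: "weak_plucker_fun F ?S r' ?I"
    using tract_axioms E by (simp add: weak_plucker_fun_def weak_plucker_fun_axioms_def)
  interpret I: weak_plucker_fun F ?S r' ?I by (rule wI)
  have ini: "initial F M v = add_coloops F ?N Z"
    by (simp add: initial_def Z_def u_def Let_def)
  have "Z \<inter> ?S = {}" by auto
  note co = add_coloops[OF wI Z(2) this N]
  have g: "?S \<union> Z = ?E" using Z by auto
  have cov: "X \<in> covectors F (initial F M v) \<longleftrightarrow> X \<in> tuples F ?E \<and>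
      covec F ?S r' ?I (\<lambda>i. tconj F (X i))" for X
  proof -
    have "X \<in> covectors F (initial F M v) \<longleftrightarrow> X \<in> perp F ?E (circuits F ?N)"
      unfolding ini covectors_def co(2,3) g by simp
    then show ?thesis
      using perp_circuits_iff[of ?I ?N ?E X, OF I.P_closed N(3) E] N by auto
  qed
  show ?thesis
    by (rule that[OF K(1,2) refl Q K(3) _ cov]) (use co(1) ini in auto)
qed

text \<open>\<open>strong_rel\<close> asks for pairings in rank 2 with a covector that has no zero.
  Its valuation is a finite weight, so its leading part is a covector of the initial vector without
  any contraction, and \<open>perfect_pairing_trop_ext\<close> supplies the pairing.\<close>

lemma perfect_imp_strong_trop_ext:
  fixes P :: "'e::linorder set \<Rightarrow> ('a \<times> 'g::linordered_ab_group_add) option"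
  assumes perfect: "perfect k F" and P: "is_plucker k (trop_ext F) E r P" and E: "finite E"
  shows "strong_plucker (trop_ext F) E r P"
proof (cases k)
  case Strong
  then show ?thesis using P by simp
next
  case Weak
  interpret T: tract "trop_ext F :: ('a \<times> 'g) tract" by (rule tract_trop_ext)
  interpret P: weak_plucker_fun "trop_ext F" E r P
    by (rule T.weak_plucker_funI[OF E P])
  have "formal_sum (\<lambda>i. tmul (trop_ext F) (W i) (Y i)) S \<in> null (trop_ext F)"
    if S: "finite S" and Q: "weak_plucker (trop_ext F) S 2 Q" and W: "\<And>i. W i \<in> elems (trop_ext F)"
      and Y: "\<And>i. Y i \<in> elems (trop_ext F)" and W0: "\<And>i. i \<in> S \<Longrightarrow> W i \<noteq> None"
      and cov: "covec (trop_ext F) S 2 Q W" and vec: "vec (trop_ext F) S 2 Q Y"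
    for S :: "'e set" and Q W Y
  proof -
    define u where "u i = the (val (W i))" for i
    have val: "val (W i) = Some (u i)" if "i \<in> S" for i
      using W0[OF that] by (auto simp: u_def val_def)
    have pf: "plucker_fun (trop_ext F) S 2 Q" using Q unfolding weak_plucker_def by blast
    have "covec F S 2 (initial_plucker S 2 u Q) (\<lambda>i. lead (u i) (W i))"
      using val by (intro covec_initial[OF pf S _ cov]) (simp add: val_ge_val)
    then have "covec F S 2 (initial_plucker S 2 u Q) (\<lambda>i. theta (W i))"
      using covec_cong[of S "\<lambda>i. lead (u i) (W i)" "\<lambda>i. theta (W i)"] lead_val[OF val] by blast
    then show ?thesis
      using Q Weak W Y val vec by (intro perfect_pairing_trop_ext[OF perfect _ S _ _ val]) auto
  qed
  then show ?thesis by (intro P.strong_plucker_of_strong_rel P.strong_rel) blast+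
qed

text \<open>In one direction the zeros of \<open>X\<close> are contracted and leading terms are
  taken. In the other, a fundamental circuit of \<open>M\<close> restricted to the support
  \<open>S\<close> of \<open>X\<close> is a vector of the contraction, and it pairs to a null sum
  with \<open>X\<close> as soon as the leading part of \<open>X\<close> is a covector.\<close>

lemma covectors_trop_ext:
  fixes M :: "('e::linorder, 'a \<times> 'g::linordered_ab_group_add) fmatroid"
  assumes M: "is_fmatroid k (trop_ext F) M" and X: "X \<in> tuples (trop_ext F) (ground M)"
  shows "X \<in> covectors (trop_ext F) M \<Longrightarrow> theta \<circ> X \<in> covectors F (initial F M (val \<circ> X))"
    and "perfect k F \<Longrightarrow> theta \<circ> X \<in> covectors F (initial F M (val \<circ> X))
      \<Longrightarrow> X \<in> covectors (trop_ext F) M"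
proof -
  interpret T: tract "trop_ext F :: ('a \<times> 'g) tract" by (rule tract_trop_ext)
  let ?E = "ground M" and ?r = "rk M" and ?T = "trop_ext F :: ('a \<times> 'g) tract"
  obtain P where P: "is_plucker k ?T ?E ?r P" and MP: "pluckers M = scale_class ?T P" and E: "finite ?E"
    using M unfolding is_fmatroid_def by auto
  interpret P: weak_plucker_fun ?T ?E ?r P
    by (rule T.weak_plucker_funI[OF E P])
  define Z where "Z = {i \<in> ?E. (val \<circ> X) i = None}"
  define S where "S = ?E - Z"
  define u where "u = (\<lambda>i. the ((val \<circ> X) i))"
  obtain K r' Q where K: "K \<subseteq> Z" "?r = card K + r'" and Q_def: "Q = minor_plucker ?T K S P"
    and Q: "is_plucker k ?T S r' Q" and max: "\<And>B. P B \<noteq> None \<Longrightarrow> card (B \<inter> Z) \<le> card K"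
    and cov_iff: "\<And>X'. X' \<in> covectors F (initial F M (val \<circ> X)) \<longleftrightarrow> X' \<in> tuples F ?E \<and>
      covec F S r' (initial_plucker S r' u Q) (\<lambda>i. tconj F (X' i))"
    unfolding Z_def S_def u_def by (rule initial_obtain[OF P E MP, of "val \<circ> X"]) blast
  define W where "W i = tconj ?T (X i)" for i
  have Xc: "X i \<in> elems ?T" for i using X unfolding tuples_def by (cases "i \<in> ?E") auto
  have Wc: "W i \<in> elems ?T" for i using Xc by (simp add: W_def)
  have WZ: "W i = None" if "i \<in> Z" for i using that by (simp add: W_def Z_def)
  have WS: "val (W i) = Some (u i)" if "i \<in> S" for i
    using that by (cases "val (X i)") (auto simp: W_def Z_def S_def u_def)
  have S: "finite S" "S \<subseteq> ?E" "Z \<subseteq> ?E" "K \<inter> S = {}" "finite K" "finite Z"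
    using E K by (auto simp: S_def Z_def intro: finite_subset)
  have \<theta>X: "theta \<circ> X \<in> tuples F ?E" using X Xc by (auto simp: tuples_def)
  have \<theta>W: "theta (W i) = tconj F ((theta \<circ> X) i)" for i by (simp add: W_def theta_tconj)
  have iff: "theta \<circ> X \<in> covectors F (initial F M (val \<circ> X)) \<longleftrightarrow>
      covec F S r' (initial_plucker S r' u Q) (\<lambda>i. theta (W i))"
    unfolding cov_iff \<theta>W using \<theta>X by simp
  have iffX: "X \<in> covectors ?T M \<longleftrightarrow> covec ?T ?E ?r P W"
    using T.covectors_iff[OF P MP E] X by (simp add: W_def[abs_def])
  have Qf: "plucker_fun ?T S r' Q" using T.plucker_weak[OF S(1) Q] unfolding weak_plucker_def by blast
  show "theta \<circ> X \<in> covectors F (initial F M (val \<circ> X))" if "X \<in> covectors ?T M"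
  proof -
    have "covec ?T S r' Q W"
      unfolding Q_def using that iffX K S Wc WZ
      by (intro T.covec_minor[where E = ?E and r = ?r]) auto
    then have "covec F S r' (initial_plucker S r' u Q) (\<lambda>i. lead (u i) (W i))"
      using WS by (intro covec_initial[OF Qf S(1)]) (simp_all add: val_ge_val)
    then show ?thesis
      unfolding iff using covec_cong[of S "\<lambda>i. lead (u i) (W i)" "\<lambda>i. theta (W i)"] lead_val[OF WS] by blast
  qed
  show "X \<in> covectors ?T M" if perfect: "perfect k F"
    and "theta \<circ> X \<in> covectors F (initial F M (val \<circ> X))"
  proof -
    have strong: "strong_plucker ?T ?E ?r P" using perfect_imp_strong_trop_ext[OF perfect P E] .
    have cov: "covec F S r' (initial_plucker S r' u Q) (\<lambda>i. theta (W i))" using that iff by blast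
    show ?thesis
      unfolding iffX covec_def
    proof
      fix J assume "J \<in> nsets ?E (Suc ?r)"
      then have J: "J \<subseteq> ?E" "finite J" "card J = Suc ?r" by (auto simp: nsets_def)
      define Y where "Y i = (if i \<in> J then signed ?T (eps J i) (P (J - {i})) else None)" for i
      have Yc: "Y i \<in> elems ?T" for i by (simp add: Y_def)
      \<comment> \<open>The sum for \<open>I\<close> is, up to a common sign, the relation of
        \<open>P\<close> for \<open>K \<union> I\<close> and \<open>J\<close>, which may have many
        terms; this is where the relations of a strong vector enter.\<close>
      have vec: "vec ?T S r' Q Y"
        unfolding vec_def
      proof (intro allI impI)
        fix I assume I: "I \<subseteq> S" "Suc (card I) = r'"
        have fI: "finite I" using I S finite_subset by blast
        have "K \<inter> I = {}" using I S by auto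
        then have KI: "K \<union> I \<subseteq> ?E" "Suc (card (K \<union> I)) = ?r"
          using I S K fI card_Un_disjoint[of K I] by auto
        let ?g = "\<lambda>j. signed ?T (eps J j + eps (K \<union> I) j) (tmul ?T (P (insert j (K \<union> I))) (P (J - {j})))"
        let ?D = "J \<inter> S - I"
        have "plucker_rel ?T P (K \<union> I) J"
          using strong KI J unfolding strong_plucker_def by blast
        then have "formal_sum ?g (J - (K \<union> I)) \<in> null ?T"
          using T.plucker_rel_iff[of "K \<union> I" J P] J(2) fI S by simp
        moreover have "formal_sum ?g (J - (K \<union> I)) = formal_sum ?g ?D"
        proof (rule formal_sum_mono_neutral)
          show "?D \<subseteq> J - (K \<union> I)" using S by auto
          \<comment> \<open>Here \<open>j\<close> is a zero of \<open>X\<close> outside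
            \<open>K\<close>. A basis containing \<open>K\<close> and \<open>j\<close> would meet
            \<open>Z\<close> in more than \<open>card K\<close> elements, so the coordinate at
            \<open>insert j (K \<union> I)\<close> vanishes.\<close>
          fix j assume j: "j \<in> J - (K \<union> I) - ?D"
          then have jZ: "j \<in> Z" "j \<notin> K" "j \<notin> I" using J(1) by (auto simp: S_def)
          have "insert j K \<subseteq> insert j (K \<union> I) \<inter> Z" using jZ K by auto
          then have "card (insert j K) \<le> card (insert j (K \<union> I) \<inter> Z)"
            using S by (intro card_mono) auto
          then have "P (insert j (K \<union> I)) = None"
            using max[of "insert j (K \<union> I)"] jZ S by (cases "P (insert j (K \<union> I))") auto
          then show "?g j = None" by simp
        qed
        moreover have "vec_sum ?T S Q Y I
            = formal_sum (\<lambda>i. signed ?T (eps I i) (tmul ?T (Q (insert i I)) (Y i))) ?D"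
          by (rule formal_sum_mono_neutral) (auto simp: Y_def)
        moreover have "formal_sum (\<lambda>i. signed ?T (eps I i) (tmul ?T (Q (insert i I)) (Y i))) ?D
            = formal_sum (\<lambda>i. signed ?T (\<Sum>b\<in>I. eps K b) (?g i)) ?D"
        proof (rule formal_sum_cong)
          fix i assume i: "i \<in> ?D"
          have Qi: "Q (insert i I) = signed ?T (eps K i + (\<Sum>b\<in>I. eps K b)) (P (insert i (K \<union> I)))"
            using i I fI by (simp add: Q_def minor_plucker_def)
          have e: "eps (K \<union> I) i = eps K i + eps I i"
            using I S fI by (intro eps_union) auto
          have Yi: "Y i = signed ?T (eps J i) (P (J - {i}))" using i by (simp add: Y_def)
          show "signed ?T (eps I i) (tmul ?T (Q (insert i I)) (Y i)) = signed ?T (\<Sum>b\<in>I. eps K b) (?g i)"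
            unfolding Qi Yi e
            by (simp add: T.signed_simps add.commute add.left_commute)
        qed
        ultimately show "vec_sum ?T S Q Y I \<in> null ?T"
          using J(2) by (simp add: T.formal_sum_signed)
      qed
      have "formal_sum (\<lambda>i. tmul ?T (W i) (Y i)) S \<in> null ?T"
        by (rule perfect_pairing_trop_ext[OF perfect Q S(1) Wc Yc WS cov vec])
      moreover have "formal_sum (\<lambda>i. tmul ?T (W i) (Y i)) S = formal_sum (\<lambda>i. tmul ?T (W i) (Y i)) (J \<inter> S)"
        by (rule formal_sum_mono_neutral) (auto simp: Y_def)
      moreover have "covec_sum ?T P W J
          = formal_sum (\<lambda>i. signed ?T (eps J i) (tmul ?T (P (J - {i})) (W i))) (J \<inter> S)"
        using J(1) WZ by (intro formal_sum_mono_neutral) (auto simp: S_def)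
      moreover have "formal_sum (\<lambda>i. signed ?T (eps J i) (tmul ?T (P (J - {i})) (W i))) (J \<inter> S)
          = formal_sum (\<lambda>i. tmul ?T (W i) (Y i)) (J \<inter> S)"
      proof (rule formal_sum_cong)
        fix i assume "i \<in> J \<inter> S"
        then show "signed ?T (eps J i) (tmul ?T (P (J - {i})) (W i)) = tmul ?T (W i) (Y i)"
          using Wc T.tmul_comm[of "W i" "P (J - {i})"] by (simp add: Y_def T.tmul_signed_right)
      qed
      ultimately show "covec_sum ?T P W J \<in> null ?T"
        by simp
    qed
  qed
qed

text \<open>\<open>coinitial\<close> is the dual of an initial matroid of the dual, so its vectors
  are covectors of a double dual. Biduality applies because that initial matroid is a weak matroid
  by \<open>initial_obtain\<close>.\<close>

lemma covectors_coinitial_dual: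
  fixes M :: "('e::linorder, 'a \<times> 'g::linordered_ab_group_add) fmatroid"
  assumes "is_fmatroid k (trop_ext F) M"
  shows "vectors F (coinitial F M v) = covectors F (initial F (dual (trop_ext F) M) v)"
proof -
  interpret T: tract "trop_ext F :: ('a \<times> 'g) tract" by (rule tract_trop_ext)
  let ?D = "dual (trop_ext F) M"
  have "is_fmatroid k (trop_ext F) ?D" using assms by (rule T.fmatroid_dual)
  then obtain P where P: "is_plucker k (trop_ext F) (ground ?D) (rk ?D) P"
    "pluckers ?D = scale_class (trop_ext F) P" "finite (ground ?D)"
    unfolding is_fmatroid_def by auto
  have "is_fmatroid Weak F (initial F ?D v)"
    by (rule initial_obtain[OF P(1,3,2), of v])
  then show ?thesis
    by (simp add: vectors_eq_covectors_dual coinitial_def dual_dual)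
qed

lemma covectors_subset_tuples: "covectors F M \<subseteq> tuples F (ground M)"
  by (auto simp: covectors_def perp_def)

end

theorem proposition3p14:
  fixes F :: "'a tract"
    and M :: "('e::linorder, 'a \<times> 'g::linordered_ab_group_add) fmatroid"
    and k :: strength
  assumes "tract F"
    and "is_fmatroid k (trop_ext F) M"
    and "1 \<le> rk M"
  shows "vectors (trop_ext F) M \<subseteq>
           {Y \<in> tuples (trop_ext F) (ground M).
              theta \<circ> Y \<in> vectors F (coinitial F M (val \<circ> Y))} \<and>
         covectors (trop_ext F) M \<subseteq>
           {X \<in> tuples (trop_ext F) (ground M).
              theta \<circ> X \<in> covectors F (initial F M (val \<circ> X))} \<and>
         (perfect k F \<longrightarrow>
           vectors (trop_ext F) M =
             {Y \<in> tuples (trop_ext F) (ground M).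
                theta \<circ> Y \<in> vectors F (coinitial F M (val \<circ> Y))} \<and>
           covectors (trop_ext F) M =
             {X \<in> tuples (trop_ext F) (ground M).
                theta \<circ> X \<in> covectors F (initial F M (val \<circ> X))})"
proof -
  interpret tract F by fact
  interpret T: tract "trop_ext F :: ('a \<times> 'g) tract" by (rule tract_trop_ext)
  let ?T = "trop_ext F :: ('a \<times> 'g) tract"
  let ?R = "\<lambda>N :: ('e, 'a \<times> 'g) fmatroid. {X \<in> tuples ?T (ground N). theta \<circ> X \<in> covectors F (initial F N (val \<circ> X))}"
  have sub: "covectors ?T N \<subseteq> ?R N" if "is_fmatroid k ?T N" for N
    using covectors_trop_ext(1)[OF that] T.covectors_subset_tuples[of N] by blast
  have eq: "perfect k F \<longrightarrow> covectors ?T N = ?R N" if "is_fmatroid k ?T N" for N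
    using sub[OF that] covectors_trop_ext(2)[OF that] by blast
  have dual: "is_fmatroid k ?T (dual ?T M)" using assms(2) by (rule T.fmatroid_dual)
  show ?thesis
    using sub[OF assms(2)] eq[OF assms(2)] sub[OF dual] eq[OF dual]
    unfolding T.vectors_eq_covectors_dual covectors_coinitial_dual[OF assms(2)] T.dual_simps
    by blast
qed

end
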